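(* Let $\Omega\subset X$ be a nonempty bounded open set such that: (i) $\limsup_{r\to0}\frac{\mu(B(x,r)\setminus\Omega)}{\mu(B(x,r))}>0$ for $\mathcal H$-a.e. $x\in\partial\Omega$; (ii) for every $u\in\mathrm{BV}(\Omega)$ the trace $Tu(x)$ exists for $\mathcal H$-a.e. $x\in\partial^*\Omega$; (iii) there is $C_A\ge1$ such that $\frac1{C_A}\frac{\mu(B(x,r))}{r}\le\mathcal H(B(x,r)\cap\partial\Omega)\le C_A\frac{\mu(B(x,r))}{r}$ for every $x\in\partial\Omega$ and every $0<r\le\operatorname{diam}(\Omega)$. Let $f\in L^1(\partial^*\Omega,P(\Omega,\cdot))$ with $-1\le f\le 1$ and $\int_{\partial^*\Omega}f\,dP(\Omega,\cdot)=0$. If $E_i\subset\Omega$, $i\in\mathbb N$, are such that $P(E_i,\Omega)<\infty$ and $\chi_{E_i}\to\chi_E$ in $L^1(\Omega)$, then $$I(\chi_E)\le\liminf_{i\to\infty}I(\chi_{E_i})\quad\text{and}\quad I(-\chi_E)\le\liminf_{i\to\infty}I(-\chi_{E_i}).$$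
   Context: Setting. $(X,d,\mu)$ is a complete metric space with at least two points, with a Borel regular outer measure $\mu$ that is doubling: there is $C_d\ge 1$ with $0<\mu(B(x,2r))\le C_d\,\mu(B(x,r))<\infty$ for all balls. A Borel function $g\ge 0$ is an upper gradient of $u$ if $|u(x)-u(y)|\le\int_\gamma g\,ds$ for every nonconstant rectifiable curve $\gamma$ with end points $x,y$ (the left side is $\infty$ if $u(x)$ or $u(y)$ is infinite); for functions on an open set $U$ only curves in $U$ are considered. $X$ supports a $(1,1)$-Poincaré inequality: there are $C_P>0$, $\lambda\ge 1$ such that for all balls $B(x,r)$, all locally integrable $u$ on $X$ and all upper gradients $g$ of $u$, $\frac1{\mu(B(x,r))}\int_{B(x,r)}|u-u_{B(x,r)}|\,d\mu\le \frac{C_P r}{\mu(B(x,\lambda r))}\int_{B(x,\lambda r)}g\,d\mu$, where $u_{B}$ is the mean of $u$ over $B$. BV functions. For $U\subset X$ open and $u\in L^1_{\rm loc}(U)$, $\|Du\|(U)=\inf\{\liminf_i\int_U g_{u_i}\,d\mu\}$, the infimum over $u_i\in \mathrm{Lip}_{\rm loc}(U)$ (Lipschitz on every open $U'$ with $\overline{U'}$ compact in $U$) with $u_i\to u$ in $L^1_{\rm loc}(U)$ and $g_{u_i}$ an upper gradient of $u_i$ in $U$; for arbitrary $A$, $\|Du\|(A)=\inf\{\|Du\|(U):U\supset A\text{ open}\}$. $u\in\mathrm{BV}(U)$ means $u\in L^1(U)$ and $\|Du\|(U)<\infty$. For $\mu$-measurable $E$, $P(E,A)=\|D\chi_E\|(A)$.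 (Condition (iii) implies $\mathcal H(\partial\Omega)<\infty$ and hence $P(\Omega,X)<\infty$.) $\mathcal H$ is the codimension 1 Hausdorff measure: $\mathcal H(A)=\lim_{R\to0}\inf\{\sum_i \mu(B(x_i,r_i))/r_i: A\subset\bigcup_i B(x_i,r_i),\ r_i\le R\}$. The measure theoretic boundary $\partial^*E$ is the set of $x\in X$ with $\limsup_{r\to0}\mu(B(x,r)\cap E)/\mu(B(x,r))>0$ and $\limsup_{r\to 0}\mu(B(x,r)\setminus E)/\mu(B(x,r))>0$. For $u$ on $\Omega$ and $x\in\partial\Omega$, the number $Tu(x)$ is the trace of $u$ at $x$ if $\lim_{r\to0}\frac{1}{\mu(B(x,r)\cap\Omega)}\int_{B(x,r)\cap\Omega}|u-Tu(x)|\,d\mu=0$. Functional: $I(u)=\|Du\|(\Omega)+\int_{\partial^*\Omega}Tu\,f\,dP(\Omega,\cdot)$ for $u\in\mathrm{BV}(\Omega)$; convention: $I(\pm\chi_E)=+\infty$ for a $\mu$-measurable $E\subset\Omega$ with $P(E,\Omega)=\infty$. *)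

theory Defs
  imports "HOL-Analysis.Analysis"
begin

section \<open>Measures from outer measures\<close>

text \<open>The restriction of an outer measure to its Caratheodory measurable sets.\<close>

definition caratheodory_measure :: "('a set \<Rightarrow> ennreal) \<Rightarrow> 'a measure" where
  "caratheodory_measure m = measure_of UNIV (lambda_system UNIV UNIV m) m"

definition borel_regular_outer_measure :: "('a::topological_space set \<Rightarrow> ennreal) \<Rightarrow> bool" where
  "borel_regular_outer_measure m \<longleftrightarrow>
     outer_measure_space UNIV m \<and>
     sets borel \<subseteq> lambda_system UNIV UNIV m \<and>
     (\<forall>A. \<exists>B\<in>sets borel. A \<subseteq> B \<and> m B = m A)"

definition doubling :: "('a::metric_space set \<Rightarrow> ennreal) \<Rightarrow> bool" where
  "doubling m \<longleftrightarrow>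
     (\<exists>C\<ge>1::real. \<forall>x. \<forall>r>0.
        0 < m (ball x (2 * r)) \<and> m (ball x (2 * r)) \<le> ennreal C * m (ball x r) \<and>
        ennreal C * m (ball x r) < \<infinity>)"

section \<open>Curves and upper gradients\<close>

text \<open>Curves are parametrized by the unit interval (the library's \<open>path\<close>);
  \<open>curve_length \<gamma> t\<close> is the length of the restriction of \<open>\<gamma>\<close> to \<open>{0..t}\<close>.\<close>

definition curve_length :: "(real \<Rightarrow> 'a::metric_space) \<Rightarrow> real \<Rightarrow> ennreal" where
  "curve_length \<gamma> t =
     (SUP ts\<in>{ts. sorted ts \<and> set ts \<subseteq> {0..t}}.
        \<Sum>i<length ts - 1. ennreal (dist (\<gamma> (ts ! i)) (\<gamma> (ts ! Suc i))))"

definition rectifiable_curve :: "(real \<Rightarrow> 'a::metric_space) \<Rightarrow> bool" where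
  "rectifiable_curve \<gamma> \<longleftrightarrow> path \<gamma> \<and> curve_length \<gamma> 1 < \<infinity>"

definition nonconstant_curve :: "(real \<Rightarrow> 'a) \<Rightarrow> bool" where
  "nonconstant_curve \<gamma> \<longleftrightarrow> (\<exists>s\<in>{0..1}. \<exists>t\<in>{0..1}. \<gamma> s \<noteq> \<gamma> t)"

text \<open>Arc length parametrization: the choice of \<open>t\<close> is immaterial, because \<open>\<gamma>\<close> is constant
  on every interval on which its length function is constant.\<close>

definition arc_length_param :: "(real \<Rightarrow> 'a::metric_space) \<Rightarrow> real \<Rightarrow> 'a" where
  "arc_length_param \<gamma> s = \<gamma> (SOME t. t \<in> {0..1} \<and> curve_length \<gamma> t = ennreal s)"

definition curve_integral :: "(real \<Rightarrow> 'a::metric_space) \<Rightarrow> ('a \<Rightarrow> ennreal) \<Rightarrow> ennreal" where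
  "curve_integral \<gamma> g =
     (\<integral>\<^sup>+s\<in>{0..enn2real (curve_length \<gamma> 1)}. g (arc_length_param \<gamma> s) \<partial>lborel)"

text \<open>In type \<open>ereal\<close>, \<open>\<bar>a - b\<bar> = \<infinity>\<close> whenever \<open>a\<close> or \<open>b\<close> is infinite (also for \<open>a = b\<close>),
  which is exactly the convention required for infinite values of \<open>u\<close>.\<close>

definition upper_gradient_on ::
    "'a::metric_space set \<Rightarrow> ('a \<Rightarrow> ereal) \<Rightarrow> ('a \<Rightarrow> ennreal) \<Rightarrow> bool" where
  "upper_gradient_on U u g \<longleftrightarrow>
     g \<in> borel_measurable (restrict_space borel U) \<and>
     (\<forall>\<gamma>. rectifiable_curve \<gamma> \<and> nonconstant_curve \<gamma> \<and> path_image \<gamma> \<subseteq> U \<longrightarrow>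
        e2ennreal \<bar>u (pathstart \<gamma>) - u (pathfinish \<gamma>)\<bar> \<le> curve_integral \<gamma> g)"

section \<open>Local notions and the Poincare inequality\<close>

definition compactly_inside :: "'a::topological_space set \<Rightarrow> 'a set \<Rightarrow> bool" where
  "compactly_inside V U \<longleftrightarrow> open V \<and> compact (closure V) \<and> closure V \<subseteq> U"

definition locally_integrable ::
    "('a::metric_space set \<Rightarrow> ennreal) \<Rightarrow> ('a \<Rightarrow> ereal) \<Rightarrow> bool" where
  "locally_integrable m u \<longleftrightarrow>
     u \<in> borel_measurable (caratheodory_measure m) \<and>
     (\<forall>V. compactly_inside V UNIV \<longrightarrow>
        (\<integral>\<^sup>+x\<in>V. e2ennreal \<bar>u x\<bar> \<partial>caratheodory_measure m) < \<infinity>)"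

text \<open>A locally integrable function is finite almost everywhere, so its mean value is computed
  from its real part.\<close>

definition ball_mean ::
    "('a::metric_space set \<Rightarrow> ennreal) \<Rightarrow> ('a \<Rightarrow> ereal) \<Rightarrow> 'a \<Rightarrow> real \<Rightarrow> real" where
  "ball_mean m u x r =
     (LINT y:ball x r|caratheodory_measure m. real_of_ereal (u y)) / enn2real (m (ball x r))"

definition poincare_1_1 :: "('a::metric_space set \<Rightarrow> ennreal) \<Rightarrow> bool" where
  "poincare_1_1 m \<longleftrightarrow>
     (\<exists>C>0::real. \<exists>\<Lambda>\<ge>1::real. \<forall>x. \<forall>r>0. \<forall>u g.
        locally_integrable m u \<longrightarrow> upper_gradient_on UNIV u g \<longrightarrow>
        (\<integral>\<^sup>+y\<in>ball x r. e2ennreal \<bar>u y - ereal (ball_mean m u x r)\<bar> \<partial>caratheodory_measure m)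
            / m (ball x r)
          \<le> ennreal (C * r) / m (ball x (\<Lambda> * r))
              * (\<integral>\<^sup>+y\<in>ball x (\<Lambda> * r). g y \<partial>caratheodory_measure m))"

section \<open>Functions of bounded variation\<close>

definition lip_loc :: "'a::metric_space set \<Rightarrow> ('a \<Rightarrow> real) \<Rightarrow> bool" where
  "lip_loc U u \<longleftrightarrow> (\<forall>V. compactly_inside V U \<longrightarrow> (\<exists>L. L-lipschitz_on V u))"

definition converges_L1_loc ::
    "('a::metric_space set \<Rightarrow> ennreal) \<Rightarrow> 'a set \<Rightarrow> (nat \<Rightarrow> 'a \<Rightarrow> real) \<Rightarrow> ('a \<Rightarrow> real) \<Rightarrow> bool" where
  "converges_L1_loc m U us u \<longleftrightarrow>
     (\<forall>V. compactly_inside V U \<longrightarrow>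
        (\<lambda>i. \<integral>\<^sup>+x\<in>V. ennreal \<bar>us i x - u x\<bar> \<partial>caratheodory_measure m) \<longlonglongrightarrow> 0)"

definition total_variation_open ::
    "('a::metric_space set \<Rightarrow> ennreal) \<Rightarrow> ('a \<Rightarrow> real) \<Rightarrow> 'a set \<Rightarrow> ennreal" where
  "total_variation_open m u U =
     Inf {liminf (\<lambda>i. \<integral>\<^sup>+x\<in>U. g i x \<partial>caratheodory_measure m) | us g.
            (\<forall>i. lip_loc U (us i)) \<and>
            (\<forall>i. upper_gradient_on U (\<lambda>x. ereal (us i x)) (g i)) \<and>
            converges_L1_loc m U us u}"

text \<open>For open \<open>A\<close> only the values of \<open>u\<close> on \<open>A\<close> matter, so a function on an open set \<open>U\<close>
  may be represented by any extension to the whole type.\<close>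

definition total_variation ::
    "('a::metric_space set \<Rightarrow> ennreal) \<Rightarrow> ('a \<Rightarrow> real) \<Rightarrow> 'a set \<Rightarrow> ennreal" where
  "total_variation m u A =
     (if open A then total_variation_open m u A
      else (INF U\<in>{U. open U \<and> A \<subseteq> U}. total_variation_open m u U))"

definition BV_on :: "('a::metric_space set \<Rightarrow> ennreal) \<Rightarrow> 'a set \<Rightarrow> ('a \<Rightarrow> real) \<Rightarrow> bool" where
  "BV_on m U u \<longleftrightarrow>
     set_integrable (caratheodory_measure m) U u \<and> total_variation m u U < \<infinity>"

definition perimeter :: "('a::metric_space set \<Rightarrow> ennreal) \<Rightarrow> 'a set \<Rightarrow> 'a set \<Rightarrow> ennreal" where
  "perimeter m E A = total_variation m (indicator E) A"

text \<open>The perimeter \<open>P(E,\<cdot>)\<close> as a measure. When \<open>P(E,X) < \<infinity>\<close> it is the completion of a finite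
  Borel measure.\<close>

definition perimeter_measure :: "('a::metric_space set \<Rightarrow> ennreal) \<Rightarrow> 'a set \<Rightarrow> 'a measure" where
  "perimeter_measure m E = caratheodory_measure (perimeter m E)"

section \<open>Codimension 1 Hausdorff measure, measure theoretic boundary, traces\<close>

text \<open>Covers are countable and may be finite (whence the index set \<open>I\<close>); the radii are positive.\<close>

definition codim1_content ::
    "('a::metric_space set \<Rightarrow> ennreal) \<Rightarrow> real \<Rightarrow> 'a set \<Rightarrow> ennreal" where
  "codim1_content m R A =
     Inf {(\<Sum>i. if i \<in> I then m (ball (x i) (r i)) / ennreal (r i) else 0) |
            (I :: nat set) x r. A \<subseteq> (\<Union>i\<in>I. ball (x i) (r i)) \<and> (\<forall>i\<in>I. 0 < r i \<and> r i \<le> R)}"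

definition codim1_hausdorff :: "('a::metric_space set \<Rightarrow> ennreal) \<Rightarrow> 'a set \<Rightarrow> ennreal" where
  "codim1_hausdorff m A = Lim (at_right 0) (\<lambda>R. codim1_content m R A)"

definition measure_theoretic_boundary ::
    "('a::metric_space set \<Rightarrow> ennreal) \<Rightarrow> 'a set \<Rightarrow> 'a set" where
  "measure_theoretic_boundary m E =
     {x. Limsup (at_right 0) (\<lambda>r. m (ball x r \<inter> E) / m (ball x r)) > 0 \<and>
         Limsup (at_right 0) (\<lambda>r. m (ball x r - E) / m (ball x r)) > 0}"

definition is_trace ::
    "('a::metric_space set \<Rightarrow> ennreal) \<Rightarrow> 'a set \<Rightarrow> ('a \<Rightarrow> real) \<Rightarrow> 'a \<Rightarrow> real \<Rightarrow> bool" where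
  "is_trace m \<Omega> u x t \<longleftrightarrow>
     ((\<lambda>r. (\<integral>\<^sup>+y\<in>ball x r \<inter> \<Omega>. ennreal \<bar>u y - t\<bar> \<partial>caratheodory_measure m)
             / m (ball x r \<inter> \<Omega>)) \<longlongrightarrow> 0) (at_right 0)"

text \<open>At points of the boundary of an open set \<open>\<Omega>\<close> the trace is unique if it exists; the value is
  arbitrary where it does not exist.\<close>

definition trace_at ::
    "('a::metric_space set \<Rightarrow> ennreal) \<Rightarrow> 'a set \<Rightarrow> ('a \<Rightarrow> real) \<Rightarrow> 'a \<Rightarrow> real" where
  "trace_at m \<Omega> u x = (THE t. is_trace m \<Omega> u x t)"

text \<open>The Bochner integral is a real number, so \<open>I(u) = \<infinity>\<close> whenever the total variation of \<open>u\<close>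
  on \<open>\<Omega>\<close> is infinite. In particular \<open>I(\<plusminus>\<chi>\<^sub>E) = \<infinity>\<close> if \<open>P(E,\<Omega>) = \<infinity>\<close>.\<close>

definition functional_I ::
    "('a::metric_space set \<Rightarrow> ennreal) \<Rightarrow> 'a set \<Rightarrow> ('a \<Rightarrow> real) \<Rightarrow> ('a \<Rightarrow> real) \<Rightarrow> ereal" where
  "functional_I m \<Omega> f u =
     enn2ereal (total_variation m u \<Omega>) +
     ereal (LINT x:measure_theoretic_boundary m \<Omega>|perimeter_measure m \<Omega>. trace_at m \<Omega> u x * f x)"

end

(* Write T for the trace of chi_E and P(F,.) for perimeter measures. Gluing functions along Lipschitz
   cutoffs of small cost shows that P(F,.) charges neither sets of codimension 1 measure zero nor the
   part of the boundary of Omega where F has density zero: such points are covered by small balls B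
   with sum mu(B)/r bounded by a constant and mu(F Int B) <= eps mu(B). Hence, for E contained in Omega
   of finite perimeter in Omega and U open,
     P(E,U) = P(E, U Int Omega) + P(Omega, U Int {T = 1}),
   and Omega - E satisfies the same identity with {T = 0}.
   Averages of functions with values in {-1, 1} approximate f uniformly, and the functional is affine
   in f, so let f = 1 on A and f = -1 off A. By the identity, I(chi_E) + P(Omega, -A) is, up to a small
   error, P(E,W) + P(E,U1) + P(Omega - E,U2), where U1 and U2 are disjoint neighbourhoods of large
   compact parts of A and of its complement, and W is compactly inside Omega and disjoint from both.
   By superadditivity this sum is also a lower bound for every E_i, and each summand is lower
   semicontinuous. The claim for -chi_E is the one for chi_E with -f in place of f. *)
theory Submission
  imports Defs
begin

section \<open>Length of curves\<close>

text \<open>Since the variation is defined by relaxation, even its subadditivity over open sets has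
  to be proved. Approximations u and v on two open sets are blended by a cutoff
  \<open>\<eta>\<close> with upper gradient \<open>h\<close>; besides the two given gradients this
  costs the integral of |u - v| h over the transition region. If both approximate the same function,
  this term disappears in the limit, and the variation becomes an outer measure for which Borel sets
  are measurable. If they approximate chi_E and chi_F, and \<open>\<eta>\<close> is a maximum of
  bumps on balls B of radius r, the term is at most the sum of mu(3B Int ((E - F) Un (F - E))) / r.
  Everything about the boundary comes from estimating this one sum.

  The obstacle to lower semicontinuity is the sign of f: where f = -1, a boundary measure is
  subtracted. Passing to Omega - E exchanges {T = 1} and {T = 0}, so up to a constant the subtracted
  term becomes the added term for the complement. The bound |f| \<le> 1 is what lets a single copy
  of the interior perimeter near the boundary pay for either sign.\<close>

fun polygon_length :: "(real \<Rightarrow> 'a::metric_space) \<Rightarrow> real list \<Rightarrow> ennreal" where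
  "polygon_length \<gamma> (x # y # zs) = ennreal (dist (\<gamma> x) (\<gamma> y)) + polygon_length \<gamma> (y # zs)"
| "polygon_length \<gamma> _ = 0"

text \<open>The recursive form of the sum in \<open>curve_length\<close> lets partitions be cut and
  joined by induction.\<close>

lemma polygon_length_eq_sum:
  "polygon_length \<gamma> ts = (\<Sum>i<length ts - 1. ennreal (dist (\<gamma> (ts ! i)) (\<gamma> (ts ! Suc i))))"
proof (induction \<gamma> ts rule: polygon_length.induct)
  case (1 \<gamma> x y zs)
  then show ?case by (simp add: sum.lessThan_Suc_shift del: sum.lessThan_Suc)
qed auto

lemma polygon_length_append_ge:
  "polygon_length \<gamma> xs + polygon_length \<gamma> ys \<le> polygon_length \<gamma> (xs @ ys)"
proof (induction \<gamma> xs rule: polygon_length.induct)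
  case (1 \<gamma> x y zs)
  then show ?case by (simp add: add.assoc add_left_mono)
next
  case ("2_2" \<gamma> v)
  then show ?case by (cases ys) auto
qed auto

lemma polygon_length_append_Cons:
  "polygon_length \<gamma> (xs @ b # ys) = polygon_length \<gamma> (xs @ [b]) + polygon_length \<gamma> (b # ys)"
proof (induction \<gamma> xs rule: polygon_length.induct)
  case (1 \<gamma> x y zs)
  then show ?case by (simp add: add.assoc)
qed auto

lemma polygon_length_insert:
  "polygon_length \<gamma> (xs @ ys) \<le> polygon_length \<gamma> (xs @ b # ys)"
proof (induction \<gamma> xs rule: polygon_length.induct)
  case (1 \<gamma> x y zs)
  then show ?case by (simp add: add_left_mono)
next
  case ("2_1" \<gamma>)
  then show ?case by (cases ys) auto
next
  case ("2_2" \<gamma> v)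
  show ?case
  proof (cases ys)
    case (Cons y zs)
    have "ennreal (dist (\<gamma> v) (\<gamma> y)) \<le> ennreal (dist (\<gamma> v) (\<gamma> b)) + ennreal (dist (\<gamma> b) (\<gamma> y))"
      by (simp add: dist_triangle flip: ennreal_plus)
    then show ?thesis using Cons by (simp add: add_right_mono flip: add.assoc)
  qed auto
qed

lemma polygon_length_map: "polygon_length \<gamma> (map h ts) = polygon_length (\<lambda>x. \<gamma> (h x)) ts"
  by (induction "\<gamma>" ts rule: polygon_length.induct) auto

text \<open>\<open>curve_length\<close> always starts at parameter 0; additivity needs the length
  between two arbitrary parameters.\<close>

definition arc_len :: "(real \<Rightarrow> 'a::metric_space) \<Rightarrow> real \<Rightarrow> real \<Rightarrow> ennreal" where
  "arc_len \<gamma> a b = (SUP ts\<in>{ts. sorted ts \<and> set ts \<subseteq> {a..b}}. polygon_length \<gamma> ts)"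

lemma curve_length_eq_arc_len: "curve_length \<gamma> t = arc_len \<gamma> 0 t"
  by (simp add: curve_length_def arc_len_def polygon_length_eq_sum)

lemma polygon_length_le_arc_len:
  "sorted ts \<Longrightarrow> set ts \<subseteq> {a..b} \<Longrightarrow> polygon_length \<gamma> ts \<le> arc_len \<gamma> a b"
  by (auto simp: arc_len_def intro!: SUP_upper)

lemma dist_le_arc_len: "a \<le> b \<Longrightarrow> ennreal (dist (\<gamma> a) (\<gamma> b)) \<le> arc_len \<gamma> a b"
  using polygon_length_le_arc_len[of "[a, b]" a b \<gamma>] by simp

lemma arc_len_add:
  assumes "a \<le> b" "b \<le> c"
  shows "arc_len \<gamma> a b + arc_len \<gamma> b c = arc_len \<gamma> a c"
proof (rule antisym)
  define A where "A a b = {ts. sorted ts \<and> set ts \<subseteq> {a..b::real}}" for a b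
  have ne: "A a b \<noteq> {}" for a b by (auto simp: A_def intro!: exI[of _ "[]"])
  have L: "arc_len \<gamma> a b = (SUP ts\<in>A a b. polygon_length \<gamma> ts)" for a b
    by (simp add: arc_len_def A_def)
  have "arc_len \<gamma> a b + arc_len \<gamma> b c
      = (SUP xs\<in>A a b. SUP ys\<in>A b c. polygon_length \<gamma> xs + polygon_length \<gamma> ys)"
    unfolding L by (simp only: ennreal_SUP_add_left[OF ne, symmetric] ennreal_SUP_add_right[OF ne, symmetric])
  also have "\<dots> \<le> arc_len \<gamma> a c"
  proof (intro SUP_least)
    fix xs ys assume "xs \<in> A a b" "ys \<in> A b c"
    then have "sorted (xs @ ys)" "set (xs @ ys) \<subseteq> {a..c}"
      using assms by (force simp: A_def sorted_append)+
    then show "polygon_length \<gamma> xs + polygon_length \<gamma> ys \<le> arc_len \<gamma> a c"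
      using polygon_length_append_ge[of \<gamma> xs ys] polygon_length_le_arc_len[of "xs @ ys" a c \<gamma>] by auto
  qed
  finally show "arc_len \<gamma> a b + arc_len \<gamma> b c \<le> arc_len \<gamma> a c" .
next
  show "arc_len \<gamma> a c \<le> arc_len \<gamma> a b + arc_len \<gamma> b c"
    unfolding arc_len_def[of \<gamma> a c]
  proof (rule SUP_least)
    fix ts assume ts: "ts \<in> {ts. sorted ts \<and> set ts \<subseteq> {a..c}}"
    \<comment> \<open>Cut the partition at b. Inserting b does not shorten the polygon, and the
      enlarged polygon splits into one on each half.\<close>
    define xs where "xs = takeWhile (\<lambda>x. x \<le> b) ts"
    define ys where "ys = dropWhile (\<lambda>x. x \<le> b) ts"
    have tsxy: "ts = xs @ ys" by (simp add: xs_def ys_def)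
    have "\<forall>x\<in>set xs. x \<le> b" by (auto simp: xs_def dest: set_takeWhileD)
    moreover have "sorted xs" "sorted ys" "set xs \<subseteq> {a..c}" "set ys \<subseteq> {a..c}"
      using ts by (auto simp: tsxy sorted_append)
    ultimately have xs: "sorted (xs @ [b])" "set (xs @ [b]) \<subseteq> {a..b}"
      using assms by (auto simp: sorted_append)
    have "y \<ge> b" if "y \<in> set ys" for y
    proof (cases ys)
      case (Cons z zs)
      then have "\<not> z \<le> b" using hd_dropWhile[of "\<lambda>x. x \<le> b" ts] by (simp add: ys_def)
      moreover have "z \<le> y" using that Cons \<open>sorted ys\<close> by auto
      ultimately show ?thesis by simp
    qed (use that in auto)
    then have ys: "sorted (b # ys)" "set (b # ys) \<subseteq> {b..c}"
      using \<open>sorted ys\<close> \<open>set ys \<subseteq> _\<close> assms by (auto simp: subset_iff)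
    have "polygon_length \<gamma> ts \<le> polygon_length \<gamma> (xs @ [b]) + polygon_length \<gamma> (b # ys)"
      unfolding tsxy using polygon_length_insert polygon_length_append_Cons by metis
    also have "\<dots> \<le> arc_len \<gamma> a b + arc_len \<gamma> b c"
      using xs ys by (intro add_mono polygon_length_le_arc_len)
    finally show "polygon_length \<gamma> ts \<le> arc_len \<gamma> a b + arc_len \<gamma> b c" .
  qed
qed

lemma arc_len_refl: "arc_len \<gamma> a a = 0"
proof -
  have "polygon_length \<gamma> ts = 0" if "set ts \<subseteq> {a}" for ts
    using that by (induction \<gamma> ts rule: polygon_length.induct) auto
  then have "(SUP ts\<in>{ts. sorted ts \<and> set ts \<subseteq> {a..a}}. polygon_length \<gamma> ts) \<le> 0"
    by (intro SUP_least) auto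
  then show ?thesis by (simp add: arc_len_def)
qed

text \<open>The factor d may be 0: the semicontinuity lemmas below map [0,1] onto [0,t] and [t,1],
  which degenerate at the ends.\<close>

lemma arc_len_affine:
  assumes "0 \<le> d" "a \<le> b"
  shows "arc_len (\<lambda>x. \<gamma> (s + d * x)) a b = arc_len \<gamma> (s + d * a) (s + d * b)"
proof (cases "d = 0")
  case True
  have "polygon_length (\<lambda>x. \<gamma> s) ts = 0" for ts
    by (induction "(\<lambda>x::real. \<gamma> s)" ts rule: polygon_length.induct) auto
  then have "arc_len (\<lambda>x. \<gamma> s) a b \<le> 0" unfolding arc_len_def by (intro SUP_least) auto
  then show ?thesis using True by (simp add: arc_len_refl)
next
  case False
  then have d: "d > 0" using assms by simp
  show ?thesis
  proof (rule antisym)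
    show "arc_len (\<lambda>x. \<gamma> (s + d * x)) a b \<le> arc_len \<gamma> (s + d * a) (s + d * b)"
      unfolding arc_len_def[of _ a b]
    proof (rule SUP_least)
      fix ts assume "ts \<in> {ts. sorted ts \<and> set ts \<subseteq> {a..b}}"
      then have "sorted (map (\<lambda>x. s + d * x) ts)" "set (map (\<lambda>x. s + d * x) ts) \<subseteq> {s + d * a..s + d * b}"
        using d by (auto simp: sorted_map intro: sorted_wrt_mono_rel[rotated])
      from polygon_length_le_arc_len[OF this, of \<gamma>]
      show "polygon_length (\<lambda>x. \<gamma> (s + d * x)) ts \<le> arc_len \<gamma> (s + d * a) (s + d * b)"
        by (simp add: polygon_length_map)
    qed
    show "arc_len \<gamma> (s + d * a) (s + d * b) \<le> arc_len (\<lambda>x. \<gamma> (s + d * x)) a b"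
      unfolding arc_len_def[of \<gamma>]
    proof (rule SUP_least)
      fix ts assume ts: "ts \<in> {ts. sorted ts \<and> set ts \<subseteq> {s + d * a..s + d * b}}"
      let ?h = "\<lambda>x. (x - s) / d"
      have "sorted (map ?h ts)"
        using ts d by (auto simp: sorted_map intro!: sorted_wrt_mono_rel[of ts "(\<le>)"] divide_right_mono)
      moreover have "set (map ?h ts) \<subseteq> {a..b}"
        using ts d by (auto simp: pos_le_divide_eq pos_divide_le_eq algebra_simps)
      ultimately have "polygon_length (\<lambda>x. \<gamma> (s + d * x)) (map ?h ts) \<le> arc_len (\<lambda>x. \<gamma> (s + d * x)) a b"
        by (rule polygon_length_le_arc_len)
      moreover have "polygon_length (\<lambda>x. \<gamma> (s + d * x)) (map ?h ts) = polygon_length \<gamma> ts"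
        using d by (simp only: polygon_length_map) simp
      ultimately show "polygon_length \<gamma> ts \<le> arc_len (\<lambda>x. \<gamma> (s + d * x)) a b"
        by simp
    qed
  qed
qed

lemma polygon_length_continuous:
  assumes "path \<gamma>" "\<And>q. q \<in> set qs \<Longrightarrow> continuous_on {0..1} (h q) \<and> h q ` {0..1} \<subseteq> {0..1}"
  shows "continuous_on {0..1} (\<lambda>t. polygon_length (\<lambda>q. \<gamma> (h q t)) qs)"
  using assms(2)
proof (induction qs)
  case (Cons q qs)
  have c: "continuous_on {0..1} (\<lambda>t. \<gamma> (h p t))" if "p \<in> set (q # qs)" for p
    using assms(1) Cons.prems[OF that]
    by (intro continuous_on_compose2[of "{0..1}" \<gamma> "{0..1}" "h p"]) (simp_all add: path_def)
  show ?case
  proof (cases qs)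
    case (Cons p ps)
    have "continuous_on {0..1} (\<lambda>t. \<gamma> (h q t))" "continuous_on {0..1} (\<lambda>t. \<gamma> (h p t))"
      using c[of q] c[of p] Cons by simp_all
    then have "continuous_on {0..1} (\<lambda>t. ennreal (dist (\<gamma> (h q t)) (\<gamma> (h p t))))"
      by (intro continuous_on_ennreal continuous_intros)
    moreover have "continuous_on {0..1} (\<lambda>t. polygon_length (\<lambda>q. \<gamma> (h q t)) qs)"
      by (rule Cons.IH) (rule Cons.prems, simp)
    ultimately show ?thesis using Cons by (auto intro!: continuous_on_add_ennreal)
  qed auto
qed auto

text \<open>After rescaling, the lengths from 0 to t are suprema over the same partitions of [0,1]
  for all t, and each single polygon length is continuous in t.\<close>

lemma arc_len_lsc:
  assumes "path \<gamma>" "t0 \<in> {0..1}" "c < arc_len \<gamma> 0 t0"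
  shows "eventually (\<lambda>t. c < arc_len \<gamma> 0 t) (at t0 within {0..1})"
proof -
  have "arc_len \<gamma> 0 t0 = arc_len (\<lambda>q. \<gamma> (t0 * q)) 0 1"
    using arc_len_affine[of t0 0 1 \<gamma> 0] assms by simp
  then obtain qs where qs: "sorted qs" "set qs \<subseteq> {0..1}" "c < polygon_length (\<lambda>q. \<gamma> (t0 * q)) qs"
    using assms(3) by (auto simp: arc_len_def less_SUP_iff)
  have "continuous_on {0..1} (\<lambda>t. polygon_length (\<lambda>q. \<gamma> (t * q)) qs)"
    using assms(1) qs(2)
    by (intro polygon_length_continuous) (auto intro!: continuous_intros mult_le_one)
  then have "((\<lambda>t. polygon_length (\<lambda>q. \<gamma> (t * q)) qs) \<longlongrightarrow> polygon_length (\<lambda>q. \<gamma> (t0 * q)) qs) (at t0 within {0..1})"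
    using assms(2) by (auto simp: continuous_on_def)
  then have "eventually (\<lambda>t. c < polygon_length (\<lambda>q. \<gamma> (t * q)) qs) (at t0 within {0..1})"
    using qs(3) order_tendstoD by blast
  moreover have "eventually (\<lambda>t. t \<in> {0..1}) (at t0 within {0..1})"
    by (simp add: eventually_at_filter)
  ultimately show ?thesis
  proof eventually_elim
    case (elim t)
    then show ?case
      using polygon_length_le_arc_len[OF qs(1,2), of "\<lambda>q. \<gamma> (t * q)"] arc_len_affine[of t 0 1 \<gamma> 0]
      by simp
  qed
qed

lemma arc_len_lsc_right:
  assumes "path \<gamma>" "t0 \<in> {0..1}" "c < arc_len \<gamma> t0 1"
  shows "eventually (\<lambda>t. c < arc_len \<gamma> t 1) (at t0 within {0..1})"
proof -
  have "arc_len \<gamma> t0 1 = arc_len (\<lambda>q. \<gamma> (t0 + (1 - t0) * q)) 0 1"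
    using arc_len_affine[of "1 - t0" 0 1 \<gamma> t0] assms by simp
  then obtain qs where qs: "sorted qs" "set qs \<subseteq> {0..1}" "c < polygon_length (\<lambda>q. \<gamma> (t0 + (1 - t0) * q)) qs"
    using assms(3) by (auto simp: arc_len_def less_SUP_iff)
  have *: "0 \<le> t + (1 - t) * q \<and> t + (1 - t) * q \<le> 1" if "t \<in> {0..1}" "q \<in> {0..1}" for t q :: real
    using that mult_left_le[of q "1 - t"] by auto
  have "continuous_on {0..1} (\<lambda>t. polygon_length (\<lambda>q. \<gamma> (t + (1 - t) * q)) qs)"
    using assms(1)
  proof (rule polygon_length_continuous)
    fix q assume "q \<in> set qs"
    then have "q \<in> {0..1}" using qs(2) by blast
    then show "continuous_on {0..1} (\<lambda>t. t + (1 - t) * q) \<and> (\<lambda>t. t + (1 - t) * q) ` {0..1} \<subseteq> {0..1}"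
      using * by (auto intro!: continuous_intros)
  qed
  then have "((\<lambda>t. polygon_length (\<lambda>q. \<gamma> (t + (1 - t) * q)) qs) \<longlongrightarrow> polygon_length (\<lambda>q. \<gamma> (t0 + (1 - t0) * q)) qs) (at t0 within {0..1})"
    using assms(2) by (auto simp: continuous_on_def)
  then have "eventually (\<lambda>t. c < polygon_length (\<lambda>q. \<gamma> (t + (1 - t) * q)) qs) (at t0 within {0..1})"
    using qs(3) order_tendstoD by blast
  moreover have "eventually (\<lambda>t. t \<in> {0..1}) (at t0 within {0..1})"
    by (simp add: eventually_at_filter)
  ultimately show ?thesis
  proof eventually_elim
    case (elim t)
    then show ?case
      using polygon_length_le_arc_len[OF qs(1,2), of "\<lambda>q. \<gamma> (t + (1 - t) * q)"] arc_len_affine[of "1 - t" 0 1 \<gamma> t]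
      by simp
  qed
qed

locale rectifiable =
  fixes \<gamma> :: "real \<Rightarrow> 'a::metric_space"
  assumes rectifiable: "rectifiable_curve \<gamma>"
begin

definition len :: "real \<Rightarrow> real" where "len t = enn2real (curve_length \<gamma> t)"

lemma path: "path \<gamma>"
  using rectifiable by (simp add: rectifiable_curve_def)

lemma arc_len_finite:
  assumes "0 \<le> a" "a \<le> b" "b \<le> 1"
  shows "arc_len \<gamma> a b < \<infinity>"
proof -
  have "arc_len \<gamma> 0 a + (arc_len \<gamma> a b + arc_len \<gamma> b 1) = curve_length \<gamma> 1"
    using assms by (simp add: arc_len_add curve_length_eq_arc_len)
  then show ?thesis using rectifiable unfolding rectifiable_curve_def
    by (metis ennreal_add_eq_top infinity_ennreal_def top.not_eq_extremum)
qed

lemma ennreal_len: "t \<in> {0..1} \<Longrightarrow> ennreal (len t) = curve_length \<gamma> t"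
  using arc_len_finite[of 0 t] by (simp add: len_def curve_length_eq_arc_len)

lemma len_nonneg: "0 \<le> len t"
  by (simp add: len_def)

lemma len_0 [simp]: "len 0 = 0"
  by (simp add: len_def curve_length_eq_arc_len arc_len_refl)

lemma arc_len_eq:
  assumes "0 \<le> s" "s \<le> t" "t \<le> 1"
  shows "arc_len \<gamma> s t = ennreal (len t - len s)" "len s \<le> len t"
proof -
  have eq: "ennreal (len s) + arc_len \<gamma> s t = ennreal (len t)"
    using arc_len_add[of 0 s t \<gamma>] assms by (simp add: ennreal_len curve_length_eq_arc_len)
  obtain r where r: "arc_len \<gamma> s t = ennreal r" "0 \<le> r"
    using arc_len_finite[OF assms] by (metis ennreal_cases infinity_ennreal_def less_irrefl)
  have "len t = len s + r"
    using eq r by (simp add: len_nonneg flip: ennreal_plus)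
  then show "arc_len \<gamma> s t = ennreal (len t - len s)" "len s \<le> len t"
    using r by auto
qed

lemma dist_le_len: "0 \<le> s \<Longrightarrow> s \<le> t \<Longrightarrow> t \<le> 1 \<Longrightarrow> dist (\<gamma> s) (\<gamma> t) \<le> len t - len s"
  using dist_le_arc_len[of s t \<gamma>] by (simp add: arc_len_eq)

text \<open>The lengths from 0 and to 1 are both lower semicontinuous and have a constant sum.\<close>

lemma continuous_len: "continuous_on {0..1} len"
  unfolding continuous_on_def
proof (intro ballI order_tendstoI)
  fix t0 a :: real assume t0: "t0 \<in> {0..1}" and a: "a < len t0"
  show "eventually (\<lambda>t. a < len t) (at t0 within {0..1})"
  proof (cases "a < 0")
    case True
    then show ?thesis using len_nonneg by (intro always_eventually allI) (rule less_le_trans)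
  next
    case False
    have "ennreal a < arc_len \<gamma> 0 t0"
      using t0 a False by (simp add: arc_len_eq ennreal_less_iff)
    moreover have "eventually (\<lambda>t. t \<in> {0..1}) (at t0 within {0..1})"
      by (simp add: eventually_at_filter)
    ultimately show ?thesis using arc_len_lsc[OF path t0, of "ennreal a"] False
      by (auto elim: eventually_elim2 simp: arc_len_eq ennreal_less_iff)
  qed
next
  fix t0 a :: real assume t0: "t0 \<in> {0..1}" and a: "len t0 < a"
  show "eventually (\<lambda>t. len t < a) (at t0 within {0..1})"
  proof (cases "len 1 < a")
    case True
    moreover have "eventually (\<lambda>t. t \<in> {0..1}) (at t0 within {0..1})"
      by (simp add: eventually_at_filter)
    ultimately show ?thesis
      by (auto elim!: eventually_mono intro: le_less_trans arc_len_eq(2))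
  next
    case False
    have "ennreal (len 1 - a) < arc_len \<gamma> t0 1"
      using t0 a False by (simp add: arc_len_eq ennreal_less_iff)
    moreover have "eventually (\<lambda>t. t \<in> {0..1}) (at t0 within {0..1})"
      by (simp add: eventually_at_filter)
    ultimately show ?thesis using arc_len_lsc_right[OF path t0, of "ennreal (len 1 - a)"] False
      by (auto elim: eventually_elim2 simp: arc_len_eq ennreal_less_iff)
  qed
qed

lemma len_surj:
  assumes "\<sigma> \<in> {len s..len t}" "0 \<le> s" "s \<le> t" "t \<le> 1"
  obtains r where "r \<in> {s..t}" "len r = \<sigma>"
  using IVT'[of len s \<sigma> t] assms continuous_on_subset[OF continuous_len, of "{s..t}"] by fastforce

text \<open>The parameter picked by \<open>SOME\<close> has the same length as t, and the distance
  of two curve points is at most the difference of their lengths.\<close>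

lemma arc_length_param_len:
  assumes "t \<in> {0..1}"
  shows "arc_length_param \<gamma> (len t) = \<gamma> t"
proof -
  define r where "r = (SOME r. r \<in> {0..1} \<and> curve_length \<gamma> r = ennreal (len t))"
  have "r \<in> {0..1} \<and> curve_length \<gamma> r = ennreal (len t)"
    unfolding r_def by (rule someI[of _ t]) (use assms in \<open>simp add: ennreal_len\<close>)
  then have r: "r \<in> {0..1}" "len r = len t"
    by (auto simp: len_nonneg simp flip: ennreal_len)
  have "dist (\<gamma> r) (\<gamma> t) \<le> 0"
  proof (cases "r \<le> t")
    case True
    then show ?thesis using dist_le_len[of r t] r assms by simp
  next
    case False
    then show ?thesis using dist_le_len[of t r] r assms by (simp add: dist_commute)
  qed
  then have "\<gamma> r = \<gamma> t" by simp
  then show ?thesis by (simp add: arc_length_param_def r_def)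
qed

lemma arc_length_param_lipschitz: "1-lipschitz_on {0..len 1} (arc_length_param \<gamma>)"
proof -
  have "dist (arc_length_param \<gamma> x) (arc_length_param \<gamma> y) \<le> \<bar>x - y\<bar>"
    if "x \<in> {0..len 1}" "y \<in> {0..len 1}" for x y
  proof -
    have "x \<in> {len 0..len 1}" "y \<in> {len 0..len 1}" using that by simp_all
    then obtain s t where s: "s \<in> {0..1}" "len s = x" and t: "t \<in> {0..1}" "len t = y"
      by (metis len_surj order_refl zero_le_one)
    have "dist (\<gamma> s) (\<gamma> t) \<le> \<bar>len s - len t\<bar>"
    proof (cases "s \<le> t")
      case True
      then show ?thesis using dist_le_len[of s t] s t by auto
    next
      case False
      then show ?thesis using dist_le_len[of t s] s t by (auto simp: dist_commute)
    qed
    then show ?thesis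
      using s t by (metis arc_length_param_len)
  qed
  then show ?thesis by (auto simp: lipschitz_on_def dist_real_def)
qed

lemma curve_integral_eq:
  "curve_integral \<gamma> g = (\<integral>\<^sup>+\<sigma>\<in>{0..len 1}. g (arc_length_param \<gamma> \<sigma>) \<partial>lborel)"
  by (simp add: curve_integral_def len_def)

lemma arc_length_param_image:
  assumes "0 \<le> s" "s \<le> t" "t \<le> 1"
  shows "arc_length_param \<gamma> ` {len s..len t} \<subseteq> \<gamma> ` {s..t}"
proof
  fix x assume "x \<in> arc_length_param \<gamma> ` {len s..len t}"
  then obtain \<sigma> where "\<sigma> \<in> {len s..len t}" "x = arc_length_param \<gamma> \<sigma>" by auto
  moreover from this(1) obtain r where "r \<in> {s..t}" "len r = \<sigma>"
    using len_surj assms by blast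
  ultimately show "x \<in> \<gamma> ` {s..t}"
    using arc_length_param_len[of r] assms by auto
qed

text \<open>Since \<open>g\<close> is measurable on \<open>U\<close> only, the integrand is cut off
  to a parameter interval on which the curve stays in \<open>U\<close>.\<close>

lemma measurable_along:
  assumes g: "g \<in> borel_measurable (restrict_space borel U)"
    and st: "0 \<le> s" "s \<le> t" "t \<le> 1" and U: "\<gamma> ` {s..t} \<subseteq> U"
  shows "(\<lambda>\<sigma>. g (arc_length_param \<gamma> \<sigma>) * indicator {len s..len t} \<sigma> :: ennreal) \<in> borel_measurable borel"
proof -
  have "{len s..len t} \<subseteq> {0..len 1}"
    using st len_nonneg arc_len_eq(2)[of 0 s] arc_len_eq(2)[of t 1] by auto
  then have "continuous_on {len s..len t} (arc_length_param \<gamma>)"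
    using lipschitz_on_continuous_on[OF arc_length_param_lipschitz] continuous_on_subset by blast
  then have "arc_length_param \<gamma> \<in> borel_measurable (restrict_space borel {len s..len t})"
    by (rule borel_measurable_continuous_on_restrict)
  moreover have "arc_length_param \<gamma> ` {len s..len t} \<subseteq> U"
    using arc_length_param_image[OF st] U by blast
  ultimately have "arc_length_param \<gamma> \<in> restrict_space borel {len s..len t} \<rightarrow>\<^sub>M restrict_space borel U"
    by (intro measurable_restrict_space2) (auto simp: space_restrict_space)
  from measurable_compose[OF this g] show ?thesis
    by (subst (asm) borel_measurable_restrict_space_iff_ennreal) (auto simp: mult.commute)
qed

abbreviation restr :: "real \<Rightarrow> real \<Rightarrow> real \<Rightarrow> 'a" where
  "restr s t \<equiv> (\<lambda>x. \<gamma> (s + (t - s) * x))"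

text \<open>The arc length parametrization of a subcurve is that of the whole curve shifted by
  \<open>len s\<close>. Hence one fixed parametrization serves all subarcs, and their integrals add
  up.\<close>

lemma
  assumes st: "0 \<le> s" "s \<le> t" "t \<le> 1"
  shows rectifiable_subpath: "rectifiable (restr s t)"
    and curve_integral_subpath: "g \<in> borel_measurable (restrict_space borel U) \<Longrightarrow> \<gamma> ` {s..t} \<subseteq> U \<Longrightarrow>
      curve_integral (restr s t) g = (\<integral>\<^sup>+\<sigma>\<in>{len s..len t}. g (arc_length_param \<gamma> \<sigma>) \<partial>lborel)"
proof -
  have in01: "s + (t - s) * \<tau> \<in> {s..t}" if "\<tau> \<in> {0..1}" for \<tau>
    using st that mult_left_le[of \<tau> "t - s"] by auto
  have cl: "curve_length (restr s t) \<tau> = ennreal (len (s + (t - s) * \<tau>) - len s)" if "\<tau> \<in> {0..1}" for \<tau>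
    using arc_len_affine[of "t - s" 0 \<tau> \<gamma> s] st that in01[OF that]
    by (simp add: curve_length_eq_arc_len arc_len_eq)
  have "continuous_on {0..1} (restr s t)"
  proof (rule continuous_on_compose2[of "{0..1}" \<gamma>])
    show "continuous_on {0..1} \<gamma>" using path by (simp add: path_def)
    show "(\<lambda>x. s + (t - s) * x) ` {0..1} \<subseteq> {0..1}" using in01 st by fastforce
  qed (intro continuous_intros)
  then have "path (restr s t)" by (simp add: path_def)
  then show rec: "rectifiable (restr s t)"
    using cl[of 1] by (simp add: rectifiable_def rectifiable_curve_def)
  interpret S: rectifiable "restr s t" by (rule rec)
  have Slen: "S.len \<tau> = len (s + (t - s) * \<tau>) - len s" if "\<tau> \<in> {0..1}" for \<tau>
  proof -
    have "len s \<le> len (s + (t - s) * \<tau>)"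
      using in01[OF that] st by (intro arc_len_eq(2)) auto
    then show ?thesis by (simp only: S.len_def cl[OF that]) simp
  qed
  have arc: "arc_length_param (restr s t) \<sigma> = arc_length_param \<gamma> (len s + \<sigma>)" if "\<sigma> \<in> {0..len t - len s}" for \<sigma>
  proof -
    have "\<sigma> \<in> {S.len 0..S.len 1}" using that by (simp add: Slen)
    then obtain \<tau> where \<tau>: "\<tau> \<in> {0..1}" "S.len \<tau> = \<sigma>"
      by (metis S.len_surj order_refl zero_le_one)
    then have "s + (t - s) * \<tau> \<in> {0..1}" using in01[of \<tau>] st by auto
    moreover have "len s + \<sigma> = len (s + (t - s) * \<tau>)" using Slen[OF \<tau>(1)] \<tau>(2) by simp
    ultimately show ?thesis
      using arc_length_param_len[of "s + (t - s) * \<tau>"] S.arc_length_param_len[OF \<tau>(1)] \<tau>(2)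
      by (simp del: atLeastAtMost_iff)
  qed
  assume g: "g \<in> borel_measurable (restrict_space borel U)" and U: "\<gamma> ` {s..t} \<subseteq> U"
  have "curve_integral (restr s t) g
      = (\<integral>\<^sup>+\<sigma>. g (arc_length_param (restr s t) \<sigma>) * indicator {0..len t - len s} \<sigma> \<partial>lborel)"
    by (simp add: S.curve_integral_eq Slen)
  also have "\<dots> = (\<integral>\<^sup>+\<sigma>. g (arc_length_param \<gamma> (len s + 1 * \<sigma>)) * indicator {len s..len t} (len s + 1 * \<sigma>) \<partial>lborel)"
    by (intro nn_integral_cong) (auto simp: arc indicator_def)
  also have "\<dots> = (\<integral>\<^sup>+\<sigma>\<in>{len s..len t}. g (arc_length_param \<gamma> \<sigma>) \<partial>lborel)"
    using nn_integral_real_affine[OF measurable_along[OF g st U], of 1 "len s"] by simp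
  finally show "curve_integral (restr s t) g = (\<integral>\<^sup>+\<sigma>\<in>{len s..len t}. g (arc_length_param \<gamma> \<sigma>) \<partial>lborel)" .
qed

end

lemma nn_integral_atLeastAtMost_add:
  fixes a b c :: real and k :: "real \<Rightarrow> ennreal"
  assumes "a \<le> b" "b \<le> c" and k: "(\<lambda>x. k x * indicator {a..c} x) \<in> borel_measurable borel"
  shows "(\<integral>\<^sup>+x\<in>{a..b}. k x \<partial>lborel) + (\<integral>\<^sup>+x\<in>{b..c}. k x \<partial>lborel) = (\<integral>\<^sup>+x\<in>{a..c}. k x \<partial>lborel)"
proof -
  have *: "(\<lambda>x. k x * indicator B x) \<in> borel_measurable borel" if "B \<subseteq> {a..c}" "B \<in> sets borel" for B
  proof -
    have "(\<lambda>x. k x * indicator {a..c} x * indicator B x) \<in> borel_measurable borel"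
      using that by (intro borel_measurable_times_ennreal k) auto
    moreover have "(\<lambda>x. k x * indicator {a..c} x * indicator B x) = (\<lambda>x. k x * indicator B x)"
      using that by (auto simp: fun_eq_iff indicator_def)
    ultimately show ?thesis by simp
  qed
  have "(\<integral>\<^sup>+x\<in>{a..b}. k x \<partial>lborel) + (\<integral>\<^sup>+x\<in>{b..c}. k x \<partial>lborel)
      = (\<integral>\<^sup>+x. k x * indicator {a..b} x + k x * indicator {b..c} x \<partial>lborel)"
    using assms by (intro nn_integral_add[symmetric]) (auto intro!: *)
  also have "\<dots> = (\<integral>\<^sup>+x\<in>{a..c}. k x \<partial>lborel)"
  proof (intro nn_integral_cong_AE)
    show "AE x in lborel. k x * indicator {a..b} x + k x * indicator {b..c} x = k x * indicator {a..c} x"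
      using AE_lborel_singleton[of b] by eventually_elim (use assms in \<open>auto simp: indicator_def\<close>)
  qed
  finally show ?thesis .
qed

section \<open>Calculus of upper gradients\<close>

abbreviation ugrad :: "'a::metric_space set \<Rightarrow> ('a \<Rightarrow> real) \<Rightarrow> ('a \<Rightarrow> ennreal) \<Rightarrow> bool" where
  "ugrad U u g \<equiv> upper_gradient_on U (\<lambda>x. ereal (u x)) g"

lemma ugrad_def:
  "ugrad U u g \<longleftrightarrow> g \<in> borel_measurable (restrict_space borel U) \<and>
     (\<forall>\<gamma>. rectifiable \<gamma> \<and> nonconstant_curve \<gamma> \<and> path_image \<gamma> \<subseteq> U \<longrightarrow>
        ennreal \<bar>u (\<gamma> 0) - u (\<gamma> 1)\<bar> \<le> curve_integral \<gamma> g)"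
  by (simp add: upper_gradient_on_def pathstart_def pathfinish_def rectifiable_def e2ennreal_ereal)

text \<open>Expressed in the arc length of the whole curve, so that estimates for consecutive arcs
  can be added. The definition of an upper gradient excludes constant arcs, but for those the left
  side is 0.\<close>

lemma (in rectifiable) ugradD:
  assumes "ugrad U u g" "0 \<le> s" "s \<le> t" "t \<le> 1" "\<gamma> ` {s..t} \<subseteq> U"
  shows "ennreal \<bar>u (\<gamma> s) - u (\<gamma> t)\<bar> \<le> (\<integral>\<^sup>+\<sigma>\<in>{len s..len t}. g (arc_length_param \<gamma> \<sigma>) \<partial>lborel)"
proof (cases "nonconstant_curve (restr s t)")
  case True
  have "path_image (restr s t) \<subseteq> U"
  proof -
    have "s + (t - s) * x \<in> {s..t}" if "x \<in> {0..1}" for x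
      using assms that mult_left_le[of x "t - s"] by auto
    then show ?thesis using assms by (auto simp: path_image_def image_subset_iff)
  qed
  then have "ennreal \<bar>u (\<gamma> s) - u (\<gamma> t)\<bar> \<le> curve_integral (restr s t) g"
    using assms True rectifiable_subpath[of s t] by (auto simp: ugrad_def)
  then show ?thesis
    using assms curve_integral_subpath[of s t g U] by (simp add: ugrad_def)
next
  case False
  then have "restr s t 0 = restr s t 1" unfolding nonconstant_curve_def by (metis atLeastAtMost_iff order_refl zero_le_one)
  then have "\<gamma> s = \<gamma> t" by simp
  then show ?thesis by simp
qed

text \<open>It is enough to control short arcs up to an error \<open>\<epsilon>\<close> per unit of
  length: adding over a fine partition leaves a total error of \<open>\<epsilon>\<close> times the
  length of the curve, and \<open>\<epsilon>\<close> is arbitrary.\<close>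

lemma ugradI:
  assumes meas: "g \<in> borel_measurable (restrict_space borel U)"
    and step: "\<And>\<gamma> \<epsilon>. rectifiable \<gamma> \<Longrightarrow> path_image \<gamma> \<subseteq> U \<Longrightarrow> 0 < \<epsilon> \<Longrightarrow>
      \<exists>\<delta>>0. \<forall>s t. 0 \<le> s \<and> s \<le> t \<and> t \<le> 1 \<and> t - s < \<delta> \<longrightarrow>
        ennreal \<bar>w (\<gamma> s) - w (\<gamma> t)\<bar> \<le>
          (\<integral>\<^sup>+\<sigma>\<in>{rectifiable.len \<gamma> s..rectifiable.len \<gamma> t}. (g (arc_length_param \<gamma> \<sigma>) + ennreal \<epsilon>) \<partial>lborel)"
  shows "ugrad U w g"
  unfolding ugrad_def
proof (intro conjI allI impI meas)
  fix \<gamma> assume *: "rectifiable \<gamma> \<and> nonconstant_curve \<gamma> \<and> path_image \<gamma> \<subseteq> U"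
  then interpret rectifiable \<gamma> by simp
  have im: "path_image \<gamma> \<subseteq> U" using * by simp
  then have U: "\<gamma> ` {0..1} \<subseteq> U" by (simp add: path_image_def)
  show "ennreal \<bar>w (\<gamma> 0) - w (\<gamma> 1)\<bar> \<le> curve_integral \<gamma> g"
  proof (rule ennreal_le_epsilon)
    fix e :: real assume e: "0 < e"
    define \<epsilon> where "\<epsilon> = e / (len 1 + 1)"
    have \<epsilon>: "0 < \<epsilon>" "\<epsilon> * len 1 \<le> e"
      using e len_nonneg[of 1] by (auto simp: \<epsilon>_def field_simps)
    obtain \<delta> where \<delta>: "0 < \<delta>" and small: "\<And>s t. 0 \<le> s \<Longrightarrow> s \<le> t \<Longrightarrow> t \<le> 1 \<Longrightarrow> t - s < \<delta> \<Longrightarrow>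
        ennreal \<bar>w (\<gamma> s) - w (\<gamma> t)\<bar> \<le>
          (\<integral>\<^sup>+\<sigma>\<in>{len s..len t}. (g (arc_length_param \<gamma> \<sigma>) + ennreal \<epsilon>) \<partial>lborel)"
      using step[OF rectifiable_axioms im \<epsilon>(1)] by meson
    obtain n :: nat where n: "inverse (Suc n) < \<delta>" using reals_Archimedean[OF \<delta>] by auto
    let ?N = "real (Suc n)"
    let ?k = "\<lambda>\<sigma>. g (arc_length_param \<gamma> \<sigma>) + ennreal \<epsilon>"
    have g': "(\<lambda>x. g x + ennreal \<epsilon>) \<in> borel_measurable (restrict_space borel U)"
      using meas by simp
    have "j \<le> Suc n \<Longrightarrow> ennreal \<bar>w (\<gamma> 0) - w (\<gamma> (j / ?N))\<bar> \<le> (\<integral>\<^sup>+\<sigma>\<in>{0..len (j / ?N)}. ?k \<sigma> \<partial>lborel)" for j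
    proof (induction j)
      case (Suc j)
      let ?s = "j / ?N" and ?t = "Suc j / ?N"
      have st: "0 \<le> ?s" "?s \<le> ?t" "?t \<le> 1" "?t - ?s < \<delta>"
        using Suc.prems n by (simp_all add: divide_right_mono flip: diff_divide_distrib) (simp add: inverse_eq_divide)
      have "ennreal \<bar>w (\<gamma> 0) - w (\<gamma> ?t)\<bar> \<le> ennreal \<bar>w (\<gamma> 0) - w (\<gamma> ?s)\<bar> + ennreal \<bar>w (\<gamma> ?s) - w (\<gamma> ?t)\<bar>"
        by (simp del: of_nat_Suc flip: ennreal_plus)
      also have "\<dots> \<le> (\<integral>\<^sup>+\<sigma>\<in>{0..len ?s}. ?k \<sigma> \<partial>lborel) + (\<integral>\<^sup>+\<sigma>\<in>{len ?s..len ?t}. ?k \<sigma> \<partial>lborel)"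
        using Suc st by (intro add_mono small Suc.IH) auto
      also have "\<dots> = (\<integral>\<^sup>+\<sigma>\<in>{0..len ?t}. ?k \<sigma> \<partial>lborel)"
      proof (rule nn_integral_atLeastAtMost_add)
        show "0 \<le> len ?s" "len ?s \<le> len ?t" using st arc_len_eq(2) len_nonneg by auto
        show "(\<lambda>x. ?k x * indicator {0..len ?t} x) \<in> borel_measurable borel"
        proof -
          have "\<gamma> ` {0..?t} \<subseteq> U" using U st(3) by (intro order_trans[OF image_mono U]) auto
          then show ?thesis using measurable_along[OF g', of 0 ?t] st by simp
        qed
      qed
      finally show ?case .
    qed simp
    from this[of "Suc n"] have "ennreal \<bar>w (\<gamma> 0) - w (\<gamma> 1)\<bar> \<le> (\<integral>\<^sup>+\<sigma>\<in>{0..len 1}. ?k \<sigma> \<partial>lborel)"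
      by simp
    also have "\<dots> = (\<integral>\<^sup>+\<sigma>. g (arc_length_param \<gamma> \<sigma>) * indicator {0..len 1} \<sigma> + ennreal \<epsilon> * indicator {0..len 1} \<sigma> \<partial>lborel)"
      by (simp add: distrib_right)
    also have "\<dots> = curve_integral \<gamma> g + ennreal \<epsilon> * ennreal (len 1)"
      using measurable_along[OF meas, of 0 1] U len_nonneg
      by (subst nn_integral_add) (auto simp: curve_integral_eq nn_integral_cmult_indicator)
    also have "\<dots> \<le> curve_integral \<gamma> g + ennreal e"
      using \<epsilon> len_nonneg by (intro add_left_mono) (simp add: ennreal_leI flip: ennreal_mult)
    finally show "ennreal \<bar>w (\<gamma> 0) - w (\<gamma> 1)\<bar> \<le> curve_integral \<gamma> g + ennreal e" .
  qed
qed

lemma ugrad_meas: "ugrad U u g \<Longrightarrow> g \<in> borel_measurable (restrict_space borel U)"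
  by (simp add: ugrad_def)

lemma ugrad_subset:
  assumes "ugrad U u g" "V \<subseteq> U"
  shows "ugrad V u g"
  unfolding ugrad_def
proof (intro conjI allI impI)
  show "g \<in> borel_measurable (restrict_space borel V)"
    using assms by (intro measurable_restrict_mono[OF ugrad_meas])
  show "ennreal \<bar>u (\<gamma> 0) - u (\<gamma> 1)\<bar> \<le> curve_integral \<gamma> g"
    if "rectifiable \<gamma> \<and> nonconstant_curve \<gamma> \<and> path_image \<gamma> \<subseteq> V" for \<gamma>
    using assms that unfolding ugrad_def by blast
qed

lemma ugrad_mono:
  assumes "ugrad U u g" "g' \<in> borel_measurable (restrict_space borel U)"
    and "\<And>x. x \<in> U \<Longrightarrow> g x \<le> g' x" "\<And>x. x \<in> U \<Longrightarrow> u x = u' x"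
  shows "ugrad U u' g'"
  unfolding ugrad_def
proof (intro conjI allI impI assms)
  fix \<gamma> assume *: "rectifiable \<gamma> \<and> nonconstant_curve \<gamma> \<and> path_image \<gamma> \<subseteq> U"
  then interpret rectifiable \<gamma> by simp
  have "\<gamma> 0 \<in> U" "\<gamma> 1 \<in> U" using * by (auto simp: path_image_def)
  then have "ennreal \<bar>u' (\<gamma> 0) - u' (\<gamma> 1)\<bar> = ennreal \<bar>u (\<gamma> 0) - u (\<gamma> 1)\<bar>"
    using assms(4) by simp
  also have "\<dots> \<le> curve_integral \<gamma> g"
    using assms(1) * by (auto simp: ugrad_def)
  also have "\<dots> \<le> curve_integral \<gamma> g'"
    unfolding curve_integral_eq
  proof (intro nn_integral_mono)
    fix \<sigma>
    have "arc_length_param \<gamma> \<sigma> \<in> U" if "\<sigma> \<in> {0..len 1}"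
      using imageI[OF that, of "arc_length_param \<gamma>"] arc_length_param_image[of 0 1] *
      unfolding path_image_def len_0 by auto
    then show "g (arc_length_param \<gamma> \<sigma>) * indicator {0..len 1} \<sigma>
        \<le> g' (arc_length_param \<gamma> \<sigma>) * indicator {0..len 1} \<sigma>"
      by (auto simp: indicator_def intro: assms(3))
  qed
  finally show "ennreal \<bar>u' (\<gamma> 0) - u' (\<gamma> 1)\<bar> \<le> curve_integral \<gamma> g'" .
qed

lemma ugrad_const: "ugrad U (\<lambda>_. c) (\<lambda>_. 0)"
  by (simp add: ugrad_def)

lemma ugrad_lipschitz:
  assumes "L-lipschitz_on U \<eta>"
  shows "ugrad U \<eta> (\<lambda>_. ennreal L)"
  unfolding ugrad_def
proof (intro conjI allI impI)
  fix \<gamma> assume *: "rectifiable \<gamma> \<and> nonconstant_curve \<gamma> \<and> path_image \<gamma> \<subseteq> U"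
  then interpret rectifiable \<gamma> by simp
  have "\<gamma> 0 \<in> U" "\<gamma> 1 \<in> U" using * by (auto simp: path_image_def)
  then have "\<bar>\<eta> (\<gamma> 0) - \<eta> (\<gamma> 1)\<bar> \<le> L * dist (\<gamma> 0) (\<gamma> 1)"
    using lipschitz_onD[OF assms] by (auto simp: dist_real_def)
  also have "\<dots> \<le> L * len 1"
    using dist_le_len[of 0 1] lipschitz_on_nonneg[OF assms] by (intro mult_left_mono) auto
  finally show "ennreal \<bar>\<eta> (\<gamma> 0) - \<eta> (\<gamma> 1)\<bar> \<le> curve_integral \<gamma> (\<lambda>_. ennreal L)"
    using len_nonneg lipschitz_on_nonneg[OF assms]
    by (simp add: curve_integral_eq nn_integral_cmult_indicator ennreal_leI flip: ennreal_mult)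
qed simp

text \<open>A Lebesgue number for the cover of the compact curve puts every short arc into a single
  neighbourhood, and short arcs are all that \<open>ugradI\<close> asks for.\<close>

lemma ugrad_local:
  assumes meas: "g \<in> borel_measurable (restrict_space borel U)"
    and loc: "\<And>x. x \<in> U \<Longrightarrow> \<exists>V. open V \<and> x \<in> V \<and> ugrad (V \<inter> U) w g"
  shows "ugrad U w g"
proof (rule ugradI[OF meas])
  fix \<gamma> and \<epsilon> :: real
  assume rec: "rectifiable \<gamma>" and U: "path_image \<gamma> \<subseteq> U" and \<epsilon>: "0 < \<epsilon>"
  interpret rectifiable \<gamma> by (rule rec)
  define \<G> where "\<G> = {V. open V \<and> ugrad (V \<inter> U) w g}"
  have "path_image \<gamma> \<subseteq> \<Union>\<G>" using loc U by (force simp: \<G>_def)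
  then obtain e where e: "0 < e" "\<And>x. x \<in> path_image \<gamma> \<Longrightarrow> \<exists>G\<in>\<G>. ball x e \<subseteq> G"
    by (rule Heine_Borel_lemma[OF compact_path_image[OF path]]) (simp_all add: \<G>_def)
  have "uniformly_continuous_on {0..1} \<gamma>"
    using path by (auto simp: path_def intro: compact_uniformly_continuous)
  then obtain \<delta> where \<delta>: "0 < \<delta>" "\<And>s t. s \<in> {0..1} \<Longrightarrow> t \<in> {0..1} \<Longrightarrow> dist t s < \<delta> \<Longrightarrow> dist (\<gamma> t) (\<gamma> s) < e"
    using e(1) unfolding uniformly_continuous_on_def by blast
  show "\<exists>\<delta>>0. \<forall>s t. 0 \<le> s \<and> s \<le> t \<and> t \<le> 1 \<and> t - s < \<delta> \<longrightarrow>
      ennreal \<bar>w (\<gamma> s) - w (\<gamma> t)\<bar> \<le> (\<integral>\<^sup>+\<sigma>\<in>{len s..len t}. (g (arc_length_param \<gamma> \<sigma>) + ennreal \<epsilon>) \<partial>lborel)"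
  proof (intro exI[of _ \<delta>] conjI allI impI \<delta>(1))
    fix s t assume st: "0 \<le> s \<and> s \<le> t \<and> t \<le> 1 \<and> t - s < \<delta>"
    have "\<gamma> s \<in> path_image \<gamma>" using st by (auto simp: path_image_def)
    then obtain G where G: "G \<in> \<G>" "ball (\<gamma> s) e \<subseteq> G" using e(2) by blast
    have "\<gamma> ` {s..t} \<subseteq> ball (\<gamma> s) e"
      using \<delta>(2) st by (auto simp: dist_real_def dist_commute)
    then have "\<gamma> ` {s..t} \<subseteq> G \<inter> U" using G U st by (force simp: path_image_def)
    then have "ennreal \<bar>w (\<gamma> s) - w (\<gamma> t)\<bar> \<le> (\<integral>\<^sup>+\<sigma>\<in>{len s..len t}. g (arc_length_param \<gamma> \<sigma>) \<partial>lborel)"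
      using G(1) st by (intro ugradD) (auto simp: \<G>_def)
    also have "\<dots> \<le> (\<integral>\<^sup>+\<sigma>\<in>{len s..len t}. (g (arc_length_param \<gamma> \<sigma>) + ennreal \<epsilon>) \<partial>lborel)"
      by (intro nn_integral_mono mult_right_mono) auto
    finally show "ennreal \<bar>w (\<gamma> s) - w (\<gamma> t)\<bar> \<le> (\<integral>\<^sup>+\<sigma>\<in>{len s..len t}. (g (arc_length_param \<gamma> \<sigma>) + ennreal \<epsilon>) \<partial>lborel)" .
  qed
qed

text \<open>A discrete product rule: the change of the weight is multiplied by the difference of the
  two functions, which is small when both approximate the same function.\<close>

lemma convex_comb_diff_le:
  fixes a b c d p q :: real
  assumes "0 \<le> p" "p \<le> 1"
  shows "\<bar>(p * a + (1 - p) * b) - (q * c + (1 - q) * d)\<bar> \<le> \<bar>a - c\<bar> + \<bar>b - d\<bar> + \<bar>c - d\<bar> * \<bar>p - q\<bar>"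
proof -
  have "(p * a + (1 - p) * b) - (q * c + (1 - q) * d) = p * (a - c) + (1 - p) * (b - d) + (c - d) * (p - q)"
    by (simp add: algebra_simps)
  also have "\<bar>\<dots>\<bar> \<le> p * \<bar>a - c\<bar> + (1 - p) * \<bar>b - d\<bar> + \<bar>c - d\<bar> * \<bar>p - q\<bar>"
    using assms by (intro order_trans[OF abs_triangle_ineq] add_mono) (simp_all add: abs_mult)
  also have "\<dots> \<le> \<bar>a - c\<bar> + \<bar>b - d\<bar> + \<bar>c - d\<bar> * \<bar>p - q\<bar>"
    using assms by (intro add_mono mult_left_le_one_le) auto
  finally show ?thesis .
qed

text \<open>The factor |u - v| in front of \<open>h\<close> varies along the curve. On a short arc
  it is frozen at one end, which by uniform continuity costs at most \<open>\<epsilon>'\<close>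
  times \<open>h\<close>; the bound \<open>M\<close> on \<open>h\<close> turns this into an error
  per unit of length, as \<open>ugradI\<close> admits.\<close>

lemma ugrad_convex_comb:
  assumes u: "ugrad U u g1" and v: "ugrad U v g2" and \<eta>: "ugrad U \<eta> h"
    and cont: "continuous_on U u" "continuous_on U v"
    and bd: "\<And>x. x \<in> U \<Longrightarrow> 0 \<le> \<eta> x \<and> \<eta> x \<le> 1" "\<And>x. x \<in> U \<Longrightarrow> h x \<le> ennreal M" and M: "0 \<le> M"
  shows "ugrad U (\<lambda>x. \<eta> x * u x + (1 - \<eta> x) * v x) (\<lambda>x. g1 x + g2 x + ennreal \<bar>u x - v x\<bar> * h x)"
proof (rule ugradI)
  have dm: "(\<lambda>x. ennreal \<bar>u x - v x\<bar>) \<in> borel_measurable (restrict_space borel U)"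
    using cont by (intro borel_measurable_continuous_on_restrict continuous_on_ennreal continuous_intros)
  note m = ugrad_meas[OF u] ugrad_meas[OF v] ugrad_meas[OF \<eta>] dm
  show "(\<lambda>x. g1 x + g2 x + ennreal \<bar>u x - v x\<bar> * h x) \<in> borel_measurable (restrict_space borel U)"
    using m by (intro borel_measurable_add borel_measurable_times_ennreal)
  fix \<gamma> and \<epsilon> :: real
  assume rec: "rectifiable \<gamma>" and U: "path_image \<gamma> \<subseteq> U" and \<epsilon>: "0 < \<epsilon>"
  interpret rectifiable \<gamma> by (rule rec)
  define k where "k t = \<bar>u (\<gamma> t) - v (\<gamma> t)\<bar>" for t
  define \<epsilon>' where "\<epsilon>' = \<epsilon> / (M + 1)"
  have \<epsilon>': "0 < \<epsilon>'" "\<epsilon>' * M \<le> \<epsilon>" using \<epsilon> M by (auto simp: \<epsilon>'_def field_simps)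
  have \<gamma>c: "continuous_on {0..1} \<gamma>" "\<gamma> ` {0..1} \<subseteq> U"
    using path U by (simp_all add: path_def path_image_def)
  have "continuous_on {0..1} k"
    unfolding k_def
    by (intro continuous_intros continuous_on_compose2[OF cont(1) \<gamma>c] continuous_on_compose2[OF cont(2) \<gamma>c])
  then have "uniformly_continuous_on {0..1} k"
    by (intro compact_uniformly_continuous) auto
  then obtain \<delta> where \<delta>: "0 < \<delta>" "\<And>s t. s \<in> {0..1} \<Longrightarrow> t \<in> {0..1} \<Longrightarrow> dist t s < \<delta> \<Longrightarrow> dist (k t) (k s) < \<epsilon>'"
    using \<epsilon>' unfolding uniformly_continuous_on_def by blast
  let ?w = "\<lambda>x. \<eta> x * u x + (1 - \<eta> x) * v x"
  let ?g = "\<lambda>x. g1 x + g2 x + ennreal \<bar>u x - v x\<bar> * h x"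
  show "\<exists>\<delta>>0. \<forall>s t. 0 \<le> s \<and> s \<le> t \<and> t \<le> 1 \<and> t - s < \<delta> \<longrightarrow>
      ennreal \<bar>?w (\<gamma> s) - ?w (\<gamma> t)\<bar> \<le> (\<integral>\<^sup>+\<sigma>\<in>{len s..len t}. (?g (arc_length_param \<gamma> \<sigma>) + ennreal \<epsilon>) \<partial>lborel)"
  proof (intro exI[of _ \<delta>] conjI allI impI \<delta>(1))
    fix s t assume st': "0 \<le> s \<and> s \<le> t \<and> t \<le> 1 \<and> t - s < \<delta>"
    then have st: "0 \<le> s" "s \<le> t" "t \<le> 1" by auto
    have im: "\<gamma> ` {s..t} \<subseteq> U" using U st by (force simp: path_image_def)
    have pt: "\<gamma> s \<in> U" "\<gamma> t \<in> U" using im st by auto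
    let ?a = "arc_length_param \<gamma>" and ?I = "{len s..len t}"
    have mm: "(\<lambda>\<sigma>. f (?a \<sigma>) * indicator ?I \<sigma>) \<in> borel_measurable lborel"
      if "f \<in> borel_measurable (restrict_space borel U)" for f :: "_ \<Rightarrow> ennreal"
      using measurable_along[OF that st im] by simp
    have "ennreal \<bar>?w (\<gamma> s) - ?w (\<gamma> t)\<bar> \<le> ennreal (\<bar>u (\<gamma> s) - u (\<gamma> t)\<bar> + \<bar>v (\<gamma> s) - v (\<gamma> t)\<bar> + k t * \<bar>\<eta> (\<gamma> s) - \<eta> (\<gamma> t)\<bar>)"
      using convex_comb_diff_le[of "\<eta> (\<gamma> s)"] bd(1)[OF pt(1)] by (intro ennreal_leI) (auto simp: k_def)
    also have "\<dots> = ennreal \<bar>u (\<gamma> s) - u (\<gamma> t)\<bar> + ennreal \<bar>v (\<gamma> s) - v (\<gamma> t)\<bar> + ennreal (k t) * ennreal \<bar>\<eta> (\<gamma> s) - \<eta> (\<gamma> t)\<bar>"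
      by (simp add: ennreal_plus ennreal_mult k_def)
    also have "\<dots> \<le> (\<integral>\<^sup>+\<sigma>\<in>?I. g1 (?a \<sigma>) \<partial>lborel) + (\<integral>\<^sup>+\<sigma>\<in>?I. g2 (?a \<sigma>) \<partial>lborel) + ennreal (k t) * (\<integral>\<^sup>+\<sigma>\<in>?I. h (?a \<sigma>) \<partial>lborel)"
      by (intro add_mono mult_left_mono ugradD[OF u st im] ugradD[OF v st im] ugradD[OF \<eta> st im]) simp
    also have "\<dots> = (\<integral>\<^sup>+\<sigma>. g1 (?a \<sigma>) * indicator ?I \<sigma> + g2 (?a \<sigma>) * indicator ?I \<sigma> + ennreal (k t) * (h (?a \<sigma>) * indicator ?I \<sigma>) \<partial>lborel)"
      using mm m by (simp add: nn_integral_add nn_integral_cmult)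
    also have "\<dots> \<le> (\<integral>\<^sup>+\<sigma>\<in>?I. (?g (?a \<sigma>) + ennreal \<epsilon>) \<partial>lborel)"
    proof (intro nn_integral_mono)
      fix \<sigma>
      show "g1 (?a \<sigma>) * indicator ?I \<sigma> + g2 (?a \<sigma>) * indicator ?I \<sigma> + ennreal (k t) * (h (?a \<sigma>) * indicator ?I \<sigma>)
          \<le> (?g (?a \<sigma>) + ennreal \<epsilon>) * indicator ?I \<sigma>"
      proof (cases "\<sigma> \<in> ?I")
        case True
        then obtain r where r: "r \<in> {s..t}" "len r = \<sigma>" using len_surj st by blast
        then have a: "?a \<sigma> = \<gamma> r" using arc_length_param_len[of r] st by auto
        have rU: "\<gamma> r \<in> U" using im r by auto
        have "dist t r < \<delta>" using r st' by (auto simp: dist_real_def)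
        then have "dist (k t) (k r) < \<epsilon>'" using \<delta>(2)[of r t] r st by auto
        then have "k t \<le> k r + \<epsilon>'" by (auto simp: dist_real_def)
        then have "ennreal (k t) * h (\<gamma> r) \<le> ennreal (k r + \<epsilon>') * h (\<gamma> r)"
          by (intro mult_right_mono ennreal_leI) auto
        also have "\<dots> = ennreal (k r) * h (\<gamma> r) + ennreal \<epsilon>' * h (\<gamma> r)"
          using \<epsilon>' by (simp add: k_def ennreal_plus distrib_right)
        also have "ennreal \<epsilon>' * h (\<gamma> r) \<le> ennreal \<epsilon>' * ennreal M"
          by (intro mult_left_mono bd rU) auto
        also have "\<dots> \<le> ennreal \<epsilon>" using \<epsilon>' M by (simp add: ennreal_leI flip: ennreal_mult)
        finally have "ennreal (k t) * h (\<gamma> r) \<le> ennreal (k r) * h (\<gamma> r) + ennreal \<epsilon>"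
          by (simp add: add_left_mono)
        from add_left_mono[OF this, of "g1 (\<gamma> r) + g2 (\<gamma> r)"] show ?thesis
          using True by (simp add: a k_def add.assoc)
      qed simp
    qed
    finally show "ennreal \<bar>?w (\<gamma> s) - ?w (\<gamma> t)\<bar> \<le> (\<integral>\<^sup>+\<sigma>\<in>?I. (?g (?a \<sigma>) + ennreal \<epsilon>) \<partial>lborel)" .
  qed
qed

text \<open>A maximum changes by no more than the sum of the changes of its members. Taking the sum
  of the gradients keeps the members apart, so that later the integral of the gradient is a sum over
  balls.\<close>

lemma ugrad_Max:
  assumes "finite J" "J \<noteq> {}" "\<And>j. j \<in> J \<Longrightarrow> ugrad U (\<eta> j) (h j)"
  shows "ugrad U (\<lambda>x. Max ((\<lambda>j. \<eta> j x) ` J)) (\<lambda>x. \<Sum>j\<in>J. h j x)"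
  unfolding ugrad_def
proof (intro conjI allI impI)
  show "(\<lambda>x. \<Sum>j\<in>J. h j x) \<in> borel_measurable (restrict_space borel U)"
    using assms(3) by (intro borel_measurable_sum) (auto simp: ugrad_def)
  fix \<gamma> assume *: "rectifiable \<gamma> \<and> nonconstant_curve \<gamma> \<and> path_image \<gamma> \<subseteq> U"
  then interpret rectifiable \<gamma> by simp
  have U: "\<gamma> ` {0..1} \<subseteq> U" using * by (simp add: path_image_def)
  let ?m = "\<lambda>x. Max ((\<lambda>j. \<eta> j x) ` J)"
  have half: "?m x - ?m y \<le> (\<Sum>j\<in>J. \<bar>\<eta> j x - \<eta> j y\<bar>)" for x y
  proof -
    have "?m x \<in> (\<lambda>j. \<eta> j x) ` J" using assms(1,2) by (intro Max_in) auto
    then obtain j where j: "j \<in> J" "?m x = \<eta> j x" by auto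
    have "\<eta> j y \<le> ?m y" using assms(1) j by (intro Max_ge) auto
    then have "?m x - ?m y \<le> \<bar>\<eta> j x - \<eta> j y\<bar>" using j by auto
    also have "\<dots> \<le> (\<Sum>j\<in>J. \<bar>\<eta> j x - \<eta> j y\<bar>)"
      using assms(1) j by (intro member_le_sum) auto
    finally show ?thesis .
  qed
  have "\<bar>?m x - ?m y\<bar> \<le> (\<Sum>j\<in>J. \<bar>\<eta> j x - \<eta> j y\<bar>)" for x y
    using half[of x y] half[of y x] by (simp only: abs_le_iff abs_minus_commute[of "\<eta> _ y"]) simp
  then have "ennreal \<bar>?m (\<gamma> 0) - ?m (\<gamma> 1)\<bar> \<le> (\<Sum>j\<in>J. ennreal \<bar>\<eta> j (\<gamma> 0) - \<eta> j (\<gamma> 1)\<bar>)"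
    by (subst sum_ennreal) (auto intro: ennreal_leI)
  also have "\<dots> \<le> (\<Sum>j\<in>J. curve_integral \<gamma> (h j))"
    using assms(3) * by (intro sum_mono) (auto simp: ugrad_def)
  also have "\<dots> = curve_integral \<gamma> (\<lambda>x. \<Sum>j\<in>J. h j x)"
    using measurable_along[of _ U 0 1] assms(3) U unfolding curve_integral_eq
    by (subst nn_integral_sum[symmetric]) (auto simp: sum_distrib_right ugrad_def)
  finally show "ennreal \<bar>?m (\<gamma> 0) - ?m (\<gamma> 1)\<bar> \<le> curve_integral \<gamma> (\<lambda>x. \<Sum>j\<in>J. h j x)" .
qed

section \<open>Doubling spaces\<close>

lemma
  assumes "outer_measure_space UNIV m"
  shows sets_caratheodory_measure: "sets (caratheodory_measure m) = lambda_system UNIV UNIV m"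
    and space_caratheodory_measure [simp]: "space (caratheodory_measure m) = UNIV"
    and emeasure_caratheodory_measure: "A \<in> sets (caratheodory_measure m) \<Longrightarrow> emeasure (caratheodory_measure m) A = m A"
proof -
  have ms: "measure_space UNIV (lambda_system UNIV UNIV m) m"
    using sigma_algebra.caratheodory_lemma[OF sigma_algebra_Pow, of UNIV m] assms by simp
  then have "sigma_algebra UNIV (lambda_system UNIV UNIV m)" by (simp add: measure_space_def)
  then have eq: "sigma_sets UNIV (lambda_system UNIV UNIV m) = lambda_system UNIV UNIV m"
    by (rule sigma_algebra.sigma_sets_eq)
  then show s: "sets (caratheodory_measure m) = lambda_system UNIV UNIV m"
    by (simp add: caratheodory_measure_def sets_measure_of_conv)
  show "space (caratheodory_measure m) = UNIV"
    by (simp add: caratheodory_measure_def space_measure_of_conv)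
  show "emeasure (caratheodory_measure m) A = m A" if "A \<in> sets (caratheodory_measure m)"
    using that ms eq s by (simp add: caratheodory_measure_def emeasure_measure_of_conv measure_space_def
        emeasure_measure_of_sigma)
qed

locale doubling_space =
  fixes m :: "'a::complete_space set \<Rightarrow> ennreal"
  assumes outer: "borel_regular_outer_measure m" and doubling: "doubling m"
begin

abbreviation M :: "'a measure" where "M \<equiv> caratheodory_measure m"

lemma oms: "outer_measure_space UNIV m"
  using outer by (simp add: borel_regular_outer_measure_def)

lemma space_M [simp]: "space M = UNIV"
  by (rule space_caratheodory_measure[OF oms])

lemma emeasure_M: "A \<in> sets M \<Longrightarrow> emeasure M A = m A"
  by (rule emeasure_caratheodory_measure[OF oms])

lemma sets_M_borel: "A \<in> sets borel \<Longrightarrow> A \<in> sets M"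
  using outer by (auto simp: borel_regular_outer_measure_def sets_caratheodory_measure[OF oms])

lemma measurable_M_borel: "f \<in> borel \<rightarrow>\<^sub>M N \<Longrightarrow> f \<in> M \<rightarrow>\<^sub>M N"
  by (auto simp: measurable_def sets_M_borel)

lemma m_mono: "A \<subseteq> B \<Longrightarrow> m A \<le> m B"
  using oms by (simp add: outer_measure_space_def increasing_def)

lemma doubling_ex:
  "\<exists>C\<ge>1::real. \<forall>x. \<forall>r>0. m (ball x (2 * r)) \<le> ennreal C * m (ball x r) \<and> 0 < m (ball x r) \<and> m (ball x r) < \<infinity>"
proof -
  obtain C :: real where C: "1 \<le> C" "\<And>x r. 0 < r \<Longrightarrow> 0 < m (ball x (2 * r)) \<and>
      m (ball x (2 * r)) \<le> ennreal C * m (ball x r) \<and> ennreal C * m (ball x r) < \<infinity>"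
    using doubling unfolding doubling_def by metis
  have "0 < m (ball x r)" if "0 < r" for x r
    using C(2)[of "r / 2" x] that by simp
  moreover have "m (ball x r) < \<infinity>" if "0 < r" for x r
    using C(2)[of "r / 2" x] that by (auto intro: le_less_trans)
  ultimately show ?thesis using C by blast
qed

lemma m_ball_pos: "0 < r \<Longrightarrow> 0 < m (ball x r)"
  using doubling_ex by blast

lemma m_ball_finite: "m (ball x r) < \<infinity>"
proof (cases "0 < r")
  case True
  then show ?thesis using doubling_ex by blast
next
  case False
  then show ?thesis using oms by (simp add: outer_measure_space_def positive_def ball_empty)
qed

lemma doubling_iter_ex:
  "\<exists>C\<ge>1::real. \<forall>x r n. 0 < r \<longrightarrow> m (ball x (2 ^ n * r)) \<le> ennreal (C ^ n) * m (ball x r)"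
proof -
  obtain C :: real where C: "1 \<le> C" "\<And>x r. 0 < r \<Longrightarrow> m (ball x (2 * r)) \<le> ennreal C * m (ball x r)"
    using doubling_ex by blast
  have "m (ball x (2 ^ n * r)) \<le> ennreal (C ^ n) * m (ball x r)" if "0 < r" for x r n
  proof (induction n)
    case (Suc n)
    have "m (ball x (2 ^ Suc n * r)) \<le> ennreal C * m (ball x (2 ^ n * r))"
      using C(2)[of "2 ^ n * r" x] that by (simp add: mult.assoc)
    also have "\<dots> \<le> ennreal C * (ennreal (C ^ n) * m (ball x r))"
      by (intro mult_left_mono Suc) auto
    also have "\<dots> = ennreal (C ^ Suc n) * m (ball x r)"
      using C(1) by (simp add: ennreal_mult mult.assoc)
    finally show ?case .
  qed simp
  then show ?thesis using C(1) by blast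
qed

text \<open>A volume count: the balls of radius e/2 about the points of \<open>T\<close> are
  disjoint, lie in one large ball, and by iterated doubling each carries at least a fixed fraction
  of its measure.\<close>

lemma separated_card_bounded:
  assumes "0 < e"
  shows "\<exists>B::nat. \<forall>T. finite T \<and> T \<subseteq> cball (x::'a) R \<and> (\<forall>s\<in>T. \<forall>t\<in>T. s \<noteq> t \<longrightarrow> e \<le> dist s t) \<longrightarrow> card T < B"
proof -
  obtain C :: real where C: "1 \<le> C" "\<And>x r n. 0 < r \<Longrightarrow> m (ball x (2 ^ n * r)) \<le> ennreal (C ^ n) * m (ball x r)"
    using doubling_iter_ex by blast
  \<comment> \<open>The radius |R| + e leaves room for the small balls and is positive also for
    negative R.\<close>
  define R' where "R' = \<bar>R\<bar> + e"
  have R': "0 < R'" using assms by (simp add: R'_def)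
  obtain n where n: "2 * R' / (e / 2) < 2 ^ n" using real_arch_pow[of 2] by auto
  obtain B :: nat where B: "C ^ n < B" using reals_Archimedean2 by blast
  have "card T < B" if T: "finite T" "T \<subseteq> cball x R" "\<forall>s\<in>T. \<forall>t\<in>T. s \<noteq> t \<longrightarrow> e \<le> dist s t" for T
  proof -
    have big: "m (ball x R') \<le> ennreal (C ^ n) * m (ball t (e / 2))" if "t \<in> T" for t
    proof -
      have "ball x R' \<subseteq> ball t (2 ^ n * (e / 2))"
      proof
        fix y assume "y \<in> ball x R'"
        then have "dist t y < 2 * R'"
          using that T(2) assms dist_triangle[of t y x] by (auto simp: R'_def dist_commute)
        also have "\<dots> \<le> 2 ^ n * (e / 2)" using n assms by (simp add: field_simps)
        finally show "y \<in> ball t (2 ^ n * (e / 2))" by simp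
      qed
      then show ?thesis using C(2)[of "e / 2" t n] assms m_mono by (meson half_gt_zero order_trans)
    qed
    have "of_nat (card T) * m (ball x R') = (\<Sum>t\<in>T. m (ball x R'))" by simp
    also have "\<dots> \<le> (\<Sum>t\<in>T. ennreal (C ^ n) * m (ball t (e / 2)))"
      by (intro sum_mono big)
    also have "\<dots> = ennreal (C ^ n) * (\<Sum>t\<in>T. emeasure M (ball t (e / 2)))"
      by (simp add: sum_distrib_left emeasure_M sets_M_borel)
    also have "(\<Sum>t\<in>T. emeasure M (ball t (e / 2))) = emeasure M (\<Union>t\<in>T. ball t (e / 2))"
    proof (rule sum_emeasure)
      show "disjoint_family_on (\<lambda>t. ball t (e / 2)) T"
      proof (unfold disjoint_family_on_def, intro ballI impI)
        fix s t assume "s \<in> T" "t \<in> T" "s \<noteq> t"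
        then have "e \<le> dist s t" using T by blast
        then show "ball s (e / 2) \<inter> ball t (e / 2) = {}"
          using dist_triangle_half_l[of s _ e t] by (force simp: dist_commute)
      qed
    qed (use T in \<open>auto simp: sets_M_borel\<close>)
    also have "\<dots> \<le> emeasure M (ball x R')"
    proof (rule emeasure_mono)
      show "(\<Union>t\<in>T. ball t (e / 2)) \<subseteq> ball x R'"
      proof
        fix y assume "y \<in> (\<Union>t\<in>T. ball t (e / 2))"
        then obtain t where "t \<in> T" "dist t y < e / 2" by auto
        moreover from this have "dist x t \<le> R" using T(2) by auto
        ultimately show "y \<in> ball x R'"
          using dist_triangle[of x y t] assms by (auto simp: R'_def)
      qed
    qed (simp add: sets_M_borel)
    also have "\<dots> = m (ball x R')" by (simp add: emeasure_M sets_M_borel)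
    finally have le: "of_nat (card T) * m (ball x R') \<le> ennreal (C ^ n) * m (ball x R')"
      by (simp add: mult_left_mono)
    obtain c where c: "m (ball x R') = ennreal c" "0 < c"
      using m_ball_pos[OF R', of x] m_ball_finite[of x R']
      by (cases "m (ball x R')") (auto simp: ennreal_less_zero_iff less_le)
    have "ennreal (real (card T) * c) \<le> ennreal (C ^ n * c)"
      using le C(1) c by (simp add: ennreal_mult ennreal_of_nat_eq_real_of_nat)
    then have "real (card T) * c \<le> C ^ n * c"
      using C(1) c by (subst (asm) ennreal_le_iff) auto
    then have "real (card T) \<le> C ^ n" using c by simp
    then show ?thesis using B by simp
  qed
  then show ?thesis by blast
qed

text \<open>A separated set of largest cardinality is an e-net, so closed balls are totally bounded,
  and they are complete as closed sets. The compactness arguments below rest on this.\<close>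

lemma compact_cball: "compact (cball (x::'a) R)"
  unfolding compact_eq_totally_bounded
proof (intro conjI allI impI)
  show "complete (cball x R)" by (simp add: complete_eq_closed)
  fix e :: real assume e: "0 < e"
  define P where "P T \<longleftrightarrow> finite T \<and> T \<subseteq> cball x R \<and> (\<forall>s\<in>T. \<forall>t\<in>T. s \<noteq> t \<longrightarrow> e \<le> dist s t)" for T
  obtain B :: nat where "\<forall>T. P T \<longrightarrow> card T < B" using separated_card_bounded[OF e, of x R] unfolding P_def by blast
  moreover have "P {}" by (simp add: P_def)
  ultimately obtain T where T: "P T" "\<And>T'. P T' \<Longrightarrow> card T' \<le> card T"
    using ex_has_greatest_nat[of P "{}" card B] by blast
  have "cball x R \<subseteq> (\<Union>t\<in>T. ball t e)"
  proof
    fix y assume y: "y \<in> cball x R"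
    show "y \<in> (\<Union>t\<in>T. ball t e)"
    proof (rule ccontr)
      assume n: "y \<notin> (\<Union>t\<in>T. ball t e)"
      then have "P (insert y T)" using y T(1) by (auto simp: P_def not_less dist_commute)
      moreover have "y \<notin> T" using n e by force
      ultimately show False using T(2)[of "insert y T"] T(1) by (simp add: P_def)
    qed
  qed
  then show "\<exists>k. finite k \<and> cball x R \<subseteq> (\<Union>x\<in>k. ball x e)"
    using T(1) by (auto simp: P_def)
qed

lemma compact_closed_bounded:
  assumes "closed (K::'a set)" "bounded K"
  shows "compact K"
proof -
  obtain x R where "K \<subseteq> cball x R" using assms(2) bounded_subset_cball by blast
  then show ?thesis using compact_Int_closed[OF compact_cball[of x R] assms(1)] by (simp add: Int_absorb1)
qed

lemma m_bounded_finite: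
  assumes "bounded A"
  shows "m A < \<infinity>"
proof -
  obtain x R where "A \<subseteq> ball x R" using assms bounded_subset_ballD by blast
  then show ?thesis using m_mono[of A "ball x R"] m_ball_finite[of x R] by (simp add: le_less_trans)
qed

section \<open>Cutoff functions and locally Lipschitz functions\<close>

definition cutoff :: "'a set \<Rightarrow> 'a set \<Rightarrow> ('a \<Rightarrow> real) \<Rightarrow> real \<Rightarrow> 'a set \<Rightarrow> 'a set \<Rightarrow> bool" where
  "cutoff K G \<eta> L N0 N1 \<longleftrightarrow> L-lipschitz_on UNIV \<eta> \<and> (\<forall>x. 0 \<le> \<eta> x \<and> \<eta> x \<le> 1) \<and> open N0 \<and> open N1 \<and> K \<subseteq> N1 \<and>
     (\<forall>x\<in>N1. \<eta> x = 1) \<and> (\<forall>x\<in>N0. \<eta> x = 0) \<and> compact (- N0) \<and> - N0 \<subseteq> G \<and> closure N1 \<subseteq> - N0"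

text \<open>The sets \<open>N0\<close> and \<open>N1\<close> on which the cutoff is 0 and 1 are
  required to be open, so that near each of their points a glued function coincides with one of the
  two given functions.\<close>

lemma ex_cutoff:
  assumes "compact (K::'a set)" "open O1" "K \<subseteq> O1"
  shows "\<exists>\<eta> L N0 N1. cutoff K O1 \<eta> L N0 N1"
proof (cases "K = {}")
  \<comment> \<open>\<open>infdist\<close> to the empty set is 0, so for empty \<open>K\<close> the
    formula used below would be constantly 1.\<close>
  case True
  then have "cutoff K O1 (\<lambda>_. 0) 0 UNIV {}" by (simp add: cutoff_def lipschitz_on_def)
  then show ?thesis by blast
next
  case False
  obtain e where e: "0 < e" "\<And>x. x \<in> K \<Longrightarrow> ball x e \<subseteq> O1"
    using Heine_Borel_lemma[OF assms(1), of "{O1}"] assms by (metis Union_insert ccpo_Sup_singleton singletonD)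
  \<comment> \<open>\<open>e\<close> is a Lebesgue number of \<open>K\<close> in \<open>O1\<close>;
    a third of it keeps the support, at distance at most 2 \<open>\<delta>\<close> from
    \<open>K\<close>, inside \<open>O1\<close>.\<close>
  define \<delta> where "\<delta> = e / 3"
  have \<delta>: "0 < \<delta>" using e by (simp add: \<delta>_def)
  have c: "continuous_on UNIV (\<lambda>x. infdist x K)"
    by (intro continuous_intros)
  let ?\<eta> = "\<lambda>x. max 0 (min 1 (2 - infdist x K / \<delta>))"
  have sub: "{x. infdist x K \<le> 2 * \<delta>} \<subseteq> O1"
  proof
    fix x assume "x \<in> {x. infdist x K \<le> 2 * \<delta>}"
    then have "infdist x K < e" using \<delta> by (simp add: \<delta>_def)
    then obtain y where "y \<in> K" "dist x y < e" using False by (auto simp: infdist_def cINF_less_iff)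
    then show "x \<in> O1" using e(2)[of y] by (auto simp: dist_commute)
  qed
  have cl: "closed {x. infdist x K \<le> 2 * \<delta>}" "closed {x. infdist x K \<le> \<delta>}"
    by (intro closed_Collect_le c continuous_intros)+
  have "cutoff K O1 ?\<eta> (1 / \<delta>) {x. 2 * \<delta> < infdist x K} {x. infdist x K < \<delta>}"
    unfolding cutoff_def
  proof (intro conjI)
    show "(1 / \<delta>)-lipschitz_on UNIV ?\<eta>"
    proof (rule lipschitz_onI)
      fix x y :: 'a
      have "dist (?\<eta> x) (?\<eta> y) \<le> \<bar>infdist x K / \<delta> - infdist y K / \<delta>\<bar>"
        by (auto simp: dist_real_def max_def min_def)
      also have "\<dots> = 1 / \<delta> * \<bar>infdist x K - infdist y K\<bar>"
        using \<delta> by (simp add: abs_divide flip: diff_divide_distrib)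
      also have "\<dots> \<le> 1 / \<delta> * dist x y"
        using \<delta> infdist_triangle_abs[of x K y] by (intro mult_left_mono) auto
      finally show "dist (?\<eta> x) (?\<eta> y) \<le> 1 / \<delta> * dist x y" .
    qed (use \<delta> in auto)
    show "open {x. 2 * \<delta> < infdist x K}" "open {x. infdist x K < \<delta>}"
      by (intro open_Collect_less c continuous_intros)+
    have eq: "- {x. 2 * \<delta> < infdist x K} = {x. infdist x K \<le> 2 * \<delta>}" by auto
    have "bounded {x. infdist x K \<le> 2 * \<delta>}"
    proof -
      obtain a R where a: "K \<subseteq> cball a R" using compact_imp_bounded[OF assms(1)] bounded_subset_cball by blast
      have "{x. infdist x K \<le> 2 * \<delta>} \<subseteq> cball a (R + e)"
      proof
        fix x assume "x \<in> {x. infdist x K \<le> 2 * \<delta>}"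
        then have "infdist x K < e" using \<delta> by (simp add: \<delta>_def)
        then obtain y where "y \<in> K" "dist x y < e" using False by (auto simp: infdist_def cINF_less_iff)
        then show "x \<in> cball a (R + e)" using a dist_triangle[of a x y] by (force simp: dist_commute)
      qed
      then show ?thesis using bounded_cball bounded_subset by blast
    qed
    then show "compact (- {x. 2 * \<delta> < infdist x K})"
      unfolding eq using cl by (intro compact_closed_bounded)
    show "- {x. 2 * \<delta> < infdist x K} \<subseteq> O1" unfolding eq by (rule sub)
    have "closure {x. infdist x K < \<delta>} \<subseteq> {x. infdist x K \<le> \<delta>}"
      by (rule closure_minimal) (use cl in auto)
    then show "closure {x. infdist x K < \<delta>} \<subseteq> - {x. 2 * \<delta> < infdist x K}"
      using \<delta> unfolding eq by fastforce
  qed (use \<delta> in \<open>auto simp: field_simps\<close>)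
  then show ?thesis by blast
qed

lemma compactly_insideE:
  assumes "compact (K::'a set)" "open U" "K \<subseteq> U"
  obtains V where "compactly_inside V U" "K \<subseteq> V"
proof -
  obtain \<eta> L N0 N1 where "cutoff K U \<eta> L N0 N1" using ex_cutoff[OF assms] by blast
  then have "open N1" "K \<subseteq> N1" "compact (- N0)" "- N0 \<subseteq> U" "closure N1 \<subseteq> - N0"
    by (simp_all add: cutoff_def)
  then have "compactly_inside N1 U"
    using compact_Int_closed[of "- N0" "closure N1"] by (auto simp: compactly_inside_def Int_absorb1)
  then show thesis using that \<open>K \<subseteq> N1\<close> by blast
qed

text \<open>The definition asks for one Lipschitz constant on each compactly contained set. The
  pointwise form is the one that can be checked for functions pasted together from pieces.\<close>

lemma lip_loc_iff:
  assumes "open U"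
  shows "lip_loc U (u :: 'a \<Rightarrow> real) \<longleftrightarrow> (\<forall>x\<in>U. \<exists>e>0. ball x e \<subseteq> U \<and> (\<exists>L. L-lipschitz_on (ball x e) u))"
proof
  assume l: "lip_loc U u"
  show "\<forall>x\<in>U. \<exists>e>0. ball x e \<subseteq> U \<and> (\<exists>L. L-lipschitz_on (ball x e) u)"
  proof
    fix x assume "x \<in> U"
    then obtain V where V: "compactly_inside V U" "{x} \<subseteq> V"
      using compactly_insideE[of "{x}" U] assms by auto
    then have "open V" "V \<subseteq> U" using closure_subset[of V] by (auto simp: compactly_inside_def)
    then obtain e where e: "0 < e" "ball x e \<subseteq> V" using V(2) open_contains_ball[of V] by auto
    obtain L where "L-lipschitz_on V u" using l V by (auto simp: lip_loc_def)
    then have "L-lipschitz_on (ball x e) u" using e(2) by (rule lipschitz_on_subset)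
    then show "\<exists>e>0. ball x e \<subseteq> U \<and> (\<exists>L. L-lipschitz_on (ball x e) u)"
      using e \<open>V \<subseteq> U\<close> by blast
  qed
next
  assume *: "\<forall>x\<in>U. \<exists>e>0. ball x e \<subseteq> U \<and> (\<exists>L. L-lipschitz_on (ball x e) u)"
  show "lip_loc U u"
    unfolding lip_loc_def
  proof (intro allI impI)
    fix V assume V: "compactly_inside V U"
    \<comment> \<open>A one-point time set reduces the time-dependent notion to local Lipschitz
      continuity of \<open>u\<close>.\<close>
    have "local_lipschitz {0::real} (closure V) (\<lambda>_::real. u)"
    proof (rule local_lipschitzI)
      fix t :: real and x assume "x \<in> closure V"
      then obtain e L where e: "0 < e" "L-lipschitz_on (ball x e) u"
        using * V by (force simp: compactly_inside_def)
      have "cball x (e / 2) \<inter> closure V \<subseteq> ball x e" using e(1) by auto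
      from lipschitz_on_subset[OF e(2) this]
      show "\<exists>d>0. \<exists>L. \<forall>t\<in>cball t d \<inter> {0}. L-lipschitz_on (cball x d \<inter> closure V) u"
        using e(1) by (intro exI[of _ "e / 2"]) auto
    qed
    moreover have "compact (closure V)" using V by (simp add: compactly_inside_def)
    ultimately obtain L where "L-lipschitz_on (closure V) u"
      by (rule_tac local_lipschitz_compact_implies_lipschitz[where X = "closure V" and T = "{0::real}" and f = "\<lambda>_. u"]) auto
    then show "\<exists>L. L-lipschitz_on V u"
      using lipschitz_on_subset closure_subset by blast
  qed
qed

lemma lip_loc_continuous:
  assumes "open U" "lip_loc U u"
  shows "continuous_on U (u::'a \<Rightarrow> real)"
proof -
  have "continuous (at x) u" if x: "x \<in> U" for x
  proof -
    obtain e L where "0 < e" "L-lipschitz_on (ball x e) u"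
      using iffD1[OF lip_loc_iff[OF assms(1), of u] assms(2), rule_format, OF x] by blast
    from lipschitz_on_continuous_on[OF this(2)] this(1) show ?thesis
      by (simp only: continuous_on_eq_continuous_at[OF open_ball] centre_in_ball)
  qed
  then show ?thesis by (simp add: continuous_at_imp_continuous_on)
qed

lemma lip_loc_subset: "lip_loc U u \<Longrightarrow> V \<subseteq> U \<Longrightarrow> lip_loc V u"
  unfolding lip_loc_def compactly_inside_def by (meson order_trans)

lemma lip_loc_const: "lip_loc U (\<lambda>_. c)"
  unfolding lip_loc_def by (auto simp: lipschitz_on_def)

lemma lipschitz_imp_lip_loc: "L-lipschitz_on U u \<Longrightarrow> lip_loc U u"
  unfolding lip_loc_def compactly_inside_def
  using lipschitz_on_subset closure_subset by (metis order_trans)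

section \<open>Gluing two functions along a cutoff\<close>

lemma lipschitz_on_convex_comb:
  fixes u v \<eta> :: "'a \<Rightarrow> real"
  assumes "Lu-lipschitz_on (ball x e) u" "Lv-lipschitz_on (ball x e) v" "Le-lipschitz_on (ball x e) \<eta>"
    and bd: "\<And>y. y \<in> ball x e \<Longrightarrow> 0 \<le> \<eta> y \<and> \<eta> y \<le> 1" and e: "0 < e"
  shows "\<exists>L. L-lipschitz_on (ball x e) (\<lambda>y. \<eta> y * u y + (1 - \<eta> y) * v y)"
proof -
  \<comment> \<open>A bound for |u - v| on the ball; it multiplies the Lipschitz constant of the
    cutoff.\<close>
  define K where "K = \<bar>u x - v x\<bar> + (Lu + Lv) * e"
  have nn: "0 \<le> Lu" "0 \<le> Lv" "0 \<le> Le" using assms(1-3) by (auto dest: lipschitz_on_nonneg)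
  have K: "\<bar>u z - v z\<bar> \<le> K" if "z \<in> ball x e" for z
  proof -
    have "\<bar>u x - u z\<bar> \<le> Lu * dist x z" "\<bar>v x - v z\<bar> \<le> Lv * dist x z"
      using lipschitz_onD[OF assms(1), of x z] lipschitz_onD[OF assms(2), of x z] that e by (auto simp: dist_real_def)
    moreover have "Lu * dist x z \<le> Lu * e" "Lv * dist x z \<le> Lv * e"
      using that nn by (auto intro!: mult_left_mono)
    ultimately show ?thesis unfolding K_def by (simp add: distrib_right)
  qed
  have "(Lu + Lv + K * Le)-lipschitz_on (ball x e) (\<lambda>y. \<eta> y * u y + (1 - \<eta> y) * v y)"
  proof (rule lipschitz_onI)
    fix y z assume yz: "y \<in> ball x e" "z \<in> ball x e"
    have "dist (\<eta> y * u y + (1 - \<eta> y) * v y) (\<eta> z * u z + (1 - \<eta> z) * v z)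
        \<le> \<bar>u y - u z\<bar> + \<bar>v y - v z\<bar> + \<bar>u z - v z\<bar> * \<bar>\<eta> y - \<eta> z\<bar>"
      unfolding dist_real_def using bd[OF yz(1)] by (intro convex_comb_diff_le) auto
    also have "\<dots> \<le> Lu * dist y z + Lv * dist y z + K * (Le * dist y z)"
      using lipschitz_onD[OF assms(1) yz] lipschitz_onD[OF assms(2) yz] lipschitz_onD[OF assms(3) yz] K[OF yz(2)]
      by (intro add_mono mult_mono) (auto simp: dist_real_def)
    finally show "dist (\<eta> y * u y + (1 - \<eta> y) * v y) (\<eta> z * u z + (1 - \<eta> z) * v z) \<le> (Lu + Lv + K * Le) * dist y z"
      by (simp add: algebra_simps)
  qed (use nn e in \<open>auto simp: K_def\<close>)
  then show ?thesis by blast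
qed

lemma ugrad_indicator_measurable:
  assumes "ugrad U u g" "open U"
  shows "(\<lambda>x. g x * indicator U x) \<in> borel_measurable borel"
  using ugrad_meas[OF assms(1)] assms(2)
  by (subst (asm) borel_measurable_restrict_space_iff_ennreal) (auto simp: mult.commute)

text \<open>Both conclusions are local, and every point of \<open>U\<close> has a neighbourhood
  inside \<open>N0\<close>, \<open>N1\<close> or the transition region \<open>Ob\<close>; there the
  result is \<open>v\<close>, \<open>u\<close> or a genuine convex combination. Only on
  \<open>Ob\<close> must \<open>u\<close> and \<open>v\<close> both be under control.\<close>

lemma glue:
  fixes u v \<eta> :: "'a \<Rightarrow> real"
  assumes op: "open U" "open G1" "open G2" "open N0" "open N1" "open Ob"
    and u: "lip_loc G1 u" "ugrad G1 u g1" and v: "lip_loc G2 v" "ugrad G2 v g2"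
    and \<eta>: "lip_loc Ob \<eta>" "ugrad Ob \<eta> h" "\<And>x. 0 \<le> \<eta> x \<and> \<eta> x \<le> 1" "\<And>x. x \<in> Ob \<Longrightarrow> h x \<le> ennreal B" "0 \<le> B"
    and N: "\<And>x. x \<in> N0 \<Longrightarrow> \<eta> x = 0" "\<And>x. x \<in> N1 \<Longrightarrow> \<eta> x = 1"
    and sub: "U \<subseteq> N0 \<union> N1 \<union> Ob" "U \<inter> N0 \<subseteq> G2" "U \<inter> N1 \<subseteq> G1" "Ob \<subseteq> G1 \<inter> G2"
  defines "w \<equiv> \<lambda>x. \<eta> x * u x + (1 - \<eta> x) * v x"
    and "g \<equiv> \<lambda>x. g1 x * indicator G1 x + g2 x * indicator G2 x + ennreal \<bar>u x - v x\<bar> * h x * indicator Ob x"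
  shows "lip_loc U w" "ugrad U w g"
proof -
  have cont: "continuous_on Ob u" "continuous_on Ob v"
    using lip_loc_continuous[OF op(2) u(1)] lip_loc_continuous[OF op(3) v(1)] sub(4)
    by (auto intro: continuous_on_subset)
  have comb: "ugrad Ob w (\<lambda>x. g1 x + g2 x + ennreal \<bar>u x - v x\<bar> * h x)"
    unfolding w_def
    using sub(4) \<eta>(3,4,5)
    by (intro ugrad_convex_comb[where M = B] ugrad_subset[OF u(2)] ugrad_subset[OF v(2)] \<eta>(2) cont) auto
  have dm: "(\<lambda>x. ennreal \<bar>u x - v x\<bar>) \<in> borel_measurable (restrict_space borel Ob)"
    using cont by (intro borel_measurable_continuous_on_restrict continuous_on_ennreal continuous_intros)
  then have dh: "(\<lambda>x. ennreal \<bar>u x - v x\<bar> * h x) \<in> borel_measurable (restrict_space borel Ob)"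
    using ugrad_meas[OF \<eta>(2)] by (rule borel_measurable_times_ennreal)
  have "(\<lambda>x. ennreal \<bar>u x - v x\<bar> * h x * indicator Ob x) \<in> borel_measurable borel"
    using dh op(6) by (subst (asm) borel_measurable_restrict_space_iff_ennreal) (auto simp: mult.commute)
  then have gm: "g \<in> borel_measurable borel"
    unfolding g_def using ugrad_indicator_measurable u(2) v(2) op(2,3) by (intro borel_measurable_add)
  have cases: "\<exists>W. open W \<and> x \<in> W \<and> W \<subseteq> U \<and> (W \<subseteq> N0 \<inter> G2 \<or> W \<subseteq> N1 \<inter> G1 \<or> W \<subseteq> Ob)" if x: "x \<in> U" for x
  proof -
    consider "x \<in> N0" | "x \<in> N1" | "x \<in> Ob" using sub(1) x by blast
    then show ?thesis
    proof cases
      case 1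
      then show ?thesis using op sub that by (intro exI[of _ "U \<inter> N0"]) auto
    next
      case 2
      then show ?thesis using op sub that by (intro exI[of _ "U \<inter> N1"]) auto
    next
      case 3
      then show ?thesis using op sub that by (intro exI[of _ "U \<inter> Ob"]) auto
    qed
  qed
  show "ugrad U w g"
  proof (rule ugrad_local)
    show "g \<in> borel_measurable (restrict_space borel U)" using gm by (rule measurable_restrict_space1)
    fix x assume "x \<in> U"
    then obtain W where W: "open W" "x \<in> W" "W \<subseteq> U" "W \<subseteq> N0 \<inter> G2 \<or> W \<subseteq> N1 \<inter> G1 \<or> W \<subseteq> Ob"
      using cases by blast
    have gW: "g \<in> borel_measurable (restrict_space borel W)" using gm by (rule measurable_restrict_space1)
    have "ugrad W w g" using W(4)
    proof (elim disjE)
      assume A: "W \<subseteq> N0 \<inter> G2"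
      show ?thesis
      proof (rule ugrad_mono[OF ugrad_subset[OF v(2)] gW])
        fix y assume "y \<in> W"
        then have "y \<in> N0" "y \<in> G2" using A by auto
        then show "g2 y \<le> g y" "v y = w y" using N(1) by (simp_all add: g_def w_def add_increasing add_increasing2)
      qed (use A in auto)
    next
      assume A: "W \<subseteq> N1 \<inter> G1"
      show ?thesis
      proof (rule ugrad_mono[OF ugrad_subset[OF u(2)] gW])
        fix y assume "y \<in> W"
        then have "y \<in> N1" "y \<in> G1" using A by auto
        then show "g1 y \<le> g y" "u y = w y" using N(2) by (simp_all add: g_def w_def add_increasing add_increasing2)
      qed (use A in auto)
    next
      assume A: "W \<subseteq> Ob"
      show ?thesis
        by (rule ugrad_mono[OF ugrad_subset[OF comb A] gW]) (use A sub(4) in \<open>auto simp: g_def indicator_def\<close>)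
    qed
    then show "\<exists>V. open V \<and> x \<in> V \<and> ugrad (V \<inter> U) w g" using W by (auto simp: Int_absorb2)
  qed
  show "lip_loc U w"
    unfolding lip_loc_iff[OF op(1)]
  proof
    fix x assume "x \<in> U"
    then obtain W where W: "open W" "x \<in> W" "W \<subseteq> U" "W \<subseteq> N0 \<inter> G2 \<or> W \<subseteq> N1 \<inter> G1 \<or> W \<subseteq> Ob"
      using cases by blast
    have transfer: "\<exists>e>0. ball x e \<subseteq> W \<and> (\<exists>L. L-lipschitz_on (ball x e) f)"
      if "lip_loc G f" "open G" "W \<subseteq> G" for G and f :: "'a \<Rightarrow> real"
      using lip_loc_iff[OF W(1), of f] lip_loc_subset[OF that(1,3)] W(2) by blast
    have "\<exists>e>0. ball x e \<subseteq> W \<and> (\<exists>L. L-lipschitz_on (ball x e) w)" using W(4)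
    proof (elim disjE)
      assume A: "W \<subseteq> N0 \<inter> G2"
      then obtain e L where e: "0 < e" "ball x e \<subseteq> W" "L-lipschitz_on (ball x e) v"
        using transfer[OF v(1) op(3)] by blast
      then have "L-lipschitz_on (ball x e) w"
        using A N(1) by (intro lipschitz_on_transform[OF e(3)]) (auto simp: w_def subset_iff)
      then show ?thesis using e by blast
    next
      assume A: "W \<subseteq> N1 \<inter> G1"
      then obtain e L where e: "0 < e" "ball x e \<subseteq> W" "L-lipschitz_on (ball x e) u"
        using transfer[OF u(1) op(2)] by blast
      then have "L-lipschitz_on (ball x e) w"
        using A N(2) by (intro lipschitz_on_transform[OF e(3)]) (auto simp: w_def subset_iff)
      then show ?thesis using e by blast
    next
      assume A: "W \<subseteq> Ob"
      obtain e1 L1 where e1: "0 < e1" "ball x e1 \<subseteq> W" "L1-lipschitz_on (ball x e1) u"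
        using transfer[OF u(1) op(2)] A sub(4) by blast
      obtain e2 L2 where e2: "0 < e2" "ball x e2 \<subseteq> W" "L2-lipschitz_on (ball x e2) v"
        using transfer[OF v(1) op(3)] A sub(4) by blast
      obtain e3 L3 where e3: "0 < e3" "ball x e3 \<subseteq> W" "L3-lipschitz_on (ball x e3) \<eta>"
        using transfer[OF \<eta>(1) op(6)] A by blast
      define e where "e = min e1 (min e2 e3)"
      have e: "0 < e" "ball x e \<subseteq> ball x e1" "ball x e \<subseteq> ball x e2" "ball x e \<subseteq> ball x e3"
        using e1 e2 e3 by (auto simp: e_def)
      have "\<exists>L. L-lipschitz_on (ball x e) w"
        unfolding w_def
        by (rule lipschitz_on_convex_comb[OF lipschitz_on_subset[OF e1(3) e(2)] lipschitz_on_subset[OF e2(3) e(3)]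
              lipschitz_on_subset[OF e3(3) e(4)] \<eta>(3) e(1)])
      then show ?thesis using e e1(2) by blast
    qed
    then show "\<exists>e>0. ball x e \<subseteq> U \<and> (\<exists>L. L-lipschitz_on (ball x e) w)"
      using W(3) by blast
  qed
qed

section \<open>Exhaustion of open sets by compactly contained ones\<close>

definition exhaustion :: "'a set \<Rightarrow> (nat \<Rightarrow> 'a set) \<Rightarrow> bool" where
  "exhaustion U Q \<longleftrightarrow> (\<forall>j. open (Q j) \<and> compact (closure (Q j)) \<and> closure (Q j) \<subseteq> Q (Suc j)) \<and> (\<Union>j. Q j) = U"

lemma exhaustion_mono:
  assumes "exhaustion U Q" "i \<le> j"
  shows "Q i \<subseteq> Q j"
  using assms(2)
proof (rule lift_Suc_mono_le[rotated])
  show "Q n \<subseteq> Q (Suc n)" for n using assms(1) closure_subset[of "Q n"] by (auto simp: exhaustion_def)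
qed

lemma exhaustion_compact_subset:
  assumes Q: "exhaustion U Q" and K: "compact K" "K \<subseteq> U"
  obtains j where "K \<subseteq> Q j"
proof -
  have "K \<subseteq> \<Union>(range Q)" "\<And>B. B \<in> range Q \<Longrightarrow> open B" using Q K by (auto simp: exhaustion_def)
  then obtain D where D: "D \<subseteq> range Q" "finite D" "K \<subseteq> \<Union>D" using K(1) by (meson compactE)
  then obtain J where J: "finite J" "D = Q ` J" by (meson finite_subset_image)
  have "\<Union>D \<subseteq> Q (Max J)"
    unfolding J(2) using J(1) by (intro Sup_least) (auto dest: subsetD[OF exhaustion_mono[OF Q Max_ge], rotated 2])
  from order_trans[OF D(3) this] show thesis by (rule that)
qed

lemma exhaustion_compactly_inside: "exhaustion U Q \<Longrightarrow> compactly_inside (Q j) U"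
  by (auto simp: exhaustion_def compactly_inside_def)

lemma exhaustion_open: "exhaustion U Q \<Longrightarrow> open (Q j)"
  by (auto simp: exhaustion_def)

lemma ex_exhaustion:
  assumes "open (U::'a set)"
  shows "\<exists>Q. exhaustion U Q"
proof -
  define a :: 'a where "a = undefined"
  \<comment> \<open>Asking for a ball of radius strictly above 1/(j+1) inside \<open>U\<close> makes
    \<open>Q j\<close> open and, unlike the distance to the complement, needs no exception for
    \<open>U = UNIV\<close>. The centre \<open>a\<close> is arbitrary.\<close>
  define Q where "Q j = ball a (real (Suc j)) \<inter> {x. \<exists>\<delta>>1 / real (Suc j). ball x \<delta> \<subseteq> U}" for j
  have op: "open (Q j)" for j
  proof -
    have "open {x. \<exists>\<delta>>1 / real (Suc j). ball x \<delta> \<subseteq> U}"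
      unfolding open_contains_ball
    proof safe
      fix x \<delta> assume \<delta>: "1 / real (Suc j) < \<delta>" "ball x \<delta> \<subseteq> U"
      define e where "e = (\<delta> - 1 / real (Suc j)) / 2"
      have e0: "0 < e" using \<delta> by (simp add: e_def)
      have "2 * e = \<delta> - 1 / real (Suc j)" unfolding e_def by (simp only: nonzero_mult_div_cancel_left[OF zero_neq_numeral[symmetric]] times_divide_eq_right)
      then have k: "1 / real (Suc j) = \<delta> - 2 * e" by (simp only: diff_diff_eq2)
      have "\<exists>\<delta>>1 / real (Suc j). ball y \<delta> \<subseteq> U" if "y \<in> ball x e" for y
      proof (intro exI[of _ "\<delta> - e"] conjI)
        show "1 / real (Suc j) < \<delta> - e" unfolding k using e0 by simp
        show "ball y (\<delta> - e) \<subseteq> U"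
        proof
          fix z assume "z \<in> ball y (\<delta> - e)"
          then have "z \<in> ball x \<delta>" using that dist_triangle[of x z y] by auto
          then show "z \<in> U" using \<delta> by blast
        qed
      qed
      then show "\<exists>e>0. ball x e \<subseteq> {x. \<exists>\<delta>>1 / real (Suc j). ball x \<delta> \<subseteq> U}" using e0 by blast
    qed
    then show ?thesis by (auto simp: Q_def)
  qed
  have cl: "closure (Q j) \<subseteq> cball a (real (Suc j))" for j
    by (rule closure_minimal) (auto simp: Q_def)
  have clQ: "closure (Q j) \<subseteq> Q (Suc j)" for j
  proof
    fix x assume x: "x \<in> closure (Q j)"
    have "ball x (1 / real (Suc j)) \<subseteq> U"
    proof
      fix z assume z: "z \<in> ball x (1 / real (Suc j))"
      then have "0 < 1 / real (Suc j) - dist x z" by simp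
      then obtain y where y: "y \<in> Q j" "dist y x < 1 / real (Suc j) - dist x z"
        using x unfolding closure_approachable by blast
      then obtain \<delta> where "1 / real (Suc j) < \<delta>" "ball y \<delta> \<subseteq> U" by (auto simp: Q_def)
      moreover have "dist y z < 1 / real (Suc j)" using y(2) dist_triangle[of y z x] by simp
      ultimately show "z \<in> U" by (force simp del: of_nat_Suc)
    qed
    moreover have "1 / real (Suc (Suc j)) < 1 / real (Suc j)" by (simp add: divide_strict_left_mono)
    moreover have "dist a x < real (Suc (Suc j))" using x cl by (force simp del: of_nat_Suc intro: le_less_trans)
    ultimately show "x \<in> Q (Suc j)"
      unfolding Q_def by (intro IntI CollectI exI[of _ "1 / real (Suc j)"] conjI) (simp_all only: mem_ball)
  qed
  have "(\<Union>j. Q j) = U"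
  proof
    show "(\<Union>j. Q j) \<subseteq> U"
    proof
      fix x assume "x \<in> (\<Union>j. Q j)"
      then obtain j \<delta> where "1 / real (Suc j) < \<delta>" "ball x \<delta> \<subseteq> U" by (auto simp: Q_def)
      moreover have "0 < \<delta>" using calculation(1) by (meson less_trans of_nat_0_less_iff zero_less_Suc zero_less_divide_1_iff)
      ultimately show "x \<in> U" by auto
    qed
    show "U \<subseteq> (\<Union>j. Q j)"
    proof
      fix x assume "x \<in> U"
      then obtain \<delta> where \<delta>: "0 < \<delta>" "ball x \<delta> \<subseteq> U" using assms open_contains_ball by blast
      obtain j1 :: nat where j1: "inverse (real (Suc j1)) < \<delta>" using reals_Archimedean[OF \<delta>(1)] by blast
      obtain j2 :: nat where j2: "dist a x < real j2" using reals_Archimedean2 by blast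
      define j where "j = max j1 j2"
      have "1 / real (Suc j) \<le> 1 / real (Suc j1)" by (simp add: j_def frac_le)
      then have "1 / real (Suc j) < \<delta>" using j1 by (simp add: inverse_eq_divide)
      moreover have "dist a x < real (Suc j)" using j2 by (simp add: j_def)
      ultimately have "x \<in> Q j" using \<delta> by (auto simp: Q_def)
      then show "x \<in> (\<Union>j. Q j)" by blast
    qed
  qed
  moreover have "compact (closure (Q j))" for j
    using compact_Int_closed[OF compact_cball closed_closure] cl by (metis inf.absorb_iff2)
  ultimately have "exhaustion U Q" using op clQ by (simp add: exhaustion_def)
  then show ?thesis by blast
qed

end

lemma liminf_superadditive_ennreal:
  fixes f g :: "nat \<Rightarrow> ennreal"
  shows "liminf f + liminf g \<le> liminf (\<lambda>n. f n + g n)"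
proof -
  have "liminf f + liminf g = (SUP n. (INF k\<in>{n..}. f k) + (INF k\<in>{n..}. g k))"
    unfolding liminf_SUP_INF
    by (intro ennreal_SUP_add[symmetric]) (auto simp: incseq_def intro!: INF_superset_mono)
  also have "\<dots> \<le> liminf (\<lambda>n. f n + g n)"
    unfolding liminf_SUP_INF
    by (intro SUP_mono') (auto intro!: INF_greatest add_mono INF_lower)
  finally show ?thesis .
qed

context doubling_space
begin

section \<open>Total variation on open sets\<close>

abbreviation L1 :: "'a set \<Rightarrow> ('a \<Rightarrow> real) \<Rightarrow> ('a \<Rightarrow> real) \<Rightarrow> ennreal" where
  "L1 V u v \<equiv> \<integral>\<^sup>+x\<in>V. ennreal \<bar>u x - v x\<bar> \<partial>M"

abbreviation tv :: "('a \<Rightarrow> real) \<Rightarrow> 'a set \<Rightarrow> ennreal" where "tv \<equiv> total_variation_open m"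

lemma compactly_inside_subset: "compactly_inside V U \<Longrightarrow> V \<subseteq> (U::'a set)"
  using closure_subset by (auto simp: compactly_inside_def)

lemma lip_loc_measurable:
  assumes "open U" "lip_loc U w" "V \<subseteq> U" "open V"
  shows "(\<lambda>x. w x * indicator V x :: real) \<in> borel_measurable M"
proof -
  have "continuous_on V w" using lip_loc_continuous[OF assms(1,2)] assms(3) continuous_on_subset by blast
  then have "(\<lambda>x. indicator V x *\<^sub>R w x) \<in> borel_measurable borel"
    using assms(4) by (intro borel_measurable_continuous_on_indicator) auto
  then show ?thesis by (intro measurable_M_borel) (simp add: mult.commute)
qed

lemma lip_loc_diff_measurable:
  assumes "open U" "lip_loc U w" "V \<subseteq> U" "open V" and u: "u \<in> borel_measurable M"
  shows "(\<lambda>x. ennreal \<bar>w x - u x\<bar> * indicator V x) \<in> borel_measurable M"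
proof -
  have "(\<lambda>x. w x * indicator V x - u x * indicator V x) \<in> borel_measurable M"
    using u assms(4)
    by (intro borel_measurable_diff borel_measurable_times borel_measurable_indicator sets_M_borel lip_loc_measurable[OF assms(1-4)]) auto
  from measurable_compose[OF this, of "\<lambda>y. ennreal \<bar>y\<bar>" borel]
  have "(\<lambda>x. ennreal \<bar>w x * indicator V x - u x * indicator V x\<bar>) \<in> borel_measurable M"
    by simp
  moreover have "ennreal \<bar>w x * indicator V x - u x * indicator V x\<bar> = ennreal \<bar>w x - u x\<bar> * indicator V x" for x
    by (auto simp: indicator_def)
  ultimately show ?thesis by simp
qed

text \<open>A small liminf gives infinitely many indices with small energy, convergence gives
  closeness at all large indices; some index has both.\<close>

lemma tv_approx:
  assumes "tv u U < a" "compactly_inside V U" "0 < \<epsilon>"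
  obtains w g where "lip_loc U w" "ugrad U w g" "(\<integral>\<^sup>+x\<in>U. g x \<partial>M) < a"
    and "(L1 V w u) < ennreal \<epsilon>"
proof -
  obtain us g where ug: "\<And>i. lip_loc U (us i)" "\<And>i. ugrad U (us i) (g i)" "converges_L1_loc m U us u"
    and lim: "liminf (\<lambda>i. \<integral>\<^sup>+x\<in>U. g i x \<partial>M) < a"
    using assms(1) by (auto simp: total_variation_open_def Inf_less_iff)
  have fr: "\<exists>\<^sub>F i in sequentially. (\<integral>\<^sup>+x\<in>U. g i x \<partial>M) < a"
  proof (rule ccontr)
    assume "\<not> (\<exists>\<^sub>F i in sequentially. (\<integral>\<^sup>+x\<in>U. g i x \<partial>M) < a)"
    then have "\<forall>\<^sub>F i in sequentially. a \<le> (\<integral>\<^sup>+x\<in>U. g i x \<partial>M)" by (simp add: not_frequently not_less)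
    then have "a \<le> liminf (\<lambda>i. \<integral>\<^sup>+x\<in>U. g i x \<partial>M)" by (rule Liminf_bounded)
    then show False using lim by simp
  qed
  have "(\<lambda>i. L1 V (us i) u) \<longlonglongrightarrow> 0"
    using ug(3) assms(2) by (auto simp: converges_L1_loc_def)
  then have "\<forall>\<^sub>F i in sequentially. (L1 V (us i) u) < ennreal \<epsilon>"
    using assms(3) by (intro order_tendstoD) auto
  then have "\<forall>\<^sub>F i in sequentially. (\<integral>\<^sup>+x\<in>U. g i x \<partial>M) < a \<longrightarrow>
      (L1 V (us i) u) < ennreal \<epsilon> \<and> (\<integral>\<^sup>+x\<in>U. g i x \<partial>M) < a"
    by eventually_elim simp
  from frequently_ex[OF frequently_rev_mp[OF fr this]]
  obtain i where "(L1 V (us i) u) < ennreal \<epsilon>" "(\<integral>\<^sup>+x\<in>U. g i x \<partial>M) < a" by blast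
  then show thesis using that ug(1,2) by blast
qed

text \<open>A diagonal choice along an exhaustion turns approximations that depend on
  \<open>V\<close> and \<open>\<epsilon>\<close> into a single sequence converging on every
  compactly contained set. Together with \<open>tv_approx\<close> this removes sequences from most
  arguments about the variation.\<close>

lemma tv_leI:
  assumes "open U"
    and ap: "\<And>V \<epsilon>. compactly_inside V U \<Longrightarrow> 0 < \<epsilon> \<Longrightarrow> \<exists>w g. lip_loc U w \<and> ugrad U w g \<and>
      (\<integral>\<^sup>+x\<in>U. g x \<partial>M) \<le> a + ennreal \<epsilon> \<and> (L1 V w u) \<le> ennreal \<epsilon>"
  shows "tv u U \<le> a"
proof -
  obtain Q where Q: "exhaustion U Q" using ex_exhaustion[OF assms(1)] by blast
  have "\<forall>j. \<exists>w g. lip_loc U w \<and> ugrad U w g \<and>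
      (\<integral>\<^sup>+x\<in>U. g x \<partial>M) \<le> a + ennreal (inverse (real (Suc j))) \<and>
      (L1 (Q j) w u) \<le> ennreal (inverse (real (Suc j)))"
    using ap exhaustion_compactly_inside[OF Q] by simp
  then obtain w g where w: "\<And>j. lip_loc U (w j)" "\<And>j. ugrad U (w j) (g j)"
    and g: "\<And>j. (\<integral>\<^sup>+x\<in>U. g j x \<partial>M) \<le> a + ennreal (inverse (real (Suc j)))"
    and c: "\<And>j. (L1 (Q j) (w j) u) \<le> ennreal (inverse (real (Suc j)))"
    unfolding choice_iff by (elim exE) (simp only: all_conj_distrib, elim conjE, rule that, (erule spec)+)
  have inv: "(\<lambda>j. ennreal (inverse (real (Suc j)))) \<longlonglongrightarrow> 0"
    using tendsto_ennrealI[OF LIMSEQ_inverse_real_of_nat] by simp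
  have "converges_L1_loc m U w u"
    unfolding converges_L1_loc_def
  proof (intro allI impI)
    fix V assume V: "compactly_inside V U"
    then obtain j0 where j0: "closure V \<subseteq> Q j0"
      using exhaustion_compact_subset[OF Q] by (auto simp: compactly_inside_def)
    have "(L1 V (w j) u) \<le> ennreal (inverse (real (Suc j)))" if "j0 \<le> j" for j
    proof -
      have "V \<subseteq> Q j" using j0 exhaustion_mono[OF Q that] closure_subset[of V] by blast
      then have "(L1 V (w j) u) \<le> (L1 (Q j) (w j) u)"
        by (intro nn_integral_mono) (auto simp: indicator_def)
      then show ?thesis using c[of j] by (rule order_trans)
    qed
    then show "(\<lambda>j. L1 V (w j) u) \<longlonglongrightarrow> 0"
      by (intro tendsto_sandwich[OF _ _ tendsto_const inv]) (auto simp: eventually_sequentially)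
  qed
  then have "tv u U \<le> liminf (\<lambda>i. \<integral>\<^sup>+x\<in>U. g i x \<partial>M)"
    unfolding total_variation_open_def using w by (intro Inf_lower) blast
  also have "\<dots> \<le> liminf (\<lambda>j. a + ennreal (inverse (real (Suc j))))"
    by (intro Liminf_mono always_eventually allI g)
  also have "(\<lambda>j. a + ennreal (inverse (real (Suc j)))) \<longlonglongrightarrow> a + 0"
    by (intro tendsto_add tendsto_const inv)
  then have "liminf (\<lambda>j. a + ennreal (inverse (real (Suc j)))) = a"
    by (simp add: lim_imp_Liminf)
  finally show ?thesis .
qed

lemma tv_subset:
  assumes "open U" "open V" "U \<subseteq> V"
  shows "tv u U \<le> tv u V"
  unfolding total_variation_open_def
proof (rule Inf_mono)
  fix t assume "t \<in> {liminf (\<lambda>i. \<integral>\<^sup>+x\<in>V. g i x \<partial>M) | us g. (\<forall>i. lip_loc V (us i)) \<and>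
      (\<forall>i. ugrad V (us i) (g i)) \<and> converges_L1_loc m V us u}"
  then obtain us g where t: "t = liminf (\<lambda>i. \<integral>\<^sup>+x\<in>V. g i x \<partial>M)" and
    us: "\<And>i. lip_loc V (us i)" "\<And>i. ugrad V (us i) (g i)" "converges_L1_loc m V us u" by blast
  have "lip_loc U (us i)" "ugrad U (us i) (g i)" for i
    using us lip_loc_subset ugrad_subset assms(3) by blast+
  moreover have "converges_L1_loc m U us u"
    using us(3) assms(3) by (auto simp: converges_L1_loc_def compactly_inside_def)
  ultimately have "liminf (\<lambda>i. \<integral>\<^sup>+x\<in>U. g i x \<partial>M) \<in> {liminf (\<lambda>i. \<integral>\<^sup>+x\<in>U. g i x \<partial>M) | us g. (\<forall>i. lip_loc U (us i)) \<and>
      (\<forall>i. ugrad U (us i) (g i)) \<and> converges_L1_loc m U us u}" by blast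
  moreover have "liminf (\<lambda>i. \<integral>\<^sup>+x\<in>U. g i x \<partial>M) \<le> t"
    unfolding t using assms(3)
    by (intro Liminf_mono always_eventually allI nn_integral_mono) (auto simp: indicator_def)
  ultimately show "\<exists>s\<in>{liminf (\<lambda>i. \<integral>\<^sup>+x\<in>U. g i x \<partial>M) | us g. (\<forall>i. lip_loc U (us i)) \<and>
      (\<forall>i. ugrad U (us i) (g i)) \<and> converges_L1_loc m U us u}. s \<le> t" by blast
qed

lemma tv_cong:
  assumes "\<And>x. x \<in> U \<Longrightarrow> u x = v x"
  shows "tv u U = tv v U"
proof -
  have "converges_L1_loc m U us u = converges_L1_loc m U us v" for us
    unfolding converges_L1_loc_def
  proof (intro all_cong1 imp_cong refl)
    fix V assume "compactly_inside V U"
    then have "V \<subseteq> U" by (rule compactly_inside_subset)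
    then have "(L1 V (us i) u) = (L1 V (us i) v)" for i
      using assms by (intro nn_integral_cong) (auto simp: indicator_def subset_iff)
    then show "((\<lambda>i. L1 V (us i) u) \<longlonglongrightarrow> 0) = ((\<lambda>i. L1 V (us i) v) \<longlonglongrightarrow> 0)"
      by simp
  qed
  then show ?thesis by (simp add: total_variation_open_def)
qed

lemma tv_const:
  assumes "open U"
  shows "tv (\<lambda>_. c) U = 0"
proof -
  have "tv (\<lambda>_. c) U \<le> 0"
    by (rule tv_leI[OF assms], rule exI[of _ "\<lambda>_. c"], rule exI[of _ "\<lambda>_. 0"])
      (simp add: ugrad_const lip_loc_const)
  then show ?thesis by simp
qed

lemma tv_empty: "tv u {} = 0"
  using tv_const[of "{}" 0] tv_cong[of "{}" u "\<lambda>_. 0"] by simp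

lemma tv_reflect_le:
  assumes "open U"
  shows "tv (\<lambda>x. c - u x) U \<le> tv u U"
proof (cases "tv u U = \<infinity>")
  case False
  show ?thesis
  proof (rule tv_leI[OF assms])
    fix V and \<epsilon> :: real assume V: "compactly_inside V U" and \<epsilon>: "0 < \<epsilon>"
    have "tv u U < tv u U + ennreal \<epsilon>" using ennreal_add_left_cancel_less[of "tv u U" 0 "ennreal \<epsilon>"] False \<epsilon> by simp
    from tv_approx[OF this V \<epsilon>] obtain w g where w: "lip_loc U w" "ugrad U w g"
      "(\<integral>\<^sup>+x\<in>U. g x \<partial>M) < tv u U + ennreal \<epsilon>" "(L1 V w u) < ennreal \<epsilon>" by blast
    have "lip_loc U (\<lambda>x. c - w x)"
      using w(1) by (auto simp: lip_loc_def lipschitz_on_def dist_real_def abs_minus_commute)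
    moreover have "ugrad U (\<lambda>x. c - w x) g"
      using w(2) by (simp add: ugrad_def abs_minus_commute)
    moreover have "(\<integral>\<^sup>+x\<in>V. ennreal \<bar>(c - w x) - (c - u x)\<bar> \<partial>M) = (L1 V w u)"
      by (simp add: abs_minus_commute)
    ultimately show "\<exists>w g. lip_loc U w \<and> ugrad U w g \<and> (\<integral>\<^sup>+x\<in>U. g x \<partial>M) \<le> tv u U + ennreal \<epsilon> \<and>
        (\<integral>\<^sup>+x\<in>V. ennreal \<bar>w x - (c - u x)\<bar> \<partial>M) \<le> ennreal \<epsilon>"
      using w(3,4) by (intro exI[of _ "\<lambda>x. c - w x"] exI[of _ g]) auto
  qed
qed simp

text \<open>Used with c = 1 to pass to the complement of a set, and with c = 0 to change the sign of
  an indicator.\<close>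

lemma tv_reflect: "open U \<Longrightarrow> tv (\<lambda>x. c - u x) U = tv u U"
  using tv_reflect_le[of U c u] tv_reflect_le[of U c "\<lambda>x. c - u x"] by simp

lemma ugrad_integral_measurable:
  assumes "ugrad U u g" "open A" "A \<subseteq> U"
  shows "(\<lambda>x. g x * indicator A x) \<in> borel_measurable M"
  by (rule measurable_M_borel[OF ugrad_indicator_measurable[OF ugrad_subset[OF assms(1,3)] assms(2)]])

text \<open>A sequence that is admissible for the union restricts to one for each part, and the
  liminf of a sum is at least the sum of the liminfs.\<close>

lemma tv_superadditive:
  assumes "open A" "open B" "A \<inter> B = {}"
  shows "tv u A + tv u B \<le> tv u (A \<union> B)"
  unfolding total_variation_open_def[of m u "A \<union> B"]
proof (rule Inf_greatest)
  fix t assume "t \<in> {liminf (\<lambda>i. \<integral>\<^sup>+x\<in>A \<union> B. g i x \<partial>M) | us g. (\<forall>i. lip_loc (A \<union> B) (us i)) \<and>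
      (\<forall>i. ugrad (A \<union> B) (us i) (g i)) \<and> converges_L1_loc m (A \<union> B) us u}"
  then obtain us g where t: "t = liminf (\<lambda>i. \<integral>\<^sup>+x\<in>A \<union> B. g i x \<partial>M)" and
    us: "\<And>i. lip_loc (A \<union> B) (us i)" "\<And>i. ugrad (A \<union> B) (us i) (g i)" "converges_L1_loc m (A \<union> B) us u" by blast
  have le: "tv u W \<le> liminf (\<lambda>i. \<integral>\<^sup>+x\<in>W. g i x \<partial>M)" if W: "W \<subseteq> A \<union> B" for W
  proof -
    have "lip_loc W (us i)" "ugrad W (us i) (g i)" for i
      using us lip_loc_subset ugrad_subset W by blast+
    moreover have "converges_L1_loc m W us u"
      using us(3) W by (auto simp: converges_L1_loc_def compactly_inside_def)
    ultimately show ?thesis unfolding total_variation_open_def by (intro Inf_lower) blast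
  qed
  have "tv u A + tv u B \<le> liminf (\<lambda>i. \<integral>\<^sup>+x\<in>A. g i x \<partial>M) + liminf (\<lambda>i. \<integral>\<^sup>+x\<in>B. g i x \<partial>M)"
    by (intro add_mono le) auto
  also have "\<dots> \<le> liminf (\<lambda>i. (\<integral>\<^sup>+x\<in>A. g i x \<partial>M) + (\<integral>\<^sup>+x\<in>B. g i x \<partial>M))"
    by (rule liminf_superadditive_ennreal)
  also have "(\<lambda>i. (\<integral>\<^sup>+x\<in>A. g i x \<partial>M) + (\<integral>\<^sup>+x\<in>B. g i x \<partial>M)) = (\<lambda>i. \<integral>\<^sup>+x\<in>A \<union> B. g i x \<partial>M)"
  proof
    fix i
    have "(\<integral>\<^sup>+x\<in>A. g i x \<partial>M) + (\<integral>\<^sup>+x\<in>B. g i x \<partial>M) = (\<integral>\<^sup>+x. g i x * indicator A x + g i x * indicator B x \<partial>M)"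
      using ugrad_integral_measurable[OF us(2)] assms by (intro nn_integral_add[symmetric]) auto
    also have "\<dots> = (\<integral>\<^sup>+x\<in>A \<union> B. g i x \<partial>M)"
      using assms(3) by (intro nn_integral_cong) (auto simp: indicator_def)
    finally show "(\<integral>\<^sup>+x\<in>A. g i x \<partial>M) + (\<integral>\<^sup>+x\<in>B. g i x \<partial>M) = (\<integral>\<^sup>+x\<in>A \<union> B. g i x \<partial>M)" .
  qed
  finally show "tv u A + tv u B \<le> t" by (simp add: t)
qed

text \<open>A good approximation of \<open>v\<close> on a compactly contained set is one of
  \<open>u\<close> as well. The form with \<open>\<epsilon>\<close> fits the cutting arguments
  below, where a competitor \<open>v\<close> is built for each \<open>\<epsilon>\<close>.\<close>

lemma tv_lsc:
  assumes U: "open U" and u: "u \<in> borel_measurable M"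
    and ap: "\<And>\<epsilon>. 0 < \<epsilon> \<Longrightarrow> \<exists>v\<in>borel_measurable M. tv v U \<le> a + ennreal \<epsilon> \<and> (L1 U v u) \<le> ennreal \<epsilon>"
  shows "tv u U \<le> a"
proof (cases "a = \<infinity>")
  case False
  show ?thesis
  proof (rule tv_leI[OF U])
    fix V and \<epsilon> :: real assume V: "compactly_inside V U" and \<epsilon>: "0 < \<epsilon>"
    obtain v where v: "v \<in> borel_measurable M" "tv v U \<le> a + ennreal (\<epsilon>/2)"
      "(L1 U v u) \<le> ennreal (\<epsilon>/2)"
      using ap[of "\<epsilon>/2"] \<epsilon> by auto
    have lt: "a + ennreal (\<epsilon>/2) < a + ennreal \<epsilon>"
      using False \<epsilon> by (simp add: ennreal_lessI ennreal_add_left_cancel_less)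
    have "0 < \<epsilon>/2" using \<epsilon> by simp
    from tv_approx[OF le_less_trans[OF v(2) lt] V this] obtain w g where w: "lip_loc U w" "ugrad U w g"
      "(\<integral>\<^sup>+x\<in>U. g x \<partial>M) < a + ennreal \<epsilon>" "(L1 V w v) < ennreal (\<epsilon>/2)" by blast
    have VU: "V \<subseteq> U" "open V" using V compactly_inside_subset by (auto simp: compactly_inside_def)
    have "(L1 V w u) \<le> (\<integral>\<^sup>+x. ennreal \<bar>w x - v x\<bar> * indicator V x + ennreal \<bar>v x - u x\<bar> * indicator U x \<partial>M)"
      using VU by (intro nn_integral_mono) (auto simp: indicator_def simp flip: ennreal_plus intro!: ennreal_leI)
    also have "\<dots> = (L1 V w v) + (L1 U v u)"
    proof (rule nn_integral_add)
      show "(\<lambda>x. ennreal \<bar>w x - v x\<bar> * indicator V x) \<in> borel_measurable M"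
        by (rule lip_loc_diff_measurable[OF U w(1) VU v(1)])
      show "(\<lambda>x. ennreal \<bar>v x - u x\<bar> * indicator U x) \<in> borel_measurable M"
        using u v(1) U by (intro borel_measurable_times_ennreal borel_measurable_indicator) (auto simp: sets_M_borel)
    qed
    also have "\<dots> \<le> ennreal (\<epsilon>/2) + ennreal (\<epsilon>/2)"
      using w(4) v(3) by (intro add_mono) auto
    also have "\<dots> = ennreal \<epsilon>" using \<epsilon> by (simp flip: ennreal_plus)
    finally show "\<exists>w g. lip_loc U w \<and> ugrad U w g \<and> (\<integral>\<^sup>+x\<in>U. g x \<partial>M) \<le> a + ennreal \<epsilon> \<and>
        (L1 V w u) \<le> ennreal \<epsilon>"
      using w by (intro exI[of _ w] exI[of _ g]) auto
  qed
qed simp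

lemma tv_approx_finite:
  assumes "tv u U < \<infinity>" "compactly_inside V U" "0 < \<epsilon>"
  obtains w g where "lip_loc U w" "ugrad U w g" "(\<integral>\<^sup>+x\<in>U. g x \<partial>M) \<le> tv u U + ennreal \<epsilon>"
    and "(L1 V w u) \<le> ennreal \<epsilon>"
proof -
  have "tv u U < tv u U + ennreal \<epsilon>"
    using ennreal_add_left_cancel_less[of "tv u U" 0 "ennreal \<epsilon>"] assms by simp
  from tv_approx[OF this assms(2,3)] obtain w g where "lip_loc U w" "ugrad U w g"
    "(\<integral>\<^sup>+x\<in>U. g x \<partial>M) < tv u U + ennreal \<epsilon>" "(L1 V w u) < ennreal \<epsilon>" by blast
  then show thesis by (intro that[of w g] less_imp_le)
qed

text \<open>Approximations \<open>u'\<close> and \<open>v'\<close> are glued; in the transition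
  region |u' - v'| is replaced by |u - v|, at the price of their L1 errors times the bound
  \<open>B\<close> for \<open>h\<close>.\<close>

lemma tv_glue:
  fixes u v \<eta> :: "'a \<Rightarrow> real"
  assumes op: "open U" "open G1" "open G2" "open N0" "open N1" "open Ob"
    and uv: "u \<in> borel_measurable M" "v \<in> borel_measurable M"
    and \<eta>: "lip_loc Ob \<eta>" "ugrad Ob \<eta> h" "\<And>x. 0 \<le> \<eta> x \<and> \<eta> x \<le> 1" "\<And>x. x \<in> Ob \<Longrightarrow> h x \<le> ennreal B" "0 \<le> B"
    and N: "\<And>x. x \<in> N0 \<Longrightarrow> \<eta> x = 0" "\<And>x. x \<in> N1 \<Longrightarrow> \<eta> x = 1"
    and sub: "U \<subseteq> N0 \<union> N1 \<union> Ob" "U \<inter> N0 \<subseteq> G2" "U \<inter> N1 \<subseteq> G1"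
    and Ob: "compact (closure Ob)" "closure Ob \<subseteq> G1 \<inter> G2"
  shows "tv (\<lambda>x. \<eta> x * u x + (1 - \<eta> x) * v x) U \<le> tv u G1 + tv v G2 + (\<integral>\<^sup>+x\<in>Ob. ennreal \<bar>u x - v x\<bar> * h x \<partial>M)"
    (is "tv ?w U \<le> _ + _ + ?T")
proof (cases "tv u G1 = \<infinity> \<or> tv v G2 = \<infinity>")
  case True
  then show ?thesis by auto
next
  case False
  have ObG: "Ob \<subseteq> G1 \<inter> G2" using Ob(2) closure_subset[of Ob] by blast
  show ?thesis
  proof (rule tv_leI[OF op(1)])
    fix V and \<epsilon> :: real assume V: "compactly_inside V U" and \<epsilon>: "0 < \<epsilon>"
    \<comment> \<open>Two errors \<open>\<epsilon>'\<close> come from the two variations and two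
      errors \<open>B\<close> times \<open>\<epsilon>'\<close> from the transition region.\<close>
    define \<epsilon>' where "\<epsilon>' = \<epsilon> / (2 + 2 * B)"
    have \<epsilon>': "0 < \<epsilon>'" "(2 + 2 * B) * \<epsilon>' = \<epsilon>" using \<epsilon> \<eta>(5) by (auto simp: \<epsilon>'_def)
    have cV: "compact (closure V)" "closure V \<subseteq> U" using V by (auto simp: compactly_inside_def)
    \<comment> \<open>\<open>u'\<close> must be close to \<open>u\<close> wherever it can have
      positive weight, that is on \<open>V\<close> outside \<open>N0\<close>, and on the transition
      region. The same goes for \<open>v'\<close> with \<open>N1\<close> in place of
      \<open>N0\<close>.\<close>
    have "compact (closure V - N0 \<union> closure Ob)"
      using cV Ob op(4) by (intro compact_Un compact_diff)
    moreover have "closure V - N0 \<union> closure Ob \<subseteq> G1"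
      using cV(2) Ob(2) sub(1,3) ObG by blast
    ultimately obtain V1 where V1: "compactly_inside V1 G1" "closure V - N0 \<union> closure Ob \<subseteq> V1"
      using compactly_insideE[OF _ op(2)] by blast
    have "compact (closure V - N1 \<union> closure Ob)"
      using cV Ob op(5) by (intro compact_Un compact_diff)
    moreover have "closure V - N1 \<union> closure Ob \<subseteq> G2"
      using cV(2) Ob(2) sub(1,2) ObG by blast
    ultimately obtain V2 where V2: "compactly_inside V2 G2" "closure V - N1 \<union> closure Ob \<subseteq> V2"
      using compactly_insideE[OF _ op(3)] by blast
    obtain u' g1 where u': "lip_loc G1 u'" "ugrad G1 u' g1" "(\<integral>\<^sup>+x\<in>G1. g1 x \<partial>M) \<le> tv u G1 + ennreal \<epsilon>'"
      "(L1 V1 u' u) \<le> ennreal \<epsilon>'"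
      using tv_approx_finite[OF _ V1(1) \<epsilon>'(1), of u] False by (auto simp: less_top)
    obtain v' g2 where v': "lip_loc G2 v'" "ugrad G2 v' g2" "(\<integral>\<^sup>+x\<in>G2. g2 x \<partial>M) \<le> tv v G2 + ennreal \<epsilon>'"
      "(L1 V2 v' v) \<le> ennreal \<epsilon>'"
      using tv_approx_finite[OF _ V2(1) \<epsilon>'(1), of v] False by (auto simp: less_top)
    let ?w' = "\<lambda>x. \<eta> x * u' x + (1 - \<eta> x) * v' x"
    let ?g = "\<lambda>x. g1 x * indicator G1 x + g2 x * indicator G2 x + ennreal \<bar>u' x - v' x\<bar> * h x * indicator Ob x"
    have gl: "lip_loc U ?w'" "ugrad U ?w' ?g"
      using glue[OF op u'(1,2) v'(1,2) \<eta> N sub ObG] by auto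
    have V1s: "open V1" "V1 \<subseteq> G1" and V2s: "open V2" "V2 \<subseteq> G2"
      using V1(1) V2(1) compactly_inside_subset by (auto simp: compactly_inside_def)
    have ObV: "Ob \<subseteq> V1" "Ob \<subseteq> V2" using V1(2) V2(2) closure_subset[of Ob] by auto
    have m1: "(\<lambda>x. g1 x * indicator G1 x) \<in> borel_measurable M" "(\<lambda>x. g2 x * indicator G2 x) \<in> borel_measurable M"
      using ugrad_integral_measurable u'(2) v'(2) op by auto
    have mu: "(\<lambda>x. ennreal \<bar>u' x - u x\<bar> * indicator V1 x) \<in> borel_measurable M"
      by (rule lip_loc_diff_measurable[OF op(2) u'(1) V1s(2,1) uv(1)])
    have mv: "(\<lambda>x. ennreal \<bar>v' x - v x\<bar> * indicator V2 x) \<in> borel_measurable M"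
      by (rule lip_loc_diff_measurable[OF op(3) v'(1) V2s(2,1) uv(2)])
    have mh: "(\<lambda>x. h x * indicator Ob x) \<in> borel_measurable M"
      by (rule ugrad_integral_measurable[OF \<eta>(2) op(6) order_refl])
    have mo: "(\<lambda>x. ennreal \<bar>u x - v x\<bar> * (h x * indicator Ob x)) \<in> borel_measurable M"
      using uv by (intro borel_measurable_times_ennreal mh) simp
    have "(\<integral>\<^sup>+x\<in>U. ?g x \<partial>M) \<le> (\<integral>\<^sup>+x. g1 x * indicator G1 x + g2 x * indicator G2 x +
        (ennreal \<bar>u x - v x\<bar> * (h x * indicator Ob x) + (ennreal B * (ennreal \<bar>u' x - u x\<bar> * indicator V1 x)
           + ennreal B * (ennreal \<bar>v' x - v x\<bar> * indicator V2 x))) \<partial>M)"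
    proof (rule nn_integral_mono)
      fix x
      have "ennreal \<bar>u' x - v' x\<bar> * h x * indicator Ob x \<le> ennreal \<bar>u x - v x\<bar> * (h x * indicator Ob x) +
         (ennreal B * (ennreal \<bar>u' x - u x\<bar> * indicator V1 x) + ennreal B * (ennreal \<bar>v' x - v x\<bar> * indicator V2 x))"
      proof (cases "x \<in> Ob")
        case True
        have "ennreal \<bar>u' x - v' x\<bar> \<le> ennreal \<bar>u x - v x\<bar> + (ennreal \<bar>u' x - u x\<bar> + ennreal \<bar>v' x - v x\<bar>)"
          by (simp flip: ennreal_plus)
        then have "ennreal \<bar>u' x - v' x\<bar> * h x \<le> (ennreal \<bar>u x - v x\<bar> + (ennreal \<bar>u' x - u x\<bar> + ennreal \<bar>v' x - v x\<bar>)) * h x"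
          by (rule mult_right_mono) simp
        also have "\<dots> = ennreal \<bar>u x - v x\<bar> * h x + (h x * ennreal \<bar>u' x - u x\<bar> + h x * ennreal \<bar>v' x - v x\<bar>)"
          by (simp only: distrib_left mult.commute[of _ "h x"])
        also have "\<dots> \<le> ennreal \<bar>u x - v x\<bar> * h x + (ennreal B * ennreal \<bar>u' x - u x\<bar> + ennreal B * ennreal \<bar>v' x - v x\<bar>)"
          using \<eta>(4)[OF True] by (intro add_mono mult_right_mono order_refl) auto
        finally show ?thesis using True ObV by (auto simp: subset_iff)
      qed simp
      then show "?g x * indicator U x \<le> g1 x * indicator G1 x + g2 x * indicator G2 x +
        (ennreal \<bar>u x - v x\<bar> * (h x * indicator Ob x) + (ennreal B * (ennreal \<bar>u' x - u x\<bar> * indicator V1 x)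
           + ennreal B * (ennreal \<bar>v' x - v x\<bar> * indicator V2 x)))"
        by (cases "x \<in> U") (auto intro: add_left_mono)
    qed
    also have "\<dots> = (\<integral>\<^sup>+x\<in>G1. g1 x \<partial>M) + (\<integral>\<^sup>+x\<in>G2. g2 x \<partial>M) +
        (?T + (ennreal B * (L1 V1 u' u) + ennreal B * (L1 V2 v' v)))"
      using m1 mu mv mo by (simp add: nn_integral_add nn_integral_cmult mult.assoc)
    also have "\<dots> \<le> (tv u G1 + ennreal \<epsilon>') + (tv v G2 + ennreal \<epsilon>') + (?T + (ennreal B * ennreal \<epsilon>' + ennreal B * ennreal \<epsilon>'))"
      by (intro add_mono mult_left_mono u' v' order_refl) auto
    also have "\<dots> = tv u G1 + tv v G2 + ?T + (ennreal \<epsilon>' + ennreal \<epsilon>' + (ennreal B * ennreal \<epsilon>' + ennreal B * ennreal \<epsilon>'))"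
      by (simp only: ac_simps)
    also have "ennreal \<epsilon>' + ennreal \<epsilon>' + (ennreal B * ennreal \<epsilon>' + ennreal B * ennreal \<epsilon>') = ennreal \<epsilon>"
      unfolding \<epsilon>'(2)[symmetric] using \<epsilon>'(1) \<eta>(5) by (simp add: algebra_simps flip: ennreal_plus ennreal_mult)
    finally have G: "(\<integral>\<^sup>+x\<in>U. ?g x \<partial>M) \<le> tv u G1 + tv v G2 + ?T + ennreal \<epsilon>" .
    let ?c = "\<lambda>x. ennreal \<bar>u' x - u x\<bar> * indicator V1 x" and ?d = "\<lambda>x. ennreal \<bar>v' x - v x\<bar> * indicator V2 x"
    have "(L1 V ?w' ?w) \<le> (\<integral>\<^sup>+x. ?c x + ?d x \<partial>M)"
    proof (rule nn_integral_mono)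
      fix x
      show "ennreal \<bar>?w' x - ?w x\<bar> * indicator V x \<le> ?c x + ?d x"
      proof (cases "x \<in> V")
        case True
        then have x: "x \<in> closure V" using closure_subset by blast
        have eq: "?w' x - ?w x = \<eta> x * (u' x - u x) + (1 - \<eta> x) * (v' x - v x)" by (simp add: algebra_simps)
        have "\<bar>?w' x - ?w x\<bar> \<le> \<eta> x * \<bar>u' x - u x\<bar> + (1 - \<eta> x) * \<bar>v' x - v x\<bar>"
          unfolding eq using \<eta>(3)[of x] by (intro order_trans[OF abs_triangle_ineq]) (simp add: abs_mult)
        from ennreal_leI[OF this]
        have le: "ennreal \<bar>?w' x - ?w x\<bar> \<le> ennreal (\<eta> x * \<bar>u' x - u x\<bar>) + ennreal ((1 - \<eta> x) * \<bar>v' x - v x\<bar>)"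
          using \<eta>(3)[of x] by (simp add: ennreal_plus)
        have "ennreal (\<eta> x * \<bar>u' x - u x\<bar>) \<le> ?c x"
        proof (cases "x \<in> N0")
          case False
          then have "x \<in> V1" using x V1(2) by blast
          then show ?thesis using \<eta>(3)[of x] by (auto intro!: ennreal_leI mult_left_le_one_le)
        qed (simp add: N(1))
        moreover have "ennreal ((1 - \<eta> x) * \<bar>v' x - v x\<bar>) \<le> ?d x"
        proof (cases "x \<in> N1")
          case False
          then have "x \<in> V2" using x V2(2) by blast
          then show ?thesis using \<eta>(3)[of x] by (auto intro!: ennreal_leI mult_left_le_one_le)
        qed (simp add: N(2))
        ultimately have "ennreal (\<eta> x * \<bar>u' x - u x\<bar>) + ennreal ((1 - \<eta> x) * \<bar>v' x - v x\<bar>) \<le> ?c x + ?d x"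
          by (rule add_mono)
        from order_trans[OF le this] show ?thesis using True by simp
      qed simp
    qed
    also have "\<dots> = (\<integral>\<^sup>+x. ?c x \<partial>M) + (\<integral>\<^sup>+x. ?d x \<partial>M)"
      by (rule nn_integral_add[OF mu mv])
    also have "\<dots> \<le> ennreal \<epsilon>' + ennreal \<epsilon>'" by (intro add_mono u' v')
    also have "\<dots> \<le> ennreal \<epsilon>"
      unfolding \<epsilon>'(2)[symmetric] using \<epsilon>'(1) \<eta>(5) by (simp add: algebra_simps flip: ennreal_plus)
    finally show "\<exists>w g. lip_loc U w \<and> ugrad U w g \<and> (\<integral>\<^sup>+x\<in>U. g x \<partial>M) \<le> tv u G1 + tv v G2 + ?T + ennreal \<epsilon> \<and>
        (L1 V w ?w) \<le> ennreal \<epsilon>"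
      using gl G by (intro exI[of _ ?w'] exI[of _ ?g]) auto
  qed
qed

text \<open>Gluing \<open>u\<close> with itself returns \<open>u\<close>, and the transition term
  vanishes. Compactness of the closure of \<open>W\<close> leaves room for a cutoff supported in
  \<open>A\<close> that is 1 on the part of \<open>W\<close> outside \<open>B\<close>.\<close>

lemma tv_subadditive_compactly_inside:
  assumes u: "u \<in> borel_measurable M" and op: "open A" "open B" and W: "compactly_inside W (A \<union> B)"
  shows "tv u W \<le> tv u A + tv u B"
proof -
  have W': "open W" "compact (closure W)" "closure W \<subseteq> A \<union> B" using W by (auto simp: compactly_inside_def)
  have "compact (closure W - B)" "closure W - B \<subseteq> A" using W' op by (auto intro: compact_diff)
  then obtain \<eta> L N0 N1 where c: "cutoff (closure W - B) A \<eta> L N0 N1"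
    using ex_cutoff op(1) by blast
  then have \<eta>: "L-lipschitz_on UNIV \<eta>" "\<And>x. 0 \<le> \<eta> x \<and> \<eta> x \<le> 1" and
    N: "open N0" "open N1" "closure W - B \<subseteq> N1" "\<And>x. x \<in> N1 \<Longrightarrow> \<eta> x = 1" "\<And>x. x \<in> N0 \<Longrightarrow> \<eta> x = 0"
      "compact (- N0)" "- N0 \<subseteq> A" "closure N1 \<subseteq> - N0"
    by (simp_all add: cutoff_def)
  have "compact (closure W - (N0 \<union> N1))" "closure W - (N0 \<union> N1) \<subseteq> A \<inter> B"
    using W' N by (auto intro: compact_diff)
  then obtain Ob where Ob: "compactly_inside Ob (A \<inter> B)" "closure W - (N0 \<union> N1) \<subseteq> Ob"
    using compactly_insideE[of _ "A \<inter> B"] op by blast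
  have "tv (\<lambda>x. \<eta> x * u x + (1 - \<eta> x) * u x) W \<le> tv u A + tv u B + (\<integral>\<^sup>+x\<in>Ob. ennreal \<bar>u x - u x\<bar> * ennreal L \<partial>M)"
  proof (rule tv_glue)
    show "lip_loc Ob \<eta>" using \<eta>(1) lipschitz_imp_lip_loc lip_loc_subset by blast
    show "ugrad Ob \<eta> (\<lambda>x. ennreal L)" by (rule ugrad_subset[OF ugrad_lipschitz[OF \<eta>(1)]]) simp
    show "0 \<le> L" using \<eta>(1) by (rule lipschitz_on_nonneg)
    show "W \<subseteq> N0 \<union> N1 \<union> Ob" using Ob(2) closure_subset[of W] by blast
    have "x \<notin> N1" if "x \<in> N0" for x using N(4,5)[of x] that by auto
    then show "W \<inter> N0 \<subseteq> B" using N(3) closure_subset[of W] by blast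
    show "W \<inter> N1 \<subseteq> A" using N(7,8) closure_subset[of N1] by blast
  qed (use u W' op \<eta> N Ob in \<open>auto simp: compactly_inside_def\<close>)
  moreover have "(\<lambda>x. \<eta> x * u x + (1 - \<eta> x) * u x) = u" by (simp add: fun_eq_iff algebra_simps)
  ultimately show ?thesis by simp
qed

section \<open>Gluing infinitely many pieces on shells\<close>

lemma lip_loc_local:
  assumes "open U" and loc: "\<And>x. x \<in> U \<Longrightarrow> \<exists>W. open W \<and> x \<in> W \<and> W \<subseteq> U \<and> lip_loc W w"
  shows "lip_loc U (w :: 'a \<Rightarrow> real)"
  unfolding lip_loc_iff[OF assms(1)]
proof
  fix x assume "x \<in> U"
  then obtain W where W: "open W" "x \<in> W" "W \<subseteq> U" "lip_loc W w" using loc by blast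
  obtain e L where "0 < e" "ball x e \<subseteq> W" "L-lipschitz_on (ball x e) w"
    using iffD1[OF lip_loc_iff[OF W(1)] W(4)] W(2) by blast
  then show "\<exists>e>0. ball x e \<subseteq> U \<and> (\<exists>L. L-lipschitz_on (ball x e) w)" using W(3) by blast
qed

text \<open>For an exhaustion, only consecutive shells meet: shells i and i+1 overlap exactly in Q
  (i+1) minus the closure of Q i, and this is where one approximation is blended into the
  next.\<close>

definition shell :: "(nat \<Rightarrow> 'a set) \<Rightarrow> nat \<Rightarrow> 'a set" where
  "shell Q i = Q (Suc i) - (case i of 0 \<Rightarrow> {} | Suc k \<Rightarrow> closure (Q k))"

lemma shell_0: "shell Q 0 = Q 1" and shell_Suc: "shell Q (Suc k) = Q (Suc (Suc k)) - closure (Q k)"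
  by (simp_all add: shell_def)

lemma shell_open: "exhaustion U Q \<Longrightarrow> open (shell Q i)"
  by (auto simp: shell_def exhaustion_def split: nat.split)

lemma shell_subset: "exhaustion U Q \<Longrightarrow> shell Q i \<subseteq> U"
  by (auto simp: shell_def exhaustion_def)

text \<open>Dividing by 1 plus the partial sums of \<open>L\<close> serves both
  \<open>\<delta> i\<close> and \<open>\<delta> (Suc i)\<close>: these sums dominate
  \<open>L i\<close> and increase. The factor 3 shares the geometric weight among the three
  terms.\<close>

lemma geometric_errors:
  fixes L :: "nat \<Rightarrow> real"
  assumes "\<And>i. 0 \<le> L i" "0 < \<epsilon>"
  obtains \<delta> :: "nat \<Rightarrow> real" where "\<And>i. 0 < \<delta> i" "\<And>i. \<delta> i + L i * (\<delta> i + \<delta> (Suc i)) \<le> \<epsilon> * (1/2) ^ Suc i"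
proof -
  define c where "c k = 1 + (\<Sum>j\<le>k. L j)" for k
  define \<delta> where "\<delta> k = \<epsilon> * (1/2) ^ Suc k / (3 * c k)" for k
  have c1: "1 \<le> c k" and cL: "L k \<le> c k" and cS: "c k \<le> c (Suc k)" for k
    using assms(1) member_le_sum[of k "{..k}" L] sum_nonneg[of "{..k}" L] by (auto simp: c_def)
  have b: "\<delta> k \<le> \<epsilon> * (1/2) ^ Suc k / 3" "L k * \<delta> k \<le> \<epsilon> * (1/2) ^ Suc k / 3"
    "L k * \<delta> (Suc k) \<le> \<epsilon> * (1/2) ^ Suc k / 3" "0 < \<delta> k" for k
  proof -
    define e where "e = \<epsilon> * (1/2) ^ Suc k"
    have e: "0 < e" using assms(2) by (simp add: e_def)
    have d: "\<delta> k = e / 3 / c k" by (simp add: \<delta>_def e_def)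
    have d': "\<delta> (Suc k) = e / 6 / c (Suc k)" by (simp add: \<delta>_def e_def)
    show "0 < \<delta> k" using e c1[of k] by (simp add: d)
    show "\<delta> k \<le> \<epsilon> * (1/2) ^ Suc k / 3"
      unfolding d e_def[symmetric] using e c1[of k] by (simp add: divide_le_eq)
    have "L k * \<delta> k = e / 3 * (L k / c k)" by (simp add: d)
    also have "\<dots> \<le> e / 3 * 1" using e c1[of k] cL[of k] by (intro mult_left_mono) (auto simp: divide_le_eq)
    finally show "L k * \<delta> k \<le> \<epsilon> * (1/2) ^ Suc k / 3" by (simp add: e_def)
    have "L k * \<delta> (Suc k) = e / 6 * (L k / c (Suc k))" by (simp add: d')
    also have "\<dots> \<le> e / 6 * 1" using e c1[of "Suc k"] cL[of k] cS[of k]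
      by (intro mult_left_mono) (auto simp: divide_le_eq)
    also have "\<dots> \<le> e / 3" using e by simp
    finally show "L k * \<delta> (Suc k) \<le> \<epsilon> * (1/2) ^ Suc k / 3" by (simp add: e_def)
  qed
  show thesis
  proof (rule that)
    show "\<delta> i + L i * (\<delta> i + \<delta> (Suc i)) \<le> \<epsilon> * (1/2) ^ Suc i" for i
      using b(1,2,3)[of i] by (simp only: distrib_left)
  qed (rule b(4))
qed

lemma two_terms_le_suminf: "f i + f (Suc i) \<le> suminf f" for f :: "nat \<Rightarrow> ennreal"
  using sum_le_suminf[OF summableI, of "{i, Suc i}" f] by simp

lemma suminf_geometric_ennreal: "0 \<le> \<epsilon> \<Longrightarrow> (\<Sum>i. ennreal (\<epsilon> * (1/2) ^ Suc i)) = ennreal \<epsilon>"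
  using sums_mult[OF power_half_series, of \<epsilon>] by (intro suminf_ennreal_eq) auto

text \<open>The De Giorgi-Letta step: gluing infinitely many approximations, one on each shell, gives inner
  regularity of the variation.\<close>

lemma tv_le_shells:
  assumes U: "open U" and u: "u \<in> borel_measurable M" and Q: "exhaustion U Q"
  shows "tv u U \<le> (\<Sum>i. tv u (shell Q i))"
proof (cases "(\<Sum>i. tv u (shell Q i)) = \<infinity>")
  case False
  define T where "T i = Q (Suc i) - closure (Q i)" for i
  have Qop: "open (Q i)" and Qc: "compact (closure (Q i))" and Qs: "closure (Q i) \<subseteq> Q (Suc i)" and QU: "Q i \<subseteq> U" for i
    using Q by (auto simp: exhaustion_def)
  have Qm: "Q i \<subseteq> Q (Suc i)" for i using Qs closure_subset by blast
  have Aop: "open (shell Q i)" for i by (rule shell_open[OF Q])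
  have Top: "open (T i)" for i by (simp add: T_def Qop open_Diff)
  have TA: "T i \<subseteq> shell Q i" for i
  proof (cases i)
    case (Suc k)
    have "closure (Q k) \<subseteq> closure (Q (Suc k))" by (rule closure_mono[OF Qm])
    then show ?thesis by (auto simp: Suc T_def shell_Suc)
  qed (auto simp: T_def shell_0)
  have TA': "T i \<subseteq> shell Q (Suc i)" for i
    using Qm[of "Suc i"] by (auto simp: T_def shell_Suc)
  have "\<forall>i. \<exists>\<eta> L N0 N1. cutoff (closure (Q i)) (Q (Suc i)) \<eta> L N0 N1"
    using ex_cutoff[OF Qc Qop Qs] by blast
  then obtain \<eta> L N0 N1 where "\<forall>i. cutoff (closure (Q i)) (Q (Suc i)) (\<eta> i) (L i) (N0 i) (N1 i)"
    unfolding choice_iff by (elim exE)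
  then have \<eta>: "\<And>i. (L i)-lipschitz_on UNIV (\<eta> i)" "\<And>i x. 0 \<le> \<eta> i x \<and> \<eta> i x \<le> 1" and
    N: "\<And>i. open (N0 i)" "\<And>i. open (N1 i)" "\<And>i. closure (Q i) \<subseteq> N1 i" "\<And>i x. x \<in> N1 i \<Longrightarrow> \<eta> i x = 1"
      "\<And>i x. x \<in> N0 i \<Longrightarrow> \<eta> i x = 0" "\<And>i. compact (- N0 i)" "\<And>i. - N0 i \<subseteq> Q (Suc i)" "\<And>i. closure (N1 i) \<subseteq> - N0 i"
    by (simp_all add: cutoff_def)
  have N01: "x \<notin> N1 i" if "x \<in> N0 i" for x i using N(4,5)[of x i] that by auto
  have Ln: "0 \<le> L i" for i using \<eta>(1) by (rule lipschitz_on_nonneg)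
  have "\<exists>Ob. compactly_inside Ob (T i) \<and> - N0 i - N1 i \<subseteq> Ob" for i
  proof -
    have "compact (- N0 i - N1 i)" using N by (intro compact_diff)
    moreover have "- N0 i - N1 i \<subseteq> T i" using N(3,7)[of i] by (auto simp: T_def)
    ultimately show ?thesis using compactly_insideE[OF _ Top] by metis
  qed
  then obtain Ob where Ob: "\<And>i. compactly_inside (Ob i) (T i)" "\<And>i. - N0 i - N1 i \<subseteq> Ob i"
    by metis
  have Obc: "open (Ob i)" "compact (closure (Ob i))" "closure (Ob i) \<subseteq> T i" "Ob i \<subseteq> T i" for i
    using Ob(1)[of i] compactly_inside_subset[OF Ob(1)[of i]] by (auto simp: compactly_inside_def)
  \<comment> \<open>Outside \<open>R i\<close> the piece \<open>us i\<close> will have weight 0 in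
    the glued function. \<open>B i\<close> adds the two transition regions in which
    \<open>us i\<close> is compared with its neighbours.\<close>
  define R where "R i = - N0 i - (case i of 0 \<Rightarrow> {} | Suc k \<Rightarrow> N1 k)" for i
  define B where "B i = R i \<union> closure (Ob i) \<union> (case i of 0 \<Rightarrow> {} | Suc k \<Rightarrow> closure (Ob k))" for i
  have "compact (B i)" "B i \<subseteq> shell Q i" for i
  proof -
    show "compact (B i)" unfolding B_def R_def
      using N Obc by (cases i) (auto intro!: compact_Un compact_diff)
    have "R i \<subseteq> shell Q i"
      using N(7)[of i] N(3) by (cases i) (auto simp: R_def shell_0 shell_Suc subset_iff)
    moreover have "(case i of 0 \<Rightarrow> {} | Suc k \<Rightarrow> closure (Ob k)) \<subseteq> shell Q i"
      using Obc(3) TA' by (cases i) (auto simp: subset_iff)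
    ultimately show "B i \<subseteq> shell Q i" using Obc(3)[of i] TA[of i] by (auto simp: B_def)
  qed
  then have "\<exists>S. compactly_inside S (shell Q i) \<and> B i \<subseteq> S" for i
    using compactly_insideE[OF _ Aop] by metis
  then obtain S where S: "\<And>i. compactly_inside (S i) (shell Q i)" "\<And>i. B i \<subseteq> S i" by metis
  have Sop: "open (S i)" "S i \<subseteq> shell Q i" for i
    using S(1)[of i] compactly_inside_subset[OF S(1)[of i]] by (auto simp: compactly_inside_def)
  have RS: "R i \<subseteq> S i" "Ob i \<subseteq> S i" "Ob i \<subseteq> S (Suc i)" for i
    using S(2)[of i] S(2)[of "Suc i"] closure_subset[of "Ob i"] by (auto simp: B_def)
  have fin: "tv u (shell Q i) < \<infinity>" for i
    using False by (metis ennreal_suminf_lessD infinity_ennreal_def top.not_eq_extremum)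
  show ?thesis
  proof (rule tv_leI[OF U])
    fix V and \<epsilon> :: real assume "compactly_inside V U" and \<epsilon>: "0 < \<epsilon>"
    then have VU: "V \<subseteq> U" using compactly_inside_subset by blast
    obtain \<delta> where \<delta>: "\<And>i. 0 < \<delta> i" "\<And>i. \<delta> i + L i * (\<delta> i + \<delta> (Suc i)) \<le> \<epsilon> * (1/2) ^ Suc i"
      using geometric_errors[of L \<epsilon>] Ln \<epsilon> by blast
    have "\<forall>i. \<exists>w g. lip_loc (shell Q i) w \<and> ugrad (shell Q i) w g \<and>
        (\<integral>\<^sup>+x\<in>shell Q i. g x \<partial>M) \<le> tv u (shell Q i) + ennreal (\<delta> i) \<and>
        (L1 (S i) w u) \<le> ennreal (\<delta> i)"
    proof
      fix i
      obtain w g where "lip_loc (shell Q i) w" "ugrad (shell Q i) w g"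
        "(\<integral>\<^sup>+x\<in>shell Q i. g x \<partial>M) \<le> tv u (shell Q i) + ennreal (\<delta> i)"
        "(L1 (S i) w u) \<le> ennreal (\<delta> i)"
        by (rule tv_approx_finite[OF fin S(1) \<delta>(1)])
      then show "\<exists>w g. lip_loc (shell Q i) w \<and> ugrad (shell Q i) w g \<and>
        (\<integral>\<^sup>+x\<in>shell Q i. g x \<partial>M) \<le> tv u (shell Q i) + ennreal (\<delta> i) \<and>
        (L1 (S i) w u) \<le> ennreal (\<delta> i)" by blast
    qed
    then obtain us g where "\<forall>i. lip_loc (shell Q i) (us i) \<and> ugrad (shell Q i) (us i) (g i) \<and>
        (\<integral>\<^sup>+x\<in>shell Q i. g i x \<partial>M) \<le> tv u (shell Q i) + ennreal (\<delta> i) \<and>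
        (L1 (S i) (us i) u) \<le> ennreal (\<delta> i)"
      unfolding choice_iff by (elim exE)
    then have us: "\<And>i. lip_loc (shell Q i) (us i)" "\<And>i. ugrad (shell Q i) (us i) (g i)"
        "\<And>i. (\<integral>\<^sup>+x\<in>shell Q i. g i x \<partial>M) \<le> tv u (shell Q i) + ennreal (\<delta> i)"
        "\<And>i. (L1 (S i) (us i) u) \<le> ennreal (\<delta> i)" by blast+
    \<comment> \<open>A point of index i lies in Q (i+1) and, for i > 0, outside Q i. There
      \<open>\<eta> i\<close> blends \<open>us i\<close>, used near Q i, into
      \<open>us (Suc i)\<close>, used near the outer boundary.\<close>
    define idx where "idx x = (LEAST i. x \<in> Q (Suc i))" for x
    define w where "w x = \<eta> (idx x) x * us (idx x) x + (1 - \<eta> (idx x) x) * us (Suc (idx x)) x" for x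
    \<comment> \<open>Summing all contributions gives one Borel function that dominates the upper
      gradient of every local formula for \<open>w\<close>.\<close>
    define G where "G x = (\<Sum>i. g i x * indicator (shell Q i) x + ennreal \<bar>us i x - us (Suc i) x\<bar> * ennreal (L i) * indicator (Ob i) x)" for x
    have idx: "x \<in> Q (Suc (idx x))" "i < idx x \<Longrightarrow> x \<notin> Q (Suc i)" if x: "x \<in> U" for x i
    proof -
      obtain j where "x \<in> Q j" using x Q by (auto simp: exhaustion_def)
      then have "x \<in> Q (Suc j)" using Qm by blast
      then show "x \<in> Q (Suc (idx x))" unfolding idx_def by (rule LeastI)
      show "x \<notin> Q (Suc i)" if "i < idx x" using not_less_Least that unfolding idx_def by blast
    qed
    have idx_eq: "idx x = i" if "x \<in> Q (Suc i)" "i = 0 \<or> x \<notin> Q i" for x i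
      unfolding idx_def
    proof (rule Least_equality)
      fix j assume j: "x \<in> Q (Suc j)"
      show "i \<le> j"
      proof (rule ccontr)
        assume "\<not> i \<le> j"
        then have "Q (Suc j) \<subseteq> Q i" by (intro exhaustion_mono[OF Q]) auto
        then show False using j that \<open>\<not> i \<le> j\<close> by auto
      qed
    qed (rule that(1))
    have gm: "(\<lambda>x. g i x * indicator (shell Q i) x) \<in> borel_measurable borel" for i
      by (rule ugrad_indicator_measurable[OF us(2) Aop])
    have dm: "(\<lambda>x. ennreal \<bar>us i x - us (Suc i) x\<bar> * ennreal (L i) * indicator (Ob i) x) \<in> borel_measurable borel" for i
    proof -
      have "continuous_on (Ob i) (us i)" "continuous_on (Ob i) (us (Suc i))"
        using lip_loc_continuous[OF Aop us(1)] Obc(4)[of i] TA[of i] TA'[of i] continuous_on_subset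
        by (metis order_trans)+
      then have "(\<lambda>x. ennreal \<bar>us i x - us (Suc i) x\<bar> * ennreal (L i)) \<in> borel_measurable (restrict_space borel (Ob i))"
        by (intro borel_measurable_times_ennreal borel_measurable_continuous_on_restrict continuous_on_ennreal continuous_intros) auto
      then show ?thesis
        using Obc(1) by (subst (asm) borel_measurable_restrict_space_iff_ennreal) (auto simp: mult.commute)
    qed
    have Gm: "G \<in> borel_measurable borel"
      unfolding G_def using gm dm by (intro borel_measurable_suminf_order borel_measurable_add)
    have Gge: "g i x * indicator (shell Q i) x + ennreal \<bar>us i x - us (Suc i) x\<bar> * ennreal (L i) * indicator (Ob i) x \<le> G x" for i x
      unfolding G_def using sum_le_suminf[OF summableI, of "{i}"] by simp
    have Gge2: "g i x * indicator (shell Q i) x + g (Suc i) x * indicator (shell Q (Suc i)) x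
        + ennreal \<bar>us i x - us (Suc i) x\<bar> * ennreal (L i) * indicator (Ob i) x \<le> G x" for i x
    proof -
      let ?t = "\<lambda>i. g i x * indicator (shell Q i) x + ennreal \<bar>us i x - us (Suc i) x\<bar> * ennreal (L i) * indicator (Ob i) x"
      have "g i x * indicator (shell Q i) x + g (Suc i) x * indicator (shell Q (Suc i)) x
        + ennreal \<bar>us i x - us (Suc i) x\<bar> * ennreal (L i) * indicator (Ob i) x \<le> ?t i + ?t (Suc i)"
        by (simp add: ac_simps add_left_mono add_increasing2)
      also have "\<dots> = sum ?t {i, Suc i}" by simp
      also have "\<dots> \<le> G x" unfolding G_def by (intro sum_le_suminf summableI) auto
      finally show ?thesis .
    qed
    have loc: "\<exists>W. open W \<and> x \<in> W \<and> W \<subseteq> U \<and> lip_loc W w \<and> ugrad W w G" if x: "x \<in> U" for x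
    proof -
      define i where "i = idx x"
      have xi: "x \<in> Q (Suc i)" using idx(1)[OF x] by (simp add: i_def)
      have main: "\<exists>W. open W \<and> x \<in> W \<and> W \<subseteq> U \<and> lip_loc W w \<and> ugrad W w G"
        if W: "open W" "x \<in> W" "W \<subseteq> shell Q i" "\<And>y. y \<in> W \<Longrightarrow> idx y = i" for W
      proof -
        let ?w' = "\<lambda>x. \<eta> i x * us i x + (1 - \<eta> i x) * us (Suc i) x"
        let ?g = "\<lambda>x. g i x * indicator (shell Q i) x + g (Suc i) x * indicator (shell Q (Suc i)) x
          + ennreal \<bar>us i x - us (Suc i) x\<bar> * ennreal (L i) * indicator (Ob i) x"
        have WQ: "W \<subseteq> Q (Suc i)" using W(3) by (auto simp: shell_def)
        have l: "lip_loc (Ob i) (\<eta> i)"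
          using \<eta>(1) lipschitz_imp_lip_loc lip_loc_subset by blast
        have h: "ugrad (Ob i) (\<eta> i) (\<lambda>x. ennreal (L i))"
          by (rule ugrad_subset[OF ugrad_lipschitz[OF \<eta>(1)]]) simp
        have sub: "W \<subseteq> N0 i \<union> N1 i \<union> Ob i" "W \<inter> N0 i \<subseteq> shell Q (Suc i)" "W \<inter> N1 i \<subseteq> shell Q i"
          "Ob i \<subseteq> shell Q i \<inter> shell Q (Suc i)"
        proof -
          show "W \<subseteq> N0 i \<union> N1 i \<union> Ob i" using Ob(2)[of i] by blast
          show "W \<inter> N0 i \<subseteq> shell Q (Suc i)"
            using WQ Qm[of "Suc i"] N(3)[of i] N01 unfolding shell_Suc by blast
          show "W \<inter> N1 i \<subseteq> shell Q i" using W(3) by blast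
          show "Ob i \<subseteq> shell Q i \<inter> shell Q (Suc i)" using Obc(4) TA TA' by blast
        qed
        have gl: "lip_loc W ?w'" "ugrad W ?w' ?g"
          using glue[OF W(1) Aop Aop N(1) N(2) Obc(1) us(1) us(2) us(1) us(2) l h \<eta>(2) order_refl Ln N(5) N(4) sub] by auto
        have eq: "w y = ?w' y" if "y \<in> W" for y using W(4)[OF that] by (simp add: w_def)
        have "lip_loc W w"
          using gl(1) compactly_inside_subset eq unfolding lip_loc_def
          by (metis (no_types, lifting) lipschitz_on_transform subsetD)
        moreover have "ugrad W w G"
          using Gge2 eq by (intro ugrad_mono[OF gl(2) measurable_restrict_space1[OF Gm]]) auto
        moreover have "W \<subseteq> U" using WQ QU by blast
        ultimately show ?thesis using W(1,2) by blast
      qed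
      show ?thesis
      proof (cases "i = 0 \<or> x \<notin> closure (Q i)")
        case True
        define W where "W = (if i = 0 then Q 1 else T i)"
        show ?thesis
        proof (rule main)
          show "open W" by (simp add: W_def Qop Top)
          show "x \<in> W" using xi True by (auto simp: W_def T_def)
          show "W \<subseteq> shell Q i" using TA[of i] by (auto simp: W_def shell_0)
          show "idx y = i" if "y \<in> W" for y
            using that closure_subset[of "Q i"] by (intro idx_eq) (auto simp: W_def T_def split: if_splits)
        qed
      next
        case False
        then obtain k where k: "i = Suc k" using not0_implies_Suc by blast
        have xk: "x \<notin> Q i" using idx(2)[OF x, of k] by (simp add: k flip: i_def)
        \<comment> \<open>Here x lies where the index jumps from k to i. Near x the cutoffs are
          constant, \<open>\<eta> k\<close> = 0 and \<open>\<eta> i\<close> = 1, so the formulas on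
          both sides reduce to \<open>us i\<close>.\<close>
        define W where "W = N1 i \<inter> N0 k \<inter> shell Q i"
        have xW: "x \<in> W"
          using False N(3)[of i] N(7)[of k] xk xi Qs[of k] by (auto simp: W_def k shell_Suc)
        have eq: "us i y = w y" if y: "y \<in> W" for y
        proof (cases "y \<in> Q i")
          case True
          have "y \<notin> Q k" using y closure_subset[of "Q k"] by (auto simp: W_def k shell_Suc)
          then have "idx y = k" using True by (intro idx_eq) (auto simp: k)
          then show ?thesis using y N(5)[of y k] by (simp add: w_def k W_def)
        next
          case False
          then have "idx y = i" using y by (intro idx_eq) (auto simp: W_def shell_def)
          then show ?thesis using y N(4)[of y i] by (simp add: w_def W_def)
        qed
        have "lip_loc W (us i)" using us(1)[of i] by (rule lip_loc_subset) (auto simp: W_def)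
        then have "lip_loc W w"
          using compactly_inside_subset eq unfolding lip_loc_def
          by (metis (no_types, lifting) lipschitz_on_transform subsetD)
        moreover have "ugrad W w G"
        proof (rule ugrad_mono[OF ugrad_subset[OF us(2)[of i]] measurable_restrict_space1[OF Gm]])
          show "W \<subseteq> shell Q i" by (auto simp: W_def)
          fix y assume "y \<in> W"
          then show "us i y = w y" "g i y \<le> G y"
            using eq order_trans[OF _ Gge[of i y]] by (auto simp: W_def add_increasing2)
        qed
        moreover have "open W" by (simp add: W_def N Aop open_Int)
        moreover have "W \<subseteq> U" using shell_subset[OF Q, of i] by (auto simp: W_def)
        ultimately show ?thesis using xW by blast
      qed
    qed
    have "lip_loc U w" using loc by (intro lip_loc_local[OF U]) blast
    moreover have "ugrad U w G"
    proof (rule ugrad_local[OF measurable_restrict_space1[OF Gm]])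
      fix x assume "x \<in> U"
      then obtain W where "open W" "x \<in> W" "W \<subseteq> U" "ugrad W w G" using loc by blast
      then show "\<exists>V. open V \<and> x \<in> V \<and> ugrad (V \<inter> U) w G" by (auto simp: Int_absorb2)
    qed
    moreover have "(\<integral>\<^sup>+x\<in>U. G x \<partial>M) \<le> (\<Sum>i. tv u (shell Q i)) + ennreal \<epsilon>"
    proof -
      have sm: "(\<lambda>x. ennreal \<bar>us i x - u x\<bar> * indicator (S i) x) \<in> borel_measurable M" for i
        by (rule lip_loc_diff_measurable[OF Aop us(1) Sop(2,1) u])
      have jump: "(\<integral>\<^sup>+x. ennreal \<bar>us i x - us (Suc i) x\<bar> * ennreal (L i) * indicator (Ob i) x \<partial>M)
          \<le> ennreal (L i * (\<delta> i + \<delta> (Suc i)))" for i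
      proof -
        have "(\<integral>\<^sup>+x. ennreal \<bar>us i x - us (Suc i) x\<bar> * ennreal (L i) * indicator (Ob i) x \<partial>M)
          \<le> (\<integral>\<^sup>+x. ennreal (L i) * (ennreal \<bar>us i x - u x\<bar> * indicator (S i) x + ennreal \<bar>us (Suc i) x - u x\<bar> * indicator (S (Suc i)) x) \<partial>M)"
        proof (rule nn_integral_mono)
          fix x
          have "ennreal \<bar>us i x - us (Suc i) x\<bar> \<le> ennreal \<bar>us i x - u x\<bar> + ennreal \<bar>us (Suc i) x - u x\<bar>"
            by (simp flip: ennreal_plus)
          from mult_left_mono[OF this, of "ennreal (L i)"]
          show "ennreal \<bar>us i x - us (Suc i) x\<bar> * ennreal (L i) * indicator (Ob i) x
            \<le> ennreal (L i) * (ennreal \<bar>us i x - u x\<bar> * indicator (S i) x + ennreal \<bar>us (Suc i) x - u x\<bar> * indicator (S (Suc i)) x)"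
            using RS(2,3)[of i] by (cases "x \<in> Ob i") (auto simp: mult.commute subset_iff)
        qed
        also have "\<dots> = ennreal (L i) * ((L1 (S i) (us i) u) + (L1 (S (Suc i)) (us (Suc i)) u))"
          using sm by (subst nn_integral_cmult) (simp_all add: nn_integral_add)
        also have "\<dots> \<le> ennreal (L i) * (ennreal (\<delta> i) + ennreal (\<delta> (Suc i)))"
          by (intro mult_left_mono add_mono us) auto
        also have "\<dots> = ennreal (L i * (\<delta> i + \<delta> (Suc i)))"
          using \<delta>(1)[of i] \<delta>(1)[of "Suc i"] Ln by (simp add: ennreal_mult ennreal_plus)
        finally show ?thesis .
      qed
      have "(\<integral>\<^sup>+x\<in>U. G x \<partial>M) \<le> (\<integral>\<^sup>+x. G x \<partial>M)"
        by (intro nn_integral_mono) (auto simp: indicator_def)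
      also have "\<dots> = (\<Sum>i. (\<integral>\<^sup>+x\<in>shell Q i. g i x \<partial>M) + (\<integral>\<^sup>+x. ennreal \<bar>us i x - us (Suc i) x\<bar> * ennreal (L i) * indicator (Ob i) x \<partial>M))"
        unfolding G_def using gm dm by (simp add: nn_integral_suminf nn_integral_add measurable_M_borel borel_measurable_add)
      also have "\<dots> \<le> (\<Sum>i. tv u (shell Q i) + ennreal (\<epsilon> * (1/2) ^ Suc i))"
      proof (intro suminf_le summableI)
        fix i
        have "(\<integral>\<^sup>+x\<in>shell Q i. g i x \<partial>M) + (\<integral>\<^sup>+x. ennreal \<bar>us i x - us (Suc i) x\<bar> * ennreal (L i) * indicator (Ob i) x \<partial>M)
            \<le> (tv u (shell Q i) + ennreal (\<delta> i)) + ennreal (L i * (\<delta> i + \<delta> (Suc i)))"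
          by (intro add_mono us jump)
        also have "\<dots> = tv u (shell Q i) + ennreal (\<delta> i + L i * (\<delta> i + \<delta> (Suc i)))"
          using \<delta>(1)[of i] \<delta>(1)[of "Suc i"] Ln[of i] by (simp add: ennreal_plus add.assoc)
        also have "\<dots> \<le> tv u (shell Q i) + ennreal (\<epsilon> * (1/2) ^ Suc i)"
          by (intro add_left_mono ennreal_leI \<delta>)
        finally show "(\<integral>\<^sup>+x\<in>shell Q i. g i x \<partial>M) + (\<integral>\<^sup>+x. ennreal \<bar>us i x - us (Suc i) x\<bar> * ennreal (L i) * indicator (Ob i) x \<partial>M)
            \<le> tv u (shell Q i) + ennreal (\<epsilon> * (1/2) ^ Suc i)" .
      qed
      also have "\<dots> = (\<Sum>i. tv u (shell Q i)) + (\<Sum>i. ennreal (\<epsilon> * (1/2) ^ Suc i))"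
        by (rule suminf_add[OF summableI summableI, symmetric])
      also have "(\<Sum>i. ennreal (\<epsilon> * (1/2) ^ Suc i)) = ennreal \<epsilon>"
        using \<epsilon> by (intro suminf_geometric_ennreal) simp
      finally show ?thesis .
    qed
    moreover have "(L1 V w u) \<le> ennreal \<epsilon>"
    proof -
      have sm: "(\<lambda>x. ennreal \<bar>us i x - u x\<bar> * indicator (S i) x) \<in> borel_measurable M" for i
        by (rule lip_loc_diff_measurable[OF Aop us(1) Sop(2,1) u])
      have "(L1 V w u) \<le> (\<integral>\<^sup>+x. (\<Sum>i. ennreal \<bar>us i x - u x\<bar> * indicator (S i) x) \<partial>M)"
      proof (rule nn_integral_mono)
        fix x
        let ?t = "\<lambda>i. ennreal \<bar>us i x - u x\<bar> * indicator (S i) x"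
        show "ennreal \<bar>w x - u x\<bar> * indicator V x \<le> (\<Sum>i. ?t i)"
        proof (cases "x \<in> V")
          case True
          then have x: "x \<in> U" using VU by blast
          define i where "i = idx x"
          have xi: "x \<in> Q (Suc i)" using idx(1)[OF x] by (simp add: i_def)
          have eq: "w x - u x = \<eta> i x * (us i x - u x) + (1 - \<eta> i x) * (us (Suc i) x - u x)"
            by (simp add: w_def i_def algebra_simps)
          have "\<bar>w x - u x\<bar> \<le> \<eta> i x * \<bar>us i x - u x\<bar> + (1 - \<eta> i x) * \<bar>us (Suc i) x - u x\<bar>"
            unfolding eq using \<eta>(2)[of i x] by (intro order_trans[OF abs_triangle_ineq]) (simp add: abs_mult)
          from ennreal_leI[OF this]
          have "ennreal \<bar>w x - u x\<bar> \<le> ennreal (\<eta> i x * \<bar>us i x - u x\<bar>) + ennreal ((1 - \<eta> i x) * \<bar>us (Suc i) x - u x\<bar>)"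
            using \<eta>(2)[of i x] by (simp add: ennreal_plus)
          also have "\<dots> \<le> ?t i + ?t (Suc i)"
          proof (rule add_mono)
            show "ennreal (\<eta> i x * \<bar>us i x - u x\<bar>) \<le> ?t i"
            proof (cases "x \<in> N0 i")
              case False
              have "x \<notin> N1 k" if k: "i = Suc k" for k
                using idx(2)[OF x, of k] N(7)[of k] N01[of x k] by (auto simp: k simp flip: i_def)
              then have "x \<in> R i" using False by (auto simp: R_def split: nat.split)
              then have "x \<in> S i" using RS(1) by blast
              then show ?thesis using \<eta>(2)[of i x] by (auto intro!: ennreal_leI mult_left_le_one_le)
            qed (simp add: N(5))
            show "ennreal ((1 - \<eta> i x) * \<bar>us (Suc i) x - u x\<bar>) \<le> ?t (Suc i)"
            proof (cases "x \<in> N1 i")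
              case False
              \<comment> \<open>The index moves up by one: x lies in Q (i+1), where the next cutoff
                is already 1, so x is outside \<open>N0 (Suc i)\<close>.\<close>
              have "x \<in> N1 (Suc i)" using xi N(3)[of "Suc i"] closure_subset[of "Q (Suc i)"] by blast
              then have "x \<in> R (Suc i)" using False N01[of x "Suc i"] by (auto simp: R_def)
              then have "x \<in> S (Suc i)" using RS(1) by blast
              then show ?thesis using \<eta>(2)[of i x] by (auto intro!: ennreal_leI mult_left_le_one_le)
            qed (simp add: N(4))
          qed
          also have "\<dots> \<le> (\<Sum>i. ?t i)" by (rule two_terms_le_suminf)
          finally show ?thesis using True by simp
        qed simp
      qed
      also have "\<dots> = (\<Sum>i. L1 (S i) (us i) u)"
        by (rule nn_integral_suminf[OF sm])
      also have "\<dots> \<le> (\<Sum>i. ennreal (\<epsilon> * (1/2) ^ Suc i))"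
      proof (intro suminf_le summableI)
        fix i
        have "0 \<le> L i * (\<delta> i + \<delta> (Suc i))" using Ln[of i] \<delta>(1)[of i] \<delta>(1)[of "Suc i"] by simp
        then have "\<delta> i \<le> \<epsilon> * (1/2) ^ Suc i" using \<delta>(2)[of i] by linarith
        then show "(L1 (S i) (us i) u) \<le> ennreal (\<epsilon> * (1/2) ^ Suc i)"
          using us(4)[of i] by (meson ennreal_leI order_trans)
      qed
      also have "\<dots> = ennreal \<epsilon>" using \<epsilon> by (intro suminf_geometric_ennreal) simp
      finally show ?thesis .
    qed
    ultimately show "\<exists>w g. lip_loc U w \<and> ugrad U w g \<and> (\<integral>\<^sup>+x\<in>U. g x \<partial>M) \<le> (\<Sum>i. tv u (shell Q i)) + ennreal \<epsilon> \<and>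
        (L1 V w u) \<le> ennreal \<epsilon>"
      by blast
  qed
qed simp

end

text \<open>Caratheodory measures are complete: a null set splits every set additively, by
  monotonicity in one direction and subadditivity in the other.\<close>

lemma outer_measure_null_sets:
  assumes "outer_measure_space UNIV f" "f A = 0"
  shows "A \<in> lambda_system UNIV UNIV f"
proof -
  have pos: "positive UNIV f" and inc: "\<And>A B. A \<subseteq> B \<Longrightarrow> f A \<le> f B" and cs: "countably_subadditive UNIV f"
    using assms(1) by (auto simp: outer_measure_space_def increasing_def)
  have sub: "f (x \<union> y) \<le> f x + f y" if "x \<inter> y = {}" for x y
  proof -
    have "ring_of_sets UNIV (UNIV :: 'a set set)"
      using algebra.axioms(1)[OF sigma_algebra.axioms(1)[OF sigma_algebra_Pow[of UNIV]]] by simp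
    from ring_of_sets.countably_subadditive_subadditive[OF this pos cs] show ?thesis
      using that by (auto simp: subadditive_def)
  qed
  show ?thesis
    unfolding lambda_system_def
  proof (safe intro!: antisym)
    fix x :: "'a set"
    have "f (A \<inter> x) \<le> 0" using inc[of "A \<inter> x" A] assms(2) by simp
    then show "f (A \<inter> x) + f ((UNIV - A) \<inter> x) \<le> f x" using inc[of "(UNIV - A) \<inter> x" x] by simp
    have "f x \<le> f ((A \<inter> x) \<union> ((UNIV - A) \<inter> x))" by (intro inc) auto
    also have "\<dots> \<le> f (A \<inter> x) + f ((UNIV - A) \<inter> x)" by (rule sub) auto
    finally show "f x \<le> f (A \<inter> x) + f ((UNIV - A) \<inter> x)" .
  qed auto
qed

context doubling_space
begin

section \<open>Inner regularity and countable subadditivity of the variation\<close>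

lemma exhaustion_shift: "exhaustion U Q \<Longrightarrow> exhaustion U (\<lambda>k. Q (n + k))"
proof -
  assume Q: "exhaustion U Q"
  have "Q k \<subseteq> Q (n + k)" for k by (rule exhaustion_mono[OF Q]) simp
  then have "(\<Union>k. Q (n + k)) = (\<Union>k. Q k)" by blast
  then show "exhaustion U (\<lambda>k. Q (n + k))" using Q by (simp add: exhaustion_def)
qed

text \<open>Annuli whose indices have the same parity are disjoint, so superadditivity applies to
  them; the offset \<open>c\<close> selects the parity.\<close>

lemma tv_shells_le:
  assumes Q: "exhaustion U Q"
  shows "(\<Sum>k<N. tv u (Q (Suc (Suc (2 * k + c))) - closure (Q (2 * k + c)))) \<le> tv u (Q (2 * N + c))"
proof (induction N)
  case (Suc N)
  have op: "open (Q i)" for i using Q by (rule exhaustion_open)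
  let ?n = "2 * N + c"
  have "(\<Sum>k<Suc N. tv u (Q (Suc (Suc (2 * k + c))) - closure (Q (2 * k + c))))
      \<le> tv u (Q ?n) + tv u (Q (Suc (Suc ?n)) - closure (Q ?n))"
    using Suc by (simp add: add_right_mono)
  also have "\<dots> \<le> tv u (Q ?n \<union> (Q (Suc (Suc ?n)) - closure (Q ?n)))"
    using closure_subset[of "Q ?n"] by (intro tv_superadditive) (auto intro: op)
  also have "\<dots> \<le> tv u (Q (Suc (Suc ?n)))"
    using exhaustion_mono[OF Q, of ?n "Suc (Suc ?n)"] by (intro tv_subset) (auto intro: op)
  finally show ?case by (simp add: algebra_simps)
qed simp

text \<open>The two parities bound the sum over all annuli by twice the supremum s, so its tail is
  small. For the exhaustion started at index n, the first shell is Q (n+1), with variation at most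
  s, and the remaining shells form such a tail.\<close>

lemma tv_inner_regular:
  assumes U: "open U" and u: "u \<in> borel_measurable M" and Q: "exhaustion U Q"
  shows "tv u U \<le> (SUP j. tv u (Q j))"
proof (cases "(SUP j. tv u (Q j)) = \<infinity>")
  case False
  define s where "s = (SUP j. tv u (Q j))"
  define a where "a k = tv u (Q (Suc (Suc k)) - closure (Q k))" for k
  have les: "tv u (Q j) \<le> s" for j unfolding s_def by (rule SUP_upper) simp
  have "(\<Sum>k<n. a k) \<le> s + s" for n
  proof -
    have "(\<Sum>k<n. a k) \<le> (\<Sum>k<2 * n. a k)" by (intro sum_mono2) auto
    also have "(\<Sum>k<2 * n. a k) = (\<Sum>k<n. a (2 * k + 0)) + (\<Sum>k<n. a (2 * k + 1))"
      by (induction n) (simp_all add: ac_simps)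
    also have "\<dots> \<le> s + s"
      unfolding a_def by (intro add_mono order_trans[OF tv_shells_le[OF Q] les])
    finally show ?thesis .
  qed
  then have "(\<Sum>k. a k) \<le> s + s" by (intro suminf_le_const summableI)
  then have fin: "(\<Sum>k. a k) \<noteq> top" using False by (auto simp: s_def[symmetric] top_unique)
  then have "a k < top" for k using ennreal_suminf_lessD[of a top] by (simp add: top.not_eq_extremum)
  define b where "b k = enn2real (a k)" for k
  have b: "a k = ennreal (b k)" "0 \<le> b k" for k
    using \<open>a k < top\<close> by (simp_all add: b_def)
  have bs: "summable b" using fin b by (intro summable_suminf_not_top) auto
  have "tv u U \<le> s"
  proof (rule ennreal_le_epsilon)
    fix e :: real assume e: "0 < e"
    obtain n where n: "norm (\<Sum>i. b (i + n)) < e" using suminf_exist_split[OF e bs] by blast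
    have bs': "summable (\<lambda>i. b (i + n))" using bs by simp
    have "tv u U \<le> (\<Sum>i. tv u (shell (\<lambda>k. Q (n + k)) i))"
      by (rule tv_le_shells[OF U u exhaustion_shift[OF Q]])
    also have "\<dots> = (\<Sum>i. tv u (shell (\<lambda>k. Q (n + k)) (i + 1))) + (\<Sum>i<1. tv u (shell (\<lambda>k. Q (n + k)) i))"
      by (rule suminf_offset[OF summableI])
    also have "\<dots> = (\<Sum>i. a (i + n)) + tv u (Q (n + 1))"
      by (simp add: shell_0 shell_Suc a_def add.commute)
    also have "(\<Sum>i. a (i + n)) = ennreal (\<Sum>i. b (i + n))"
      unfolding b(1) by (rule suminf_ennreal_eq[OF b(2) summable_sums[OF bs']])
    also have "\<dots> + tv u (Q (n + 1)) \<le> ennreal e + s"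
      using n by (intro add_mono les ennreal_leI) auto
    finally show "tv u U \<le> s + ennreal e" by (simp add: add.commute)
  qed
  then show ?thesis by (simp add: s_def)
next
  case True
  show ?thesis unfolding True by simp
qed

lemma tv_subadditive:
  assumes u: "u \<in> borel_measurable M" and "open A" "open B"
  shows "tv u (A \<union> B) \<le> tv u A + tv u B"
proof -
  obtain Q where Q: "exhaustion (A \<union> B) Q" using ex_exhaustion[of "A \<union> B"] assms by auto
  have "tv u (A \<union> B) \<le> (SUP j. tv u (Q j))"
    using assms by (intro tv_inner_regular[OF _ u Q]) auto
  also have "\<dots> \<le> tv u A + tv u B"
    using assms exhaustion_compactly_inside[OF Q] by (intro SUP_least tv_subadditive_compactly_inside) auto
  finally show ?thesis .
qed

text \<open>By inner regularity only compactly contained sets matter, and those are covered by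
  finitely many of the \<open>V i\<close>.\<close>

lemma tv_countably_subadditive:
  assumes u: "u \<in> borel_measurable M" and op: "\<And>i::nat. open (V i)"
  shows "tv u (\<Union>i. V i) \<le> (\<Sum>i. tv u (V i))"
proof -
  have fin: "tv u (\<Union>i<n. V i) \<le> (\<Sum>i<n. tv u (V i))" for n
  proof (induction n)
    case (Suc n)
    have "(\<Union>i<Suc n. V i) = (\<Union>i<n. V i) \<union> V n" by (auto simp: less_Suc_eq)
    then have "tv u (\<Union>i<Suc n. V i) \<le> tv u (\<Union>i<n. V i) + tv u (V n)"
      using tv_subadditive[OF u, of "\<Union>i<n. V i" "V n"] op by (simp add: open_UN)
    also have "\<dots> \<le> (\<Sum>i<n. tv u (V i)) + tv u (V n)" by (intro add_right_mono Suc)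
    finally show ?case by simp
  qed (simp add: tv_empty)
  obtain Q where Q: "exhaustion (\<Union>i. V i) Q" using ex_exhaustion[of "\<Union>i. V i"] op by auto
  have "tv u (Q j) \<le> (\<Sum>i. tv u (V i))" for j
  proof -
    have "compact (closure (Q j))" "closure (Q j) \<subseteq> (\<Union>i. V i)"
      using exhaustion_compactly_inside[OF Q, of j] by (auto simp: compactly_inside_def)
    then obtain I where I: "finite I" "closure (Q j) \<subseteq> (\<Union>i\<in>I. V i)"
      using op by (metis compactE_image UNIV_I)
    obtain n where "I \<subseteq> {..<n}" using finite_nat_iff_bounded I(1) by blast
    then have "Q j \<subseteq> (\<Union>i<n. V i)" using I(2) closure_subset[of "Q j"] by blast
    then have "tv u (Q j) \<le> tv u (\<Union>i<n. V i)"
      using exhaustion_open[OF Q] op by (intro tv_subset) auto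
    also have "\<dots> \<le> (\<Sum>i<n. tv u (V i))" by (rule fin)
    also have "\<dots> \<le> (\<Sum>i. tv u (V i))" by (intro sum_le_suminf summableI) auto
    finally show ?thesis .
  qed
  then have "(SUP j. tv u (Q j)) \<le> (\<Sum>i. tv u (V i))" by (intro SUP_least)
  then show ?thesis using tv_inner_regular[OF _ u Q] op by (meson open_UN order_trans)
qed

section \<open>The total variation measure\<close>

abbreviation TV :: "('a \<Rightarrow> real) \<Rightarrow> 'a set \<Rightarrow> ennreal" where "TV \<equiv> total_variation m"

lemma TV_open: "open U \<Longrightarrow> TV u U = tv u U"
  by (simp add: total_variation_def)

text \<open>The definition treats open sets separately; by monotonicity the infimum gives the same
  value there, so that one formula covers all sets.\<close>

lemma TV_eq_INF: "TV u A = (INF U\<in>{U. open U \<and> A \<subseteq> U}. tv u U)"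
proof (cases "open A")
  case True
  have "(INF U\<in>{U. open U \<and> A \<subseteq> U}. tv u U) = tv u A"
    using True by (intro antisym INF_lower2[of A] INF_greatest tv_subset) auto
  then show ?thesis using True by (simp add: TV_open)
qed (simp add: total_variation_def)

lemma TV_le: "open U \<Longrightarrow> A \<subseteq> U \<Longrightarrow> TV u A \<le> tv u U"
  unfolding TV_eq_INF by (rule INF_lower) auto

lemma TV_mono: "A \<subseteq> B \<Longrightarrow> TV u A \<le> TV u B"
  unfolding TV_eq_INF by (rule INF_superset_mono) auto

lemma TV_approx:
  assumes "TV u A < \<infinity>" "0 < \<epsilon>"
  obtains U where "open U" "A \<subseteq> U" "tv u U \<le> TV u A + ennreal \<epsilon>"
proof -
  have "TV u A < TV u A + ennreal \<epsilon>"
    using ennreal_add_left_cancel_less[of "TV u A" 0 "ennreal \<epsilon>"] assms by simp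
  then obtain U where "open U" "A \<subseteq> U" "tv u U < TV u A + ennreal \<epsilon>"
    unfolding TV_eq_INF[of u A] INF_less_iff by auto
  then show thesis using that less_imp_le by blast
qed

lemma TV_outer_measure:
  assumes u: "u \<in> borel_measurable M"
  shows "outer_measure_space UNIV (TV u)"
  unfolding outer_measure_space_def
proof (intro conjI)
  show "positive UNIV (TV u)" by (simp add: positive_def TV_open tv_empty)
  show "increasing UNIV (TV u)" by (simp add: increasing_def TV_mono)
  show "countably_subadditive UNIV (TV u)"
    unfolding countably_subadditive_def
  proof (intro allI impI)
    fix A :: "nat \<Rightarrow> 'a set"
    show "TV u (\<Union>i. A i) \<le> (\<Sum>i. TV u (A i))"
    proof (rule ennreal_le_epsilon)
      fix e :: real assume e: "0 < e" and "(\<Sum>i. TV u (A i)) < top"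
      then have fin: "TV u (A i) < \<infinity>" for i by (metis ennreal_suminf_lessD infinity_ennreal_def)
      have "\<exists>U. open U \<and> A i \<subseteq> U \<and> tv u U \<le> TV u (A i) + ennreal (e * (1/2) ^ Suc i)" for i
      proof -
        have "0 < e * (1/2) ^ Suc i" using e by simp
        from TV_approx[OF fin[of i] this] show ?thesis by blast
      qed
      then obtain U where U: "\<And>i. open (U i)" "\<And>i. A i \<subseteq> U i"
        "\<And>i. tv u (U i) \<le> TV u (A i) + ennreal (e * (1/2) ^ Suc i)" by metis
      have "TV u (\<Union>i. A i) \<le> tv u (\<Union>i. U i)" using U by (intro TV_le) auto
      also have "\<dots> \<le> (\<Sum>i. tv u (U i))" by (rule tv_countably_subadditive[OF u U(1)])
      also have "\<dots> \<le> (\<Sum>i. TV u (A i) + ennreal (e * (1/2) ^ Suc i))"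
        by (intro suminf_le U summableI)
      also have "\<dots> = (\<Sum>i. TV u (A i)) + (\<Sum>i. ennreal (e * (1/2) ^ Suc i))"
        by (rule suminf_add[OF summableI summableI, symmetric])
      also have "(\<Sum>i. ennreal (e * (1/2) ^ Suc i)) = ennreal e"
        using e by (intro suminf_geometric_ennreal) simp
      finally show "TV u (\<Union>i. A i) \<le> (\<Sum>i. TV u (A i)) + ennreal e" .
    qed
  qed
qed

lemma TV_Un_le:
  assumes u: "u \<in> borel_measurable M"
  shows "TV u (A \<union> B) \<le> TV u A + TV u B"
proof (rule ennreal_le_epsilon)
  fix e :: real assume e: "0 < e" and fin: "TV u A + TV u B < top"
  obtain U where U: "open U" "A \<subseteq> U" "tv u U \<le> TV u A + ennreal (e/2)"
    using TV_approx[of u A "e/2"] e fin by auto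
  obtain V where V: "open V" "B \<subseteq> V" "tv u V \<le> TV u B + ennreal (e/2)"
    using TV_approx[of u B "e/2"] e fin by auto
  have "TV u (A \<union> B) \<le> tv u (U \<union> V)" using U V by (intro TV_le) auto
  also have "\<dots> \<le> tv u U + tv u V" by (rule tv_subadditive[OF u U(1) V(1)])
  also have "\<dots> \<le> (TV u A + ennreal (e/2)) + (TV u B + ennreal (e/2))" by (intro add_mono U V)
  also have "\<dots> = TV u A + TV u B + (ennreal (e/2) + ennreal (e/2))" by (simp only: ac_simps)
  also have "ennreal (e/2) + ennreal (e/2) = ennreal e" using e by (simp flip: ennreal_plus)
  finally show "TV u (A \<union> B) \<le> TV u A + TV u B + ennreal e" .
qed

text \<open>Superadditivity is available for disjoint open sets, and V - G need not be open. A set Q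
  j compactly inside G Int V leaves the open neighbourhood V - closure (Q j) of V - G, and inner
  regularity recovers the value on G Int V.\<close>

lemma TV_caratheodory_open:
  assumes u: "u \<in> borel_measurable M" and O1: "open G"
  shows "G \<in> lambda_system UNIV UNIV (TV u)"
  unfolding lambda_system_def
proof (safe intro!: antisym)
  fix x :: "'a set"
  have "x = (G \<inter> x) \<union> ((UNIV - G) \<inter> x)" by auto
  then show "TV u x \<le> TV u (G \<inter> x) + TV u ((UNIV - G) \<inter> x)"
    using TV_Un_le[OF u, of "G \<inter> x" "(UNIV - G) \<inter> x"] by simp
  show "TV u (G \<inter> x) + TV u ((UNIV - G) \<inter> x) \<le> TV u x"
    unfolding TV_eq_INF[of u x]
  proof (rule INF_greatest)
    fix V assume "V \<in> {U. open U \<and> x \<subseteq> U}"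
    then have V: "open V" "x \<subseteq> V" by auto
    obtain Q where Q: "exhaustion (G \<inter> V) Q" using ex_exhaustion[of "G \<inter> V"] O1 V by auto
    have Qo: "open (Q j)" and Qc: "closure (Q j) \<subseteq> G \<inter> V" for j
      using exhaustion_compactly_inside[OF Q, of j] by (auto simp: compactly_inside_def)
    have "TV u (G \<inter> x) + TV u ((UNIV - G) \<inter> x) \<le> tv u (G \<inter> V) + TV u (V - G)"
      using V O1 by (intro add_mono TV_le TV_mono) auto
    also have "\<dots> \<le> (SUP j. tv u (Q j)) + TV u (V - G)"
      using V O1 by (intro add_right_mono tv_inner_regular[OF _ u Q]) auto
    also have "\<dots> = (SUP j. tv u (Q j) + TV u (V - G))"
      by (rule ennreal_SUP_add_left[symmetric]) simp
    also have "\<dots> \<le> tv u V"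
    proof (rule SUP_least)
      fix j
      have "tv u (Q j) + TV u (V - G) \<le> tv u (Q j) + tv u (V - closure (Q j))"
        using V Qc[of j] by (intro add_left_mono TV_le) auto
      also have "\<dots> \<le> tv u (Q j \<union> (V - closure (Q j)))"
        using V Qo closure_subset[of "Q j"] by (intro tv_superadditive) auto
      also have "\<dots> \<le> tv u V"
        using V Qo Qc[of j] closure_subset[of "Q j"] by (intro tv_subset) auto
      finally show "tv u (Q j) + TV u (V - G) \<le> tv u V" .
    qed
    finally show "TV u (G \<inter> x) + TV u ((UNIV - G) \<inter> x) \<le> tv u V" .
  qed
qed auto

abbreviation TVM :: "('a \<Rightarrow> real) \<Rightarrow> 'a measure" where "TVM u \<equiv> caratheodory_measure (TV u)"

lemma space_TVM: "u \<in> borel_measurable M \<Longrightarrow> space (TVM u) = UNIV"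
  by (rule space_caratheodory_measure[OF TV_outer_measure])

lemma emeasure_TVM: "u \<in> borel_measurable M \<Longrightarrow> A \<in> sets (TVM u) \<Longrightarrow> emeasure (TVM u) A = TV u A"
  by (rule emeasure_caratheodory_measure[OF TV_outer_measure])

lemma sets_TVM_borel:
  assumes u: "u \<in> borel_measurable M" and A: "A \<in> sets borel"
  shows "A \<in> sets (TVM u)"
proof -
  have "sets borel \<subseteq> sets (TVM u)"
    unfolding sets_borel
  proof (rule sigma_algebra.sigma_sets_subset)
    show "sigma_algebra UNIV (sets (TVM u))"
      using sets.sigma_algebra_axioms[of "TVM u"] by (simp add: space_TVM[OF u])
    show "{S. open S} \<subseteq> sets (TVM u)"
      using TV_caratheodory_open[OF u] by (auto simp: sets_caratheodory_measure[OF TV_outer_measure[OF u]])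
  qed
  then show ?thesis using A by blast
qed

lemma TVM_null_sets:
  assumes u: "u \<in> borel_measurable M" and "TV u A = 0"
  shows "A \<in> null_sets (TVM u)"
proof -
  have "A \<in> sets (TVM u)"
    using outer_measure_null_sets[OF TV_outer_measure[OF u] assms(2)]
    by (simp add: sets_caratheodory_measure[OF TV_outer_measure[OF u]])
  then show ?thesis using assms(2) by (intro null_setsI) (simp_all add: emeasure_TVM[OF u])
qed

section \<open>Covers and codimension 1 Hausdorff measure\<close>

text \<open>The content grows as R decreases, so the limit exists and is the supremum. Existence
  matters, because \<open>Lim\<close> of a divergent family is an unspecified value.\<close>

lemma content_le_hausdorff:
  assumes "0 < R"
  shows "codim1_content m R A \<le> codim1_hausdorff m A"
proof -
  have anti: "codim1_content m R' A \<le> codim1_content m R A" if "R \<le> R'" for R R'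
    unfolding codim1_content_def
    by (rule Inf_superset_mono) (use that in \<open>blast intro: order_trans\<close>)
  let ?s = "SUP R\<in>{0<..}. codim1_content m R A"
  have "((\<lambda>R. codim1_content m R A) \<longlongrightarrow> ?s) (at_right 0)"
  proof (rule order_tendstoI)
    fix a assume "a < ?s"
    then obtain R0 where R0: "0 < R0" "a < codim1_content m R0 A" by (auto simp: less_SUP_iff)
    have "eventually (\<lambda>R::real. R < R0) (at_right 0)"
      using R0 eventually_at_right[of 0 R0] by auto
    then show "eventually (\<lambda>R. a < codim1_content m R A) (at_right 0)"
    proof eventually_elim
      case (elim R)
      then show ?case using anti[of R R0] R0(2) by simp
    qed
  next
    fix a assume a: "?s < a"
    have "eventually (\<lambda>R::real. 0 < R) (at_right 0)" by (simp add: eventually_at_right_less)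
    then show "eventually (\<lambda>R. codim1_content m R A < a) (at_right 0)"
    proof eventually_elim
      case (elim R)
      then have "codim1_content m R A \<le> ?s" by (intro SUP_upper) simp
      then show ?case using a by (rule le_less_trans)
    qed
  qed
  then have "codim1_hausdorff m A = ?s"
    unfolding codim1_hausdorff_def by (intro tendsto_Lim) (auto simp: trivial_limit_at_right_real)
  then show ?thesis using assms by (auto intro: SUP_upper)
qed

definition ball_cover :: "'a set \<Rightarrow> real \<Rightarrow> ('a \<times> real) set \<Rightarrow> bool" where
  "ball_cover K R S \<longleftrightarrow> finite S \<and> (\<forall>(x,r)\<in>S. 0 < r \<and> r \<le> R) \<and> K \<subseteq> (\<Union>(x,r)\<in>S. ball x r)"

abbreviation ball_cost :: "('a \<times> real) set \<Rightarrow> ennreal" where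
  "ball_cost S \<equiv> \<Sum>(x,r)\<in>S. m (ball x r) / ennreal r"

text \<open>The balls are tripled because the bump attached to a ball has an upper gradient
  supported in the tripled ball.\<close>

abbreviation ball_cost3 :: "('a \<times> real) set \<Rightarrow> ennreal" where
  "ball_cost3 S \<equiv> \<Sum>(x,r)\<in>S. m (ball x (3 * r)) / ennreal r"

lemma ball_cover_of_open_cover:
  assumes K: "compact K" "K \<subseteq> (\<Union>i\<in>I. ball (x i) (r i))" and r: "\<forall>i\<in>I. 0 < r i \<and> r i \<le> R"
    and s: "(\<Sum>i::nat. if i \<in> I then m (ball (x i) (r i)) / ennreal (r i) else 0) \<le> a"
  shows "\<exists>S. ball_cover K R S \<and> ball_cost S \<le> a"
proof -
  obtain J where J: "J \<subseteq> I" "finite J" "K \<subseteq> (\<Union>i\<in>J. ball (x i) (r i))"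
    using compactE_image[OF K(1) _ K(2)] by auto
  let ?p = "\<lambda>i. (x i, r i)"
  have cov: "ball_cover K R (?p ` J)" using J r by (auto simp: ball_cover_def)
  have "(\<Sum>(x,r)\<in>?p ` J. m (ball x r) / ennreal r) \<le> (\<Sum>i\<in>J. (\<lambda>(x,r). m (ball x r) / ennreal r) (?p i))"
    using J(2) sum_image_le[of J "\<lambda>(x,r). m (ball x r) / ennreal r" ?p] by (simp add: o_def)
  also have "(\<Sum>i\<in>J. (\<lambda>(x,r). m (ball x r) / ennreal r) (?p i))
      = (\<Sum>i\<in>J. if i \<in> I then m (ball (x i) (r i)) / ennreal (r i) else 0)"
    using J(1) by (intro sum.cong) auto
  also have "\<dots> \<le> (\<Sum>i. if i \<in> I then m (ball (x i) (r i)) / ennreal (r i) else 0)"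
    using J(2) by (intro sum_le_suminf summableI) auto
  also note s
  finally show ?thesis using cov by blast
qed

lemma ball_cover_of_content:
  assumes K: "compact K" "K \<subseteq> A" and a: "codim1_content m R A < a"
  shows "\<exists>S. ball_cover K R S \<and> ball_cost S \<le> a"
proof -
  obtain I x r where "A \<subseteq> (\<Union>i\<in>I. ball (x i) (r i))" "\<forall>i\<in>I. 0 < r i \<and> r i \<le> R"
    "(\<Sum>i::nat. if i \<in> I then m (ball (x i) (r i)) / ennreal (r i) else 0) < a"
    using a by (auto simp: codim1_content_def Inf_less_iff)
  then show ?thesis using K by (intro ball_cover_of_open_cover) auto
qed

text \<open>The form in which condition (iii) is used: the bound \<open>b\<close> does not depend on
  the scale \<open>R\<close> of the cover.\<close>

definition finite_cost :: "'a set \<Rightarrow> real \<Rightarrow> bool" where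
  "finite_cost \<Gamma> b \<longleftrightarrow> 0 \<le> b \<and> (\<forall>R>0. \<exists>S. ball_cover \<Gamma> R S \<and> ball_cost S \<le> ennreal b)"

lemma finite_cost_Un:
  assumes "finite_cost A a" "finite_cost B b"
  shows "finite_cost (A \<union> B) (a + b)"
  unfolding finite_cost_def
proof (intro conjI allI impI)
  show "0 \<le> a + b" using assms by (simp add: finite_cost_def)
  fix R :: real assume "0 < R"
  then obtain S T where S: "ball_cover A R S" "ball_cost S \<le> ennreal a"
    and T: "ball_cover B R T" "ball_cost T \<le> ennreal b"
    using assms unfolding finite_cost_def by meson
  have "ball_cost (S \<union> T)
      \<le> ball_cost (S \<union> T) + ball_cost (S \<inter> T)"
    by simp
  also have "\<dots> = ball_cost S + ball_cost T"
    using S T by (intro sum.union_inter) (auto simp: ball_cover_def)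
  also have "\<dots> \<le> ennreal a + ennreal b" by (intro add_mono S T)
  also have "\<dots> = ennreal (a + b)" using assms by (simp add: finite_cost_def)
  finally show "\<exists>S. ball_cover (A \<union> B) R S \<and> ball_cost S \<le> ennreal (a + b)"
    using S(1) T(1) by (intro exI[of _ "S \<union> T"]) (auto simp: ball_cover_def)
qed

lemma finite_cost_UN:
  assumes "finite X" "\<And>x. x \<in> X \<Longrightarrow> \<exists>b. finite_cost (K x) b"
  shows "\<exists>b. finite_cost (\<Union>x\<in>X. K x) b"
  using assms
proof (induction X)
  case empty
  have "finite_cost {} 0" by (auto simp: finite_cost_def ball_cover_def intro!: exI[of _ "{}"])
  then show ?case by auto
next
  case (insert x X)
  then obtain b where b: "finite_cost (\<Union>x\<in>X. K x) b" by auto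
  obtain a where a: "finite_cost (K x) a" using insert.prems[of x] by auto
  from finite_cost_Un[OF a b] show ?case by auto
qed

text \<open>By (iii) a piece of the boundary in a ball has finite Hausdorff measure, which bounds
  its content at every scale at once. Finitely many pieces suffice; they are cut out by closed balls
  of half the radius, since passing to finite covers needs compact pieces.\<close>

lemma finite_cost_frontier:
  assumes \<Omega>: "bounded \<Omega>" "open \<Omega>" "\<Omega> \<noteq> {}"
    and C: "\<forall>x\<in>frontier \<Omega>. \<forall>r. 0 < r \<and> r \<le> diameter \<Omega> \<longrightarrow>
          codim1_hausdorff m (ball x r \<inter> frontier \<Omega>) \<le> ennreal C * (m (ball x r) / ennreal r)"
  shows "\<exists>b. finite_cost (frontier \<Omega>) b"
proof (cases "frontier \<Omega> = {}")
  case True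
  then show ?thesis by (auto simp: finite_cost_def ball_cover_def intro!: exI[of _ "{}"])
next
  case False
  define d where "d = diameter \<Omega>"
  \<comment> \<open>A nonempty bounded set of diameter 0 is a single point; being open as well as
    closed, it would have no boundary.\<close>
  have d: "0 < d"
  proof (rule ccontr)
    assume "\<not> 0 < d"
    then have "dist x y \<le> 0" if "x \<in> \<Omega>" "y \<in> \<Omega>" for x y
      using diameter_bounded_bound[OF \<Omega>(1) that] \<open>\<not> 0 < d\<close> unfolding d_def by linarith
    then obtain a where "\<Omega> = {a}" using \<Omega>(3) by fastforce
    then have "closed \<Omega>" by simp
    then show False using False \<Omega>(2) by (simp add: frontier_def closure_closed interior_open)
  qed
  have cf: "compact (frontier \<Omega>)"
    by (intro compact_closed_bounded frontier_closed bounded_subset[OF bounded_closure[OF \<Omega>(1)]])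
      (auto simp: frontier_def)
  have "frontier \<Omega> \<subseteq> (\<Union>x\<in>frontier \<Omega>. ball x (d/2))" using d by auto
  then obtain X where X: "X \<subseteq> frontier \<Omega>" "finite X" "frontier \<Omega> \<subseteq> (\<Union>x\<in>X. ball x (d/2))"
    using compactE_image[OF cf, of "frontier \<Omega>" "\<lambda>x. ball x (d/2)"] by auto
  have "\<exists>b. finite_cost (cball x (d/2) \<inter> frontier \<Omega>) b" if x: "x \<in> X" for x
  proof -
    have "ennreal C * (m (ball x d) / ennreal d) < top"
      using m_ball_finite[of x d] d by (auto simp: ennreal_mult_less_top divide_ennreal_def inverse_ennreal)
    then obtain c where c: "ennreal C * (m (ball x d) / ennreal d) = ennreal c" "0 \<le> c"
      by (metis ennreal_cases less_irrefl)
    have K: "compact (cball x (d/2) \<inter> frontier \<Omega>)" "cball x (d/2) \<inter> frontier \<Omega> \<subseteq> ball x d \<inter> frontier \<Omega>"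
      using d by (auto intro!: compact_Int_closed compact_cball)
    have "finite_cost (cball x (d/2) \<inter> frontier \<Omega>) (c + 1)"
      unfolding finite_cost_def
    proof (intro conjI allI impI)
      fix R :: real assume R: "0 < R"
      have "codim1_content m R (ball x d \<inter> frontier \<Omega>) \<le> ennreal c"
        using content_le_hausdorff[OF R, of "ball x d \<inter> frontier \<Omega>"] C X(1) x d c
        by (force simp: d_def)
      also have "\<dots> < ennreal (c + 1)" using c(2) by (intro ennreal_lessI) auto
      finally show "\<exists>S. ball_cover (cball x (d/2) \<inter> frontier \<Omega>) R S \<and> ball_cost S \<le> ennreal (c + 1)"
        by (rule ball_cover_of_content[OF K])
    qed (use c in auto)
    then show ?thesis by blast
  qed
  then have "\<exists>b. finite_cost (\<Union>x\<in>X. cball x (d/2) \<inter> frontier \<Omega>) b"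
    by (rule finite_cost_UN[OF X(2)])
  then obtain b where "finite_cost (\<Union>x\<in>X. cball x (d/2) \<inter> frontier \<Omega>) b" by (elim exE)
  moreover have "frontier \<Omega> \<subseteq> (\<Union>x\<in>X. cball x (d/2) \<inter> frontier \<Omega>)" using X(3) by force
  ultimately have "finite_cost (frontier \<Omega>) b"
    unfolding finite_cost_def ball_cover_def by (meson order_trans)
  then show ?thesis by blast
qed

text \<open>The number 8 is the first power of 2 above 7: moving the centre within a ball of radius
  r, doubling the radius and then tripling it stays within distance 7 r of the old centre.\<close>

lemma dilated_cost_ex:
  "\<exists>c>0::real. \<forall>x r. 0 < r \<longrightarrow> m (ball x (8 * r)) / ennreal r \<le> ennreal c * (m (ball x r) / ennreal r)"
proof -
  obtain C :: real where C: "1 \<le> C" "\<And>x r n. 0 < r \<Longrightarrow> m (ball x (2 ^ n * r)) \<le> ennreal (C ^ n) * m (ball x r)"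
    using doubling_iter_ex by blast
  have "m (ball x (8 * r)) / ennreal r \<le> ennreal (C ^ 3) * (m (ball x r) / ennreal r)" if "0 < r" for x r
    using divide_right_mono_ennreal[OF C(2)[OF that, of x 3], of "ennreal r"]
    by (simp add: ennreal_times_divide)
  then show ?thesis using C(1) by (intro exI[of _ "C ^ 3"]) auto
qed

text \<open>Density information will be available at the points of \<open>D\<close> only, while
  covers come with arbitrary centres. Every ball meeting \<open>D\<close> is moved to a point of
  \<open>D\<close> and doubled, so that it still contains the old ball; the doubling condition keeps
  the cost below a constant that does not depend on \<open>D\<close>, \<open>K\<close> or
  \<open>R\<close>.\<close>

lemma ball_cover_recenter:
  assumes \<Gamma>: "finite_cost \<Gamma> b" "closed \<Gamma>"
  shows "\<exists>c>0. \<forall>D K R. D \<subseteq> \<Gamma> \<and> K \<subseteq> closure D \<and> 0 < R \<longrightarrow>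
    (\<exists>S. ball_cover K R S \<and> (\<forall>(x,r)\<in>S. x \<in> D) \<and> ball_cost3 S \<le> ennreal c)"
proof -
  obtain c :: real where c: "0 < c" "\<And>x r. 0 < r \<Longrightarrow> m (ball x (8 * r)) / ennreal r \<le> ennreal c * (m (ball x r) / ennreal r)"
    using dilated_cost_ex by blast
  have b: "0 \<le> b" using \<Gamma> by (simp add: finite_cost_def)
  \<comment> \<open>Using b + 1 keeps the constant positive also for b = 0; it is divided by later.
    The given cover is taken at scale R/2 because the radii get doubled.\<close>
  have "\<exists>S. ball_cover K R S \<and> (\<forall>(x,r)\<in>S. x \<in> D) \<and> ball_cost3 S \<le> ennreal (c * (b + 1))"
    if D: "D \<subseteq> \<Gamma>" "K \<subseteq> closure D" and R: "0 < R" for D K R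
  proof -
    obtain S where S: "ball_cover \<Gamma> (R/2) S" "ball_cost S \<le> ennreal b"
      using \<Gamma>(1) R unfolding finite_cost_def by (meson half_gt_zero)
    define S1 where "S1 = {p\<in>S. ball (fst p) (snd p) \<inter> D \<noteq> {}}"
    have S1: "finite S1" "S1 \<subseteq> S" using S by (auto simp: S1_def ball_cover_def)
    define a where "a p = (SOME y. y \<in> ball (fst p) (snd p) \<inter> D)" for p
    have a: "a p \<in> ball (fst p) (snd p) \<inter> D" if "p \<in> S1" for p
      using that some_in_eq[of "ball (fst p) (snd p) \<inter> D"] by (auto simp: a_def S1_def)
    let ?q = "\<lambda>p. (a p, 2 * snd p)"
    have pos: "0 < snd p \<and> snd p \<le> R/2" if "p \<in> S1" for p
      using that S S1 by (cases p) (auto simp: ball_cover_def)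
    have "K \<subseteq> (\<Union>(x,r)\<in>?q ` S1. ball x r)"
    proof
      fix z assume z: "z \<in> K"
      have "closure D \<subseteq> \<Gamma>" using D(1) \<Gamma>(2) by (rule closure_minimal)
      then have "z \<in> \<Gamma>" using z D by blast
      then obtain p where p: "p \<in> S" "z \<in> ball (fst p) (snd p)" using S(1) by (force simp: ball_cover_def)
      have "z \<in> closure D" using z D by blast
      then have "ball (fst p) (snd p) \<inter> D \<noteq> {}"
        using p(2) open_ball closure_iff_nhds_not_empty[of z D] by blast
      then have pS: "p \<in> S1" using p(1) by (simp add: S1_def)
      then have "dist (a p) z < 2 * snd p"
        using a[OF pS] p(2) dist_triangle[of "a p" z "fst p"] by (simp add: dist_commute)
      then show "z \<in> (\<Union>(x,r)\<in>?q ` S1. ball x r)" using pS by auto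
    qed
    then have cov: "ball_cover K R (?q ` S1)"
      using S1 pos by (force simp: ball_cover_def)
    moreover have "\<forall>(x,r)\<in>?q ` S1. x \<in> D" using a by auto
    moreover have "(\<Sum>(x,r)\<in>?q ` S1. m (ball x (3 * r)) / ennreal r) \<le> ennreal (c * (b + 1))"
    proof -
      have "(\<Sum>(x,r)\<in>?q ` S1. m (ball x (3 * r)) / ennreal r) \<le> (\<Sum>p\<in>S1. m (ball (a p) (3 * (2 * snd p))) / ennreal (2 * snd p))"
        using S1 sum_image_le[of S1 "\<lambda>(x,r). m (ball x (3 * r)) / ennreal r" ?q] by (simp add: o_def)
      also have "\<dots> \<le> (\<Sum>p\<in>S1. ennreal c * (m (ball (fst p) (snd p)) / ennreal (snd p)))"
      proof (rule sum_mono)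
        fix p assume p: "p \<in> S1"
        have "ball (a p) (3 * (2 * snd p)) \<subseteq> ball (fst p) (8 * snd p)"
        proof
          fix y assume "y \<in> ball (a p) (3 * (2 * snd p))"
          then show "y \<in> ball (fst p) (8 * snd p)"
            using a[OF p] pos[OF p] dist_triangle[of "fst p" y "a p"] by simp
        qed
        then have "m (ball (a p) (3 * (2 * snd p))) / ennreal (2 * snd p) \<le> m (ball (fst p) (8 * snd p)) / ennreal (snd p)"
          unfolding divide_ennreal_def using pos[OF p]
          by (intro mult_mono m_mono) (simp_all add: inverse_ennreal ennreal_leI)
        also have "\<dots> \<le> ennreal c * (m (ball (fst p) (snd p)) / ennreal (snd p))"
          using pos[OF p] by (intro c) auto
        finally show "m (ball (a p) (3 * (2 * snd p))) / ennreal (2 * snd p) \<le> ennreal c * (m (ball (fst p) (snd p)) / ennreal (snd p))" .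
      qed
      also have "\<dots> = ennreal c * ball_cost S1"
        by (simp add: sum_distrib_left case_prod_beta)
      also have "\<dots> \<le> ennreal c * ball_cost S"
        using S S1 by (intro mult_left_mono sum_mono2) (auto simp: ball_cover_def)
      also have "\<dots> \<le> ennreal c * ennreal b" by (intro mult_left_mono S) simp
      also have "\<dots> \<le> ennreal (c * (b + 1))"
        using c b by (simp add: algebra_simps ennreal_leI flip: ennreal_mult)
      finally show ?thesis .
    qed
    ultimately show ?thesis by blast
  qed
  moreover have "0 < c * (b + 1)" using c b by simp
  ultimately show ?thesis by blast
qed

end

section \<open>Replacing one set by another near a compact set\<close>

context doubling_space
begin

abbreviation P :: "'a set \<Rightarrow> 'a set \<Rightarrow> ennreal" where "P E \<equiv> TV (indicator E)"

lemma ind_measurable: "E \<in> sets M \<Longrightarrow> (indicator E :: 'a \<Rightarrow> real) \<in> borel_measurable M"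
  by simp

lemma ennreal_abs_indicator_diff:
  "ennreal \<bar>indicator E x - indicator F x\<bar> = indicator ((E - F) \<union> (F - E)) x"
  by (auto simp: indicator_def)

definition bump :: "'a \<times> real \<Rightarrow> 'a \<Rightarrow> real" where
  "bump p y = max 0 (min 1 (2 - dist (fst p) y / snd p))"

lemma bump_lipschitz:
  assumes "0 < snd p"
  shows "(1 / snd p)-lipschitz_on UNIV (bump p)"
proof (rule lipschitz_onI)
  fix y z :: 'a
  have "dist (bump p y) (bump p z) \<le> \<bar>dist (fst p) y / snd p - dist (fst p) z / snd p\<bar>"
    by (auto simp: bump_def dist_real_def max_def min_def)
  also have "\<dots> = 1 / snd p * \<bar>dist (fst p) y - dist (fst p) z\<bar>"
    using assms by (simp add: abs_divide flip: diff_divide_distrib)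
  also have "\<dots> \<le> 1 / snd p * dist y z"
    using assms dist_triangle[of "fst p" y z] dist_triangle[of "fst p" z y]
    by (intro mult_left_mono) (auto simp: dist_commute abs_le_iff)
  finally show "dist (bump p y) (bump p z) \<le> 1 / snd p * dist y z" .
qed (use assms in auto)

lemma bump_range: "0 \<le> bump p y \<and> bump p y \<le> 1"
  by (auto simp: bump_def)

lemma bump_1: "0 < snd p \<Longrightarrow> y \<in> ball (fst p) (snd p) \<Longrightarrow> bump p y = 1"
  by (auto simp: bump_def divide_le_eq)

lemma bump_0: "0 < snd p \<Longrightarrow> y \<notin> cball (fst p) (2 * snd p) \<Longrightarrow> bump p y = 0"
  by (auto simp: bump_def le_divide_eq)

text \<open>The tripled open ball and the complement of the doubled closed ball are open and cover
  the space. On the first the Lipschitz constant is an upper gradient, on the second the bump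
  vanishes.\<close>

lemma bump_ugrad:
  assumes p: "0 < snd p"
  shows "ugrad UNIV (bump p) (\<lambda>y. ennreal (1 / snd p) * indicator (ball (fst p) (3 * snd p)) y)" (is "ugrad _ _ ?h")
proof (rule ugrad_local)
  have hb: "?h \<in> borel_measurable borel" by (intro borel_measurable_times_ennreal borel_measurable_indicator) auto
  then show "?h \<in> borel_measurable (restrict_space borel UNIV)" by simp
  fix y
  show "\<exists>V. open V \<and> y \<in> V \<and> ugrad (V \<inter> UNIV) (bump p) ?h"
  proof (cases "y \<in> ball (fst p) (3 * snd p)")
    case True
    have "ugrad (ball (fst p) (3 * snd p)) (bump p) ?h"
      by (rule ugrad_mono[OF ugrad_subset[OF ugrad_lipschitz[OF bump_lipschitz[OF p]] subset_UNIV]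
            measurable_restrict_space1[OF hb]]) auto
    then show ?thesis using True by (intro exI[of _ "ball (fst p) (3 * snd p)"]) auto
  next
    case False
    have "ugrad (- cball (fst p) (2 * snd p)) (bump p) ?h"
      by (rule ugrad_mono[OF ugrad_const[of _ 0] measurable_restrict_space1[OF hb]]) (auto simp: bump_0[OF p])
    moreover have "y \<in> - cball (fst p) (2 * snd p)" using False p by auto
    ultimately show ?thesis by (intro exI[of _ "- cball (fst p) (2 * snd p)"]) auto
  qed
qed

lemma bump_Max_lip_loc:
  assumes "finite S" "S \<noteq> {}" "\<And>p. p \<in> S \<Longrightarrow> 0 < snd p"
  shows "lip_loc U (\<lambda>y. Max ((\<lambda>p. bump p y) ` S))"
proof -
  have half: "Max ((\<lambda>p. bump p y) ` S) \<le> Max ((\<lambda>p. bump p z) ` S) + (\<Sum>p\<in>S. 1 / snd p) * dist y z" for y z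
  proof -
    have "bump p y \<le> Max ((\<lambda>p. bump p z) ` S) + (\<Sum>p\<in>S. 1 / snd p) * dist y z" if p: "p \<in> S" for p
    proof -
      have "bump p y \<le> bump p z + 1 / snd p * dist y z"
        using lipschitz_onD[OF bump_lipschitz[OF assms(3)[OF p]], of y z] by (auto simp: dist_real_def)
      also have "\<dots> \<le> Max ((\<lambda>p. bump p z) ` S) + (\<Sum>p\<in>S. 1 / snd p) * dist y z"
        using assms p by (intro add_mono mult_right_mono Max_ge member_le_sum) (auto intro: less_imp_le)
      finally show ?thesis .
    qed
    then show ?thesis using assms(1,2) by (intro Max.boundedI) auto
  qed
  have "(\<Sum>p\<in>S. 1 / snd p)-lipschitz_on UNIV (\<lambda>y. Max ((\<lambda>p. bump p y) ` S))"
  proof (rule lipschitz_onI)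
    show "dist (Max ((\<lambda>p. bump p y) ` S)) (Max ((\<lambda>p. bump p z) ` S)) \<le> (\<Sum>p\<in>S. 1 / snd p) * dist y z" for y z
      using half[of y z] half[of z y] by (simp add: dist_real_def abs_le_iff dist_commute)
    show "0 \<le> (\<Sum>p\<in>S. 1 / snd p)" using assms by (intro sum_nonneg) (auto intro: less_imp_le)
  qed
  then show ?thesis using lipschitz_imp_lip_loc lip_loc_subset by blast
qed

text \<open>With the maximum of the bumps as cutoff, chi_F is replaced by chi_E near
  \<open>K\<close>, so the variation of F is needed off \<open>K\<close> only. The gradient of the
  cutoff acts only where E and F differ, which gives the term \<open>a\<close>. The bound
  \<open>b\<close> forces the total measure of the balls to 0 with their radii; the modified
  functions therefore converge to chi_F, and lower semicontinuity yields the estimate for F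
  itself.\<close>

lemma perimeter_cut:
  assumes E: "E \<in> sets M" and F: "F \<in> sets M" and U: "open U" and K: "compact K" "K \<subseteq> U"
    and cov: "\<And>R. 0 < R \<Longrightarrow> \<exists>S. ball_cover K R S \<and>
       (\<Sum>(x,r)\<in>S. m (ball x (3 * r) \<inter> ((E - F) \<union> (F - E))) / ennreal r) \<le> a \<and>
       ball_cost3 S \<le> ennreal b"
  shows "tv (indicator F) U \<le> tv (indicator E) U + tv (indicator F) (U - K) + a"
proof (cases "K = {}")
  case True
  then show ?thesis by (simp add: add_increasing add_increasing2)
next
  case False
  define \<Delta> where "\<Delta> = (E - F) \<union> (F - E)"
  have \<Delta>: "\<Delta> \<in> sets M" using E F by (simp add: \<Delta>_def)
  show ?thesis
  proof (rule tv_lsc[OF U ind_measurable[OF F]])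
    fix \<epsilon> :: real assume \<epsilon>: "0 < \<epsilon>"
    obtain e where e: "0 < e" "\<And>z. z \<in> K \<Longrightarrow> ball z e \<subseteq> U"
      using Heine_Borel_lemma[OF K(1), of "{U}"] K U by auto
    \<comment> \<open>The first bound keeps the tripled balls that belong to balls meeting
      \<open>K\<close> within distance 5 R \<le> e of \<open>K\<close>, hence inside
      \<open>U\<close>. The second makes their total measure, at most R times the cost, no larger
      than \<open>\<epsilon>\<close>.\<close>
    define R where "R = min (e / 5) (\<epsilon> / (\<bar>b\<bar> + 1))"
    have R: "0 < R" "5 * R \<le> e" "R * \<bar>b\<bar> \<le> \<epsilon>"
    proof -
      show "0 < R" "5 * R \<le> e" using e \<epsilon> by (auto simp: R_def)
      have "R * \<bar>b\<bar> \<le> \<epsilon> / (\<bar>b\<bar> + 1) * \<bar>b\<bar>" by (intro mult_right_mono) (auto simp: R_def)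
      also have "\<dots> \<le> \<epsilon>" using \<epsilon> by (simp add: field_simps)
      finally show "R * \<bar>b\<bar> \<le> \<epsilon>" .
    qed
    obtain S0 where S0: "ball_cover K R S0"
       "(\<Sum>(x,r)\<in>S0. m (ball x (3 * r) \<inter> \<Delta>) / ennreal r) \<le> a"
       "ball_cost3 S0 \<le> ennreal b"
      using cov[OF R(1)] unfolding \<Delta>_def by blast
    define S where "S = {p\<in>S0. ball (fst p) (snd p) \<inter> K \<noteq> {}}"
    have Sfin: "finite S" "S \<subseteq> S0" using S0(1) by (auto simp: S_def ball_cover_def)
    have Sr: "0 < snd p \<and> snd p \<le> R" if "p \<in> S" for p
      using that S0(1) by (cases p) (auto simp: S_def ball_cover_def)
    have SK: "K \<subseteq> (\<Union>p\<in>S. ball (fst p) (snd p))"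
      using S0(1) by (force simp: S_def ball_cover_def)
    have Sne: "S \<noteq> {}" using SK False by auto
    have sums: "(\<Sum>p\<in>S. m (ball (fst p) (3 * snd p) \<inter> \<Delta>) / ennreal (snd p)) \<le> a"
       "(\<Sum>p\<in>S. m (ball (fst p) (3 * snd p)) / ennreal (snd p)) \<le> ennreal b"
      using S0 Sfin order_trans[OF sum_mono2[of S0 S "\<lambda>p. m (ball (fst p) (3 * snd p) \<inter> \<Delta>) / ennreal (snd p)"]]
        order_trans[OF sum_mono2[of S0 S "\<lambda>p. m (ball (fst p) (3 * snd p)) / ennreal (snd p)"]]
      by (auto simp: ball_cover_def case_prod_beta)
    have SU: "cball (fst p) (3 * snd p) \<subseteq> U" if p: "p \<in> S" for p
    proof
      fix y assume y: "y \<in> cball (fst p) (3 * snd p)"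
      obtain z where z: "z \<in> K" "dist (fst p) z < snd p" using p by (auto simp: S_def)
      have "dist z y < 5 * R"
        using y z Sr[OF p] dist_triangle[of z y "fst p"] by (simp add: dist_commute)
      then show "y \<in> U" using e(2)[OF z(1)] R(2) by auto
    qed
    define \<eta> where "\<eta> y = Max ((\<lambda>p. bump p y) ` S)" for y
    define h where "h y = (\<Sum>p\<in>S. ennreal (1 / snd p) * indicator (ball (fst p) (3 * snd p)) y)" for y
    define N1 where "N1 = (\<Union>p\<in>S. ball (fst p) (snd p))"
    define D where "D = (\<Union>p\<in>S. cball (fst p) (2 * snd p))"
    define B where "B = (\<Union>p\<in>S. ball (fst p) (3 * snd p))"
    have \<eta>r: "0 \<le> \<eta> y \<and> \<eta> y \<le> 1" for y
    proof -
      have "\<eta> y \<in> (\<lambda>p. bump p y) ` S" unfolding \<eta>_def using Sfin Sne by (intro Max_in) auto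
      then show ?thesis using bump_range by auto
    qed
    have \<eta>1: "\<eta> y = 1" if y: "y \<in> N1" for y
    proof -
      obtain p where p: "p \<in> S" "y \<in> ball (fst p) (snd p)" using y unfolding N1_def by blast
      then have "bump p y = 1" using bump_1 Sr by blast
      then have "1 \<le> \<eta> y" unfolding \<eta>_def using Sfin(1) p(1) by (metis Max_ge finite_imageI imageI)
      then show ?thesis using \<eta>r[of y] by simp
    qed
    have \<eta>0: "\<eta> y = 0" if "y \<in> - D" for y
    proof -
      have "(\<lambda>p. bump p y) ` S = {0}" using that Sne bump_0 Sr by (force simp: D_def)
      then show ?thesis by (simp add: \<eta>_def)
    qed
    have Dc: "compact D" unfolding D_def using Sfin by (intro compact_UN compact_cball) auto
    have opn: "open N1" "open B" by (auto simp: N1_def B_def)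
    have KN: "K \<subseteq> N1" using SK by (simp add: N1_def)
    have N1D: "N1 \<subseteq> D" "D \<subseteq> B" using Sr by (force simp: N1_def D_def B_def)+
    have BU: "B \<subseteq> U" using SU by (auto simp: B_def subset_iff)
    \<comment> \<open>The cutoff can vary only on D - N1, a compact set that stays away from
      \<open>K\<close> because \<open>N1\<close> is an open neighbourhood of
      \<open>K\<close>.\<close>
    have "compact (D - N1)" "D - N1 \<subseteq> B - K" using Dc opn KN N1D by (auto intro: compact_diff)
    then obtain Ob where Ob: "compactly_inside Ob (B - K)" "D - N1 \<subseteq> Ob"
      using compactly_insideE[of "D - N1" "B - K"] opn K(1) compact_imp_closed by (metis open_Diff)
    have Ob': "open Ob" "compact (closure Ob)" "closure Ob \<subseteq> B - K" using Ob(1) by (auto simp: compactly_inside_def)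
    let ?w = "\<lambda>x. \<eta> x * indicator E x + (1 - \<eta> x) * indicator F x"
    have hm: "h \<in> borel_measurable M"
      unfolding h_def by (intro borel_measurable_sum borel_measurable_times_ennreal borel_measurable_indicator)
        (auto simp: sets_M_borel)
    have "tv ?w U \<le> tv (indicator E) U + tv (indicator F) (U - K) + (\<integral>\<^sup>+x\<in>Ob. ennreal \<bar>indicator E x - indicator F x\<bar> * h x \<partial>M)"
    proof (rule tv_glue[where ?N0.0 = "- D" and ?N1.0 = N1 and B = "\<Sum>p\<in>S. 1 / snd p"])
      show "lip_loc Ob \<eta>" unfolding \<eta>_def using Sfin Sne Sr by (intro bump_Max_lip_loc) auto
      show "ugrad Ob \<eta> h" unfolding \<eta>_def h_def
        using Sfin Sne Sr bump_ugrad by (intro ugrad_Max ugrad_subset[of UNIV _ _ Ob]) auto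
      show "h x \<le> ennreal (\<Sum>p\<in>S. 1 / snd p)" for x
      proof -
        have "h x \<le> (\<Sum>p\<in>S. ennreal (1 / snd p))" unfolding h_def
          by (intro sum_mono) (auto simp: indicator_def)
        also have "\<dots> = ennreal (\<Sum>p\<in>S. 1 / snd p)" using Sr by (intro sum_ennreal) (auto intro: less_imp_le)
        finally show ?thesis .
      qed
      show "0 \<le> (\<Sum>p\<in>S. 1 / snd p)" using Sr by (intro sum_nonneg) (auto intro: less_imp_le)
      show "U \<subseteq> - D \<union> N1 \<union> Ob" using Ob(2) by auto
      show "U \<inter> - D \<subseteq> U - K" using KN N1D by auto
      show "closure Ob \<subseteq> U \<inter> (U - K)" using Ob'(3) BU by auto
      show "open (U - K)" using U K(1) by (simp add: open_Diff compact_imp_closed)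
      show "open (- D)" using Dc by (simp add: compact_imp_closed open_Compl)
      show "0 \<le> \<eta> x \<and> \<eta> x \<le> 1" for x by (rule \<eta>r)
      show "x \<in> - D \<Longrightarrow> \<eta> x = 0" for x by (rule \<eta>0)
      show "x \<in> N1 \<Longrightarrow> \<eta> x = 1" for x by (rule \<eta>1)
    qed (use U opn Ob' ind_measurable[OF E] ind_measurable[OF F] in auto)
    also have "(\<integral>\<^sup>+x\<in>Ob. ennreal \<bar>indicator E x - indicator F x\<bar> * h x \<partial>M)
        \<le> (\<integral>\<^sup>+x. (\<Sum>p\<in>S. ennreal (1 / snd p) * indicator (ball (fst p) (3 * snd p) \<inter> \<Delta>) x) \<partial>M)"
    proof (rule nn_integral_mono)
      fix x
      have "ennreal \<bar>indicator E x - indicator F x\<bar> * h x * indicator Ob x \<le> indicator \<Delta> x * h x"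
        unfolding ennreal_abs_indicator_diff \<Delta>_def by (auto simp: indicator_def)
      also have "\<dots> = (\<Sum>p\<in>S. ennreal (1 / snd p) * indicator (ball (fst p) (3 * snd p) \<inter> \<Delta>) x)"
        by (auto simp: h_def indicator_def sum_distrib_left)
      finally show "ennreal \<bar>indicator E x - indicator F x\<bar> * h x * indicator Ob x
        \<le> (\<Sum>p\<in>S. ennreal (1 / snd p) * indicator (ball (fst p) (3 * snd p) \<inter> \<Delta>) x)" .
    qed
    also have "\<dots> = (\<Sum>p\<in>S. ennreal (1 / snd p) * m (ball (fst p) (3 * snd p) \<inter> \<Delta>))"
    proof -
      have B\<Delta>: "ball (fst p) (3 * snd p) \<inter> \<Delta> \<in> sets M" for p
        by (intro sets.Int sets_M_borel \<Delta>) simp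
      have "(\<lambda>x. ennreal (1 / snd p) * indicator (ball (fst p) (3 * snd p) \<inter> \<Delta>) x) \<in> borel_measurable M" for p
        by (intro borel_measurable_times_ennreal borel_measurable_indicator B\<Delta>) simp
      then show ?thesis by (simp only: nn_integral_sum nn_integral_cmult_indicator[OF B\<Delta>] emeasure_M[OF B\<Delta>])
    qed
    also have "\<dots> = (\<Sum>p\<in>S. m (ball (fst p) (3 * snd p) \<inter> \<Delta>) / ennreal (snd p))"
      using Sr by (intro sum.cong) (simp_all add: divide_ennreal_def inverse_ennreal inverse_eq_divide mult.commute)
    also have "\<dots> \<le> a" by (rule sums)
    finally have "tv ?w U \<le> tv (indicator E) U + tv (indicator F) (U - K) + a"
      by (simp add: add_left_mono)
    moreover have "?w \<in> borel_measurable M"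
    proof -
      have "continuous_on UNIV \<eta>"
        using lip_loc_continuous[OF open_UNIV] bump_Max_lip_loc[OF Sfin(1) Sne] Sr unfolding \<eta>_def by blast
      then have "\<eta> \<in> borel_measurable M"
        by (intro measurable_M_borel borel_measurable_continuous_onI)
      then show ?thesis
        using ind_measurable[OF E] ind_measurable[OF F]
        by (intro borel_measurable_add borel_measurable_times borel_measurable_diff) auto
    qed
    moreover have "(L1 U ?w (indicator F)) \<le> ennreal \<epsilon>"
    proof -
      have "(L1 U ?w (indicator F)) \<le> (\<integral>\<^sup>+x. (\<Sum>p\<in>S. indicator (ball (fst p) (3 * snd p)) x) \<partial>M)"
      proof (rule nn_integral_mono)
        fix x
        show "ennreal \<bar>?w x - indicator F x\<bar> * indicator U x \<le> (\<Sum>p\<in>S. indicator (ball (fst p) (3 * snd p)) x)"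
        proof (cases "x \<in> D")
          case True
          then obtain p where p: "p \<in> S" "x \<in> ball (fst p) (3 * snd p)" using N1D(2) by (auto simp: B_def)
          have "?w x - indicator F x = \<eta> x * (indicator E x - indicator F x)" by (simp add: algebra_simps)
          then have "\<bar>?w x - indicator F x\<bar> \<le> 1"
            using \<eta>r[of x] by (auto simp: abs_mult indicator_def)
          then have "ennreal \<bar>?w x - indicator F x\<bar> * indicator U x \<le> indicator (ball (fst p) (3 * snd p)) x"
            using p(2) by (auto simp: indicator_def simp del: mem_ball)
          also have "\<dots> \<le> (\<Sum>p\<in>S. indicator (ball (fst p) (3 * snd p)) x)"
            using Sfin(1) p(1) by (intro member_le_sum) auto
          finally show ?thesis .
        qed (simp add: \<eta>0)
      qed
      also have "\<dots> = (\<Sum>p\<in>S. m (ball (fst p) (3 * snd p)))"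
      proof -
        have "ball x r \<in> sets M" for x r by (intro sets_M_borel) simp
        then show ?thesis by (simp add: nn_integral_sum emeasure_M)
      qed
      also have "\<dots> \<le> (\<Sum>p\<in>S. ennreal R * (m (ball (fst p) (3 * snd p)) / ennreal (snd p)))"
      proof (rule sum_mono)
        fix p assume p: "p \<in> S"
        have "m (ball (fst p) (3 * snd p)) = ennreal (snd p) * (m (ball (fst p) (3 * snd p)) / ennreal (snd p))"
          using Sr[OF p] mult_divide_eq_ennreal[of "ennreal (snd p)" "m (ball (fst p) (3 * snd p))"]
          by (simp add: ennreal_times_divide mult.commute[of "ennreal (snd p)"])
        also have "\<dots> \<le> ennreal R * (m (ball (fst p) (3 * snd p)) / ennreal (snd p))"
          using Sr[OF p] by (intro mult_right_mono ennreal_leI) auto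
        finally show "m (ball (fst p) (3 * snd p)) \<le> ennreal R * (m (ball (fst p) (3 * snd p)) / ennreal (snd p))" .
      qed
      also have "\<dots> = ennreal R * (\<Sum>p\<in>S. m (ball (fst p) (3 * snd p)) / ennreal (snd p))"
        by (simp add: sum_distrib_left)
      also have "\<dots> \<le> ennreal R * ennreal b" by (intro mult_left_mono sums) simp
      also have "\<dots> \<le> ennreal R * ennreal \<bar>b\<bar>" by (intro mult_left_mono ennreal_leI) auto
      also have "\<dots> \<le> ennreal \<epsilon>" using R by (simp add: ennreal_leI flip: ennreal_mult)
      finally show ?thesis .
    qed
    ultimately show "\<exists>v\<in>borel_measurable M. tv v U \<le> tv (indicator E) U + tv (indicator F) (U - K) + a + ennreal \<epsilon> \<and>
        (L1 U v (indicator F)) \<le> ennreal \<epsilon>"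
      by (intro bexI[of _ ?w]) (auto intro: add_increasing2)
  qed
qed

lemma TV_disjoint_Un:
  assumes u: "u \<in> borel_measurable M" and "A \<in> sets borel" "B \<in> sets borel" "A \<inter> B = {}"
  shows "TV u (A \<union> B) = TV u A + TV u B"
  using plus_emeasure[of A "TVM u" B] assms sets_TVM_borel[OF u]
  by (simp add: emeasure_TVM[OF u])

text \<open>The variation on \<open>U\<close> is that on \<open>K\<close> plus that on U - K; the
  latter is finite and cancels. This turns the output of \<open>perimeter_cut\<close> into a bound
  on a compact set.\<close>

lemma TV_cut_le:
  assumes u: "u \<in> borel_measurable M" and fin: "TV u UNIV < \<infinity>" and U: "open U" and K: "compact K" "K \<subseteq> U"
    and le: "tv u U \<le> a + tv u (U - K) + b"
  shows "TV u K \<le> a + b"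
proof -
  have cl: "closed K" using K(1) by (rule compact_imp_closed)
  have "TV u K + tv u (U - K) = TV u (K \<union> (U - K))"
    using TV_disjoint_Un[OF u, of K "U - K"] U cl by (simp add: TV_open open_Diff)
  also have "K \<union> (U - K) = U" using K by auto
  also have "TV u U \<le> a + b + tv u (U - K)"
    using le by (simp add: TV_open[OF U] ac_simps)
  finally have le': "TV u K + tv u (U - K) \<le> a + b + tv u (U - K)" .
  have "tv u (U - K) < \<infinity>"
    using TV_mono[of "U - K" UNIV u] fin U cl by (simp add: TV_open open_Diff le_less_trans)
  then show ?thesis
    using le' ennreal_add_left_cancel_le[of "tv u (U - K)" "TV u K" "a + b"] by (auto simp: add.commute)
qed

text \<open>Cut with E = {}: the error term is at most the tripled cost, which doubling compares
  with the plain cost of the cover, and that can be made arbitrarily small.\<close>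

lemma perimeter_hausdorff_null_compact:
  assumes F: "F \<in> sets M" and fin: "P F UNIV < \<infinity>" and K: "compact K"
    and null: "\<And>R a. 0 < R \<Longrightarrow> 0 < a \<Longrightarrow> \<exists>S. ball_cover K R S \<and> ball_cost S \<le> ennreal a"
  shows "P F K = 0"
proof -
  obtain c :: real where c: "0 < c" "\<And>x r. 0 < r \<Longrightarrow> m (ball x (8 * r)) / ennreal r \<le> ennreal c * (m (ball x r) / ennreal r)"
    using dilated_cost_ex by blast
  have small: "P F K \<le> 0 + ennreal e" if e: "0 < e" for e :: real
  proof -
    have "tv (indicator F) UNIV \<le> tv (indicator {}) UNIV + tv (indicator F) (UNIV - K) + ennreal e"
    proof (rule perimeter_cut[where b = e])
      fix R :: real assume R: "0 < R"
      obtain S where S: "ball_cover K R S" "ball_cost S \<le> ennreal (e / c)"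
        using null[OF R, of "e / c"] e c by auto
      have pos: "0 < snd p" if "p \<in> S" for p using that S(1) by (cases p) (auto simp: ball_cover_def)
      have "ball_cost3 S \<le> (\<Sum>(x,r)\<in>S. ennreal c * (m (ball x r) / ennreal r))"
      proof (rule sum_mono)
        fix p assume p: "p \<in> S"
        have "m (ball (fst p) (3 * snd p)) / ennreal (snd p) \<le> m (ball (fst p) (8 * snd p)) / ennreal (snd p)"
          using pos[OF p] by (intro divide_right_mono_ennreal m_mono) auto
        also have "\<dots> \<le> ennreal c * (m (ball (fst p) (snd p)) / ennreal (snd p))" using c(2) pos[OF p] by blast
        finally show "(case p of (x, r) \<Rightarrow> m (ball x (3 * r)) / ennreal r) \<le> (case p of (x, r) \<Rightarrow> ennreal c * (m (ball x r) / ennreal r))"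
          by (simp add: case_prod_beta)
      qed
      also have "\<dots> = ennreal c * ball_cost S"
        by (simp add: sum_distrib_left case_prod_beta)
      also have "\<dots> \<le> ennreal c * ennreal (e / c)" by (intro mult_left_mono S) simp
      also have "\<dots> = ennreal e" using c e by (simp flip: ennreal_mult)
      finally have b: "ball_cost3 S \<le> ennreal e" .
      have "(\<Sum>(x,r)\<in>S. m (ball x (3 * r) \<inter> (({} - F) \<union> (F - {}))) / ennreal r) \<le> ball_cost3 S"
        by (intro sum_mono) (auto intro!: divide_right_mono_ennreal m_mono)
      then show "\<exists>S. ball_cover K R S \<and>
         (\<Sum>(x,r)\<in>S. m (ball x (3 * r) \<inter> (({} - F) \<union> (F - {}))) / ennreal r) \<le> ennreal e \<and>
         ball_cost3 S \<le> ennreal e"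
        using S(1) b by (intro exI[of _ S]) auto
    qed (use F K in auto)
    then have "tv (indicator F) UNIV \<le> 0 + tv (indicator F) (UNIV - K) + ennreal e"
      using tv_cong[of UNIV "indicator {}" "\<lambda>_. 0"] tv_const[of UNIV 0] by simp
    from TV_cut_le[OF ind_measurable[OF F] fin open_UNIV K subset_UNIV this] show ?thesis .
  qed
  have "P F K \<le> 0"
  proof (rule ennreal_le_epsilon)
    show "P F K \<le> 0 + ennreal e" if "0 < e" for e using that by (rule small)
  qed
  then show ?thesis by simp
qed

text \<open>Outer regularity is applied to the complement: an open G containing - A with small
  excess leaves little of A inside G, and - G is a countable union of compact subsets of A.\<close>

lemma TV_null_of_compact:
  assumes u: "u \<in> borel_measurable M" and fin: "TV u UNIV < \<infinity>" and A: "A \<in> sets borel"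
    and K: "\<And>K. compact K \<Longrightarrow> K \<subseteq> A \<Longrightarrow> TV u K = 0"
  shows "TV u A = 0"
proof -
  have "TV u A \<le> 0"
  proof (rule ennreal_le_epsilon)
    fix e :: real assume e: "0 < e"
    have finA: "TV u (- A) < \<infinity>" using TV_mono[of "- A" UNIV u] fin by (simp add: le_less_trans)
    obtain G where G: "open G" "- A \<subseteq> G" "tv u G \<le> TV u (- A) + ennreal e" by (rule TV_approx[OF finA e])
    have "TV u (A \<inter> G) + TV u (- A) = TV u ((A \<inter> G) \<union> - A)"
      using A G by (intro TV_disjoint_Un[OF u, symmetric]) auto
    also have "(A \<inter> G) \<union> - A = G" using G(2) by auto
    also have "TV u G \<le> ennreal e + TV u (- A)" using G by (simp add: TV_open add.commute)
    finally have "TV u (A \<inter> G) \<le> ennreal e"       using finA ennreal_add_left_cancel_le[of "TV u (- A)" "TV u (A \<inter> G)" "ennreal e"] by (auto simp: add.commute)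
    moreover have "TV u (- G) = 0"
    proof -
      let ?a = "undefined :: 'a"
      have z: "TV u (- G \<inter> cball ?a (real n)) = 0" for n
        using G by (intro K closed_Int_compact compact_cball closed_Compl) auto
      have "- G = (\<Union>n. - G \<inter> cball ?a (real n))" using real_arch_simple by auto
      then have "emeasure (TVM u) (- G) = emeasure (TVM u) (\<Union>n. - G \<inter> cball ?a (real n))" by simp
      also have "\<dots> = 0"
        using z G by (intro null_setsD1 null_sets_UN TVM_null_sets[OF u])
      finally show ?thesis using G by (simp add: emeasure_TVM[OF u] sets_TVM_borel[OF u])
    qed
    moreover have "A \<subseteq> (A \<inter> G) \<union> - G" by auto
    ultimately have "TV u A \<le> ennreal e"
      using TV_mono[of A "(A \<inter> G) \<union> - G" u] TV_Un_le[OF u, of "A \<inter> G" "- G"] by simp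
    then show "TV u A \<le> 0 + ennreal e" by simp
  qed
  then show ?thesis by simp
qed

text \<open>An arbitrary null set is enlarged to the intersection of countably many of its open
  covers. The result is Borel, its compact subsets still have cheap covers at every scale, and
  vanishing on compact subsets is enough for a Borel set.\<close>

lemma perimeter_hausdorff_null:
  assumes F: "F \<in> sets M" and fin: "P F UNIV < \<infinity>" and A: "codim1_hausdorff m A = 0"
  shows "P F A = 0"
proof -
  have "\<forall>n. \<exists>I x r. A \<subseteq> (\<Union>i\<in>I. ball (x i) (r i)) \<and> (\<forall>i\<in>I. 0 < r i \<and> r i \<le> inverse (real (Suc n))) \<and>
      (\<Sum>i::nat. if i \<in> I then m (ball (x i) (r i)) / ennreal (r i) else 0) < ennreal (inverse (real (Suc n)))"
  proof
    fix n
    have "codim1_content m (inverse (real (Suc n))) A < ennreal (inverse (real (Suc n)))"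
      using content_le_hausdorff[of "inverse (real (Suc n))" A] A by simp
    then show "\<exists>I x r. A \<subseteq> (\<Union>i\<in>I. ball (x i) (r i)) \<and> (\<forall>i\<in>I. 0 < r i \<and> r i \<le> inverse (real (Suc n))) \<and>
      (\<Sum>i::nat. if i \<in> I then m (ball (x i) (r i)) / ennreal (r i) else 0) < ennreal (inverse (real (Suc n)))"
      unfolding codim1_content_def Inf_less_iff by blast
  qed
  then obtain I x r where "\<forall>n. A \<subseteq> (\<Union>i\<in>I n. ball (x n i) (r n i)) \<and>
    (\<forall>i\<in>I n. 0 < r n i \<and> r n i \<le> inverse (real (Suc n))) \<and>
    (\<Sum>i::nat. if i \<in> I n then m (ball (x n i) (r n i)) / ennreal (r n i) else 0) < ennreal (inverse (real (Suc n)))"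
    unfolding choice_iff by (elim exE)
  then have cov: "\<And>n. A \<subseteq> (\<Union>i\<in>I n. ball (x n i) (r n i))"
    "\<And>n. \<forall>i\<in>I n. 0 < r n i \<and> r n i \<le> inverse (real (Suc n))"
    "\<And>n. (\<Sum>i::nat. if i \<in> I n then m (ball (x n i) (r n i)) / ennreal (r n i) else 0) < ennreal (inverse (real (Suc n)))"
    by blast+
  define A' where "A' = (\<Inter>n. \<Union>i\<in>I n. ball (x n i) (r n i))"
  have "P F A' = 0"
  proof (rule TV_null_of_compact[OF ind_measurable[OF F] fin])
    have "open (\<Union>i\<in>I n. ball (x n i) (r n i))" for n by auto
    then show "A' \<in> sets borel" unfolding A'_def by (intro sets.countable_INT) auto
    fix K assume K: "compact K" "K \<subseteq> A'"
    show "P F K = 0"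
    proof (rule perimeter_hausdorff_null_compact[OF F fin K(1)])
      fix R a :: real assume Ra: "0 < R" "0 < a"
      obtain n where n: "inverse (real (Suc n)) < min R a" using reals_Archimedean[of "min R a"] Ra by auto
      have "K \<subseteq> (\<Union>i\<in>I n. ball (x n i) (r n i))" using K(2) by (auto simp: A'_def)
      from ball_cover_of_open_cover[OF K(1) this cov(2) less_imp_le[OF cov(3)]]
      obtain S where S: "ball_cover K (inverse (real (Suc n))) S"
        "ball_cost S \<le> ennreal (inverse (real (Suc n)))" by blast
      have "ball_cover K R S" using S(1) n by (force simp: ball_cover_def)
      moreover have "ennreal (inverse (real (Suc n))) \<le> ennreal a" using n by (intro ennreal_leI) auto
      ultimately show "\<exists>S. ball_cover K R S \<and> ball_cost S \<le> ennreal a"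
        using S(2) by (meson order_trans)
    qed
  qed
  moreover have "A \<subseteq> A'" using cov(1) by (auto simp: A'_def)
  ultimately show ?thesis using TV_mono[of A A' "indicator F"] by simp
qed

text \<open>Where E and F differ by a set of density 0, F may be replaced by E almost for free: the
  error in the cut is an arbitrarily small multiple of the bounded cost of the cover. With E = {}
  this says that F has no perimeter at points of density 0 on \<open>\<Gamma>\<close>; with Omega in
  either role it compares the perimeters of Omega and of a subset at points of trace 1.\<close>

lemma perimeter_density_zero:
  assumes \<Gamma>: "finite_cost \<Gamma> b" "closed \<Gamma>" and E: "E \<in> sets M" and F: "F \<in> sets M"
    and fin: "P F UNIV < \<infinity>" and Z: "Z \<subseteq> \<Gamma>" and U: "open U"
    and dens: "\<And>x \<epsilon>. x \<in> Z \<Longrightarrow> 0 < \<epsilon> \<Longrightarrow> \<exists>r0>0. \<forall>r. 0 < r \<and> r < r0 \<longrightarrow>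
       m (ball x r \<inter> ((E - F) \<union> (F - E))) \<le> ennreal \<epsilon> * m (ball x r)"
  shows "P F (Z \<inter> U) \<le> tv (indicator E) U"
proof (rule ennreal_le_epsilon)
  fix e :: real assume e: "0 < e"
  define \<Delta> where "\<Delta> = (E - F) \<union> (F - E)"
  from ball_cover_recenter[OF \<Gamma>] obtain c where c: "0 < c" and rec: "\<forall>D K R. D \<subseteq> \<Gamma> \<and> K \<subseteq> closure D \<and> 0 < R \<longrightarrow>
    (\<exists>S. ball_cover K R S \<and> (\<forall>(x,r)\<in>S. x \<in> D) \<and> ball_cost3 S \<le> ennreal c)"
    by (elim exE conjE)
  obtain Q where Q: "exhaustion U Q" using ex_exhaustion[OF U] by blast
  \<comment> \<open>The points at which the smallness holds uniformly below the scale 1/(n+1). The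
    fraction e/c is matched to the cost \<open>c\<close>, so that the total error is e.\<close>
  define D where "D n = {x\<in>Z. \<forall>r. 0 < r \<and> r < inverse (real (Suc n)) \<longrightarrow>
      m (ball x r \<inter> \<Delta>) \<le> ennreal (e / c) * m (ball x r)}" for n
  \<comment> \<open>The estimate is known on \<open>D n\<close> and not on its closure, but a
    compact set is needed for cutting. Covers recentred in \<open>D n\<close> bridge the
    gap.\<close>
  define K where "K n = closure (D n) \<inter> closure (Q n)" for n
  have Kc: "compact (K n)" and KU: "K n \<subseteq> U" for n
    using exhaustion_compactly_inside[OF Q, of n]
    by (auto simp: K_def compactly_inside_def intro: closed_Int_compact)
  have Ke: "P F (K n) \<le> tv (indicator E) U + ennreal e" for n
  proof (rule TV_cut_le[OF ind_measurable[OF F] fin U Kc KU perimeter_cut[OF E F U Kc KU, where b = c]])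
    fix R :: real assume R: "0 < R"
    \<comment> \<open>The quarter keeps the tripled radii below the scale of
      \<open>D n\<close>.\<close>
    define R' where "R' = min R (inverse (real (Suc n)) / 4)"
    have R': "0 < R'" "3 * R' < inverse (real (Suc n))" using R by (auto simp: R'_def min_def)
    have "D n \<subseteq> \<Gamma>" using Z by (auto simp: D_def)
    moreover have "K n \<subseteq> closure (D n)" by (auto simp: K_def)
    ultimately have "\<exists>S. ball_cover (K n) R' S \<and> (\<forall>(x,r)\<in>S. x \<in> D n) \<and>
      ball_cost3 S \<le> ennreal c"
      using R'(1) by (intro rec[rule_format] conjI)
    then obtain S where S: "ball_cover (K n) R' S" "\<forall>(x,r)\<in>S. x \<in> D n"
      "ball_cost3 S \<le> ennreal c"
      by (elim exE conjE)
    have "(\<Sum>(x,r)\<in>S. m (ball x (3 * r) \<inter> \<Delta>) / ennreal r) \<le> (\<Sum>(x,r)\<in>S. ennreal (e / c) * (m (ball x (3 * r)) / ennreal r))"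
    proof (rule sum_mono)
      fix p assume p: "p \<in> S"
      have pr: "fst p \<in> D n" "0 < snd p" "snd p \<le> R'" using p S(1,2) by (auto simp: ball_cover_def)
      then have "m (ball (fst p) (3 * snd p) \<inter> \<Delta>) \<le> ennreal (e / c) * m (ball (fst p) (3 * snd p))"
        using R'(2) by (auto simp: D_def)
      from divide_right_mono_ennreal[OF this, of "ennreal (snd p)"]
      show "(case p of (x, r) \<Rightarrow> m (ball x (3 * r) \<inter> \<Delta>) / ennreal r) \<le> (case p of (x, r) \<Rightarrow> ennreal (e / c) * (m (ball x (3 * r)) / ennreal r))"
        by (simp add: case_prod_beta ennreal_times_divide)
    qed
    also have "\<dots> = ennreal (e / c) * ball_cost3 S"
      by (simp add: sum_distrib_left case_prod_beta)
    also have "\<dots> \<le> ennreal (e / c) * ennreal c" by (intro mult_left_mono S) simp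
    also have "\<dots> = ennreal e" using e c by (simp flip: ennreal_mult)
    finally have "(\<Sum>(x,r)\<in>S. m (ball x (3 * r) \<inter> \<Delta>) / ennreal r) \<le> ennreal e" .
    moreover have "ball_cover (K n) R S" using S(1) by (force simp: ball_cover_def R'_def)
    ultimately show "\<exists>S. ball_cover (K n) R S \<and>
       (\<Sum>(x,r)\<in>S. m (ball x (3 * r) \<inter> ((E - F) \<union> (F - E))) / ennreal r) \<le> ennreal e \<and>
       ball_cost3 S \<le> ennreal c"
      using S(3) unfolding \<Delta>_def by blast
  qed
  have Kb: "K n \<in> sets (TVM (indicator F))" for n
    by (intro sets_TVM_borel ind_measurable F borel_closed compact_imp_closed Kc)
  have Kinc: "incseq K"
  proof (rule incseq_SucI)
    fix n
    have "inverse (real (Suc (Suc n))) \<le> inverse (real (Suc n))" by (simp add: le_imp_inverse_le)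
    then have "r < inverse (real (Suc n))" if "r < inverse (real (Suc (Suc n)))" for r
      using that by linarith
    then have "D n \<subseteq> D (Suc n)" unfolding D_def by blast
    moreover have "Q n \<subseteq> Q (Suc n)" by (rule exhaustion_mono[OF Q]) simp
    ultimately show "K n \<subseteq> K (Suc n)" unfolding K_def using closure_mono by blast
  qed
  have "Z \<inter> U \<subseteq> (\<Union>n. K n)"
  proof
    fix x assume x: "x \<in> Z \<inter> U"
    then obtain r0 where r0: "0 < r0" "\<forall>r. 0 < r \<and> r < r0 \<longrightarrow> m (ball x r \<inter> \<Delta>) \<le> ennreal (e / c) * m (ball x r)"
      using dens[of x "e / c"] e c by (auto simp: \<Delta>_def)
    obtain n1 where n1: "inverse (real (Suc n1)) < r0" using reals_Archimedean[OF r0(1)] by blast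
    obtain n2 where n2: "x \<in> Q n2" using x Q by (auto simp: exhaustion_def)
    define n where "n = max n1 n2"
    have "inverse (real (Suc n)) \<le> inverse (real (Suc n1))" by (simp add: n_def le_imp_inverse_le)
    then have "r < r0" if "r < inverse (real (Suc n))" for r using n1 that by linarith
    then have "x \<in> D n" using x r0(2) by (simp add: D_def del: of_nat_Suc)
    moreover have "x \<in> Q n" using n2 exhaustion_mono[OF Q, of n2 n] by (auto simp: n_def)
    ultimately show "x \<in> (\<Union>n. K n)" using closure_subset unfolding K_def by blast
  qed
  then have "P F (Z \<inter> U) \<le> P F (\<Union>n. K n)" by (rule TV_mono)
  also have "\<dots> = emeasure (TVM (indicator F)) (\<Union>n. K n)"
    using Kb by (intro emeasure_TVM[symmetric] ind_measurable F) auto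
  also have "\<dots> = (SUP n. emeasure (TVM (indicator F)) (K n))"
    using Kb Kinc by (intro SUP_emeasure_incseq[symmetric]) auto
  also have "\<dots> \<le> tv (indicator E) U + ennreal e"
    using Ke by (intro SUP_least) (simp add: emeasure_TVM[OF ind_measurable[OF F] Kb])
  finally show "P F (Z \<inter> U) \<le> tv (indicator E) U + ennreal e" .
qed

text \<open>The whole boundary is cut out with E = {}, at a price bounded by the cost of its covers.
  Off the boundary only the part inside Omega contributes variation.\<close>

lemma finite_perimeter_extension:
  assumes \<Gamma>: "finite_cost (frontier \<Omega>) b" and \<Omega>: "open \<Omega>" "bounded \<Omega>" and E: "E \<subseteq> \<Omega>" "E \<in> sets M"
    and fin: "tv (indicator E) \<Omega> < \<infinity>"
  shows "P E UNIV < \<infinity>"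
proof -
  let ?\<Gamma> = "frontier \<Omega>"
  have cf: "compact ?\<Gamma>"
    by (intro compact_closed_bounded frontier_closed bounded_subset[OF bounded_closure[OF \<Omega>(2)]])
      (auto simp: frontier_def)
  from ball_cover_recenter[OF \<Gamma> frontier_closed] obtain c where c: "0 < c" and rec: "\<forall>D K R. D \<subseteq> ?\<Gamma> \<and> K \<subseteq> closure D \<and> 0 < R \<longrightarrow>
    (\<exists>S. ball_cover K R S \<and> (\<forall>(x,r)\<in>S. x \<in> D) \<and> ball_cost3 S \<le> ennreal c)"
    by (elim exE conjE)
  have "tv (indicator E) UNIV \<le> tv (indicator {}) UNIV + tv (indicator E) (UNIV - ?\<Gamma>) + ennreal c"
  proof (rule perimeter_cut[where b = c])
    fix R :: real assume R: "0 < R"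
    have "\<exists>S. ball_cover ?\<Gamma> R S \<and> (\<forall>(x,r)\<in>S. x \<in> ?\<Gamma>) \<and> ball_cost3 S \<le> ennreal c"
      using R closure_subset by (intro rec[rule_format] conjI) auto
    then obtain S where S: "ball_cover ?\<Gamma> R S" "ball_cost3 S \<le> ennreal c"
      by (elim exE conjE)
    have "(\<Sum>(x,r)\<in>S. m (ball x (3 * r) \<inter> (({} - E) \<union> (E - {}))) / ennreal r) \<le> ball_cost3 S"
      by (intro sum_mono) (auto intro!: divide_right_mono_ennreal m_mono)
    then show "\<exists>S. ball_cover ?\<Gamma> R S \<and>
         (\<Sum>(x,r)\<in>S. m (ball x (3 * r) \<inter> (({} - E) \<union> (E - {}))) / ennreal r) \<le> ennreal c \<and>
         ball_cost3 S \<le> ennreal c"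
      using S by (intro exI[of _ S]) auto
  qed (use E cf in auto)
  also have "tv (indicator {}) UNIV = 0"
    using tv_cong[of UNIV "indicator {}" "\<lambda>_. 0"] tv_const[of UNIV 0] by simp
  also have "UNIV - ?\<Gamma> = \<Omega> \<union> - closure \<Omega>"
    using \<Omega>(1) closure_subset[of \<Omega>] by (auto simp: frontier_def interior_open)
  also have "tv (indicator E) (\<Omega> \<union> - closure \<Omega>) \<le> tv (indicator E) \<Omega> + tv (indicator E) (- closure \<Omega>)"
    using \<Omega> by (intro tv_subadditive ind_measurable E) auto
  also have "tv (indicator E) (- closure \<Omega>) = 0"
  proof -
    have "tv (indicator E) (- closure \<Omega>) = tv (\<lambda>_. 0) (- closure \<Omega>)"
      using E(1) closure_subset[of \<Omega>] by (intro tv_cong) (auto simp: indicator_def)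
    then show ?thesis by (simp add: tv_const open_Compl)
  qed
  finally have "tv (indicator E) UNIV \<le> tv (indicator E) \<Omega> + ennreal c" by (simp add: add_right_mono)
  also have "\<dots> < \<infinity>" using fin by simp
  finally show ?thesis by (simp add: TV_open)
qed

end

lemma tendsto_0_squeeze_ennreal:
  fixes f g :: "'b \<Rightarrow> ennreal"
  assumes "(g \<longlongrightarrow> 0) F" "eventually (\<lambda>x. f x \<le> g x) F"
  shows "(f \<longlongrightarrow> 0) F"
  using assms by (intro tendsto_sandwich[OF _ _ tendsto_const assms(1)]) auto

lemma half_less_ennreal:
  fixes a c :: ennreal
  assumes "a < 1/2 * (a + c)"
  shows "a < c"
proof (rule ccontr)
  assume "\<not> a < c"
  then have "1/2 * (a + c) \<le> 1/2 * (a + a)" by (intro mult_left_mono add_left_mono) auto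
  also have "\<dots> = a * 2 / 2"
    by (simp only: mult.commute[of "1/2"] ennreal_times_divide mult_1_right mult_2_right)
  also have "\<dots> = a" by (rule mult_divide_eq_ennreal) simp_all
  finally show False using assms by simp
qed

text \<open>Condition (i) is \<open>exterior\<close>, condition (iii) enters through
  \<open>cost\<close>, and condition (ii) is packaged set by set in
  \<open>has_traces\<close>.\<close>

locale boundary_setting = doubling_space m for m :: "'a::complete_space set \<Rightarrow> ennreal" +
  fixes \<Omega> :: "'a set" and b :: real
  assumes open_Omega: "open \<Omega>" and bounded_Omega: "bounded \<Omega>"
    and cost: "finite_cost (frontier \<Omega>) b"
    and exterior: "codim1_hausdorff m
          {x \<in> frontier \<Omega>. \<not> Limsup (at_right 0) (\<lambda>r. m (ball x r - \<Omega>) / m (ball x r)) > 0} = 0"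
begin

section \<open>Traces of sets\<close>

abbreviation bd :: "'a set" where "bd \<equiv> measure_theoretic_boundary m \<Omega>"

lemma Omega_sets: "\<Omega> \<in> sets M"
  using open_Omega by (intro sets_M_borel) simp

definition density_zero :: "'a set \<Rightarrow> 'a \<Rightarrow> bool" where
  "density_zero A x \<longleftrightarrow> (\<forall>\<epsilon>>0. \<exists>r0>0. \<forall>r. 0 < r \<and> r < r0 \<longrightarrow> m (ball x r \<inter> A) \<le> ennreal \<epsilon> * m (ball x r))"

lemma density_zero_subset: "density_zero A x \<Longrightarrow> B \<subseteq> A \<Longrightarrow> density_zero B x"
  unfolding density_zero_def by (meson Int_mono m_mono order_refl order_trans)

lemma relative_ball_pos:
  assumes "x \<in> frontier \<Omega>" "0 < r"
  shows "0 < m (ball x r \<inter> \<Omega>)"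
proof -
  have "x \<in> closure \<Omega>" using assms(1) by (auto simp: frontier_def)
  then obtain y where "y \<in> \<Omega>" "dist y x < r" using assms(2) unfolding closure_approachable by blast
  then have "y \<in> ball x r \<inter> \<Omega>" by (simp add: dist_commute)
  moreover have "open (ball x r \<inter> \<Omega>)" using open_Omega by auto
  ultimately obtain s where s: "0 < s" "ball y s \<subseteq> ball x r \<inter> \<Omega>" using open_contains_ball by blast
  then show ?thesis using m_mono[OF s(2)] m_ball_pos[OF s(1), of y] by simp
qed

lemma relative_ball_finite: "m (ball x r \<inter> A) < \<infinity>"
  using m_mono[of "ball x r \<inter> A" "ball x r"] m_ball_finite[of x r] by (simp add: le_less_trans)

text \<open>Traces are averages over B Int Omega, whereas density refers to the whole ball; the
  larger denominator only decreases the ratio. At boundary points B Int Omega has positive measure,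
  so the first ratio is a proper quotient.\<close>

lemma density_zeroI:
  assumes x: "x \<in> frontier \<Omega>" and lim: "((\<lambda>r. m (ball x r \<inter> A) / m (ball x r \<inter> \<Omega>)) \<longlongrightarrow> 0) (at_right 0)"
  shows "density_zero A x"
  unfolding density_zero_def
proof (intro allI impI)
  fix \<epsilon> :: real assume \<epsilon>: "0 < \<epsilon>"
  have "eventually (\<lambda>r. m (ball x r \<inter> A) / m (ball x r \<inter> \<Omega>) < ennreal \<epsilon>) (at_right 0)"
    using order_tendstoD(2)[OF lim, of "ennreal \<epsilon>"] \<epsilon> by simp
  then obtain r0 where r0: "0 < r0" "\<forall>r>0. r < r0 \<longrightarrow> m (ball x r \<inter> A) / m (ball x r \<inter> \<Omega>) < ennreal \<epsilon>"
    by (auto simp: eventually_at_right[OF zero_less_one])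
  have "m (ball x r \<inter> A) \<le> ennreal \<epsilon> * m (ball x r)" if r: "0 < r" "r < r0" for r
  proof -
    have "m (ball x r \<inter> A) / m (ball x r \<inter> \<Omega>) < ennreal \<epsilon>" using r0 r by blast
    then have "m (ball x r \<inter> A) \<le> ennreal \<epsilon> * m (ball x r \<inter> \<Omega>)"
      using divide_less_ennreal relative_ball_pos[OF x r(1)] relative_ball_finite[of x r \<Omega>]
      by (simp add: less_imp_le)
    also have "\<dots> \<le> ennreal \<epsilon> * m (ball x r)" by (intro mult_left_mono m_mono) auto
    finally show ?thesis .
  qed
  then show "\<exists>r0>0. \<forall>r. 0 < r \<and> r < r0 \<longrightarrow> m (ball x r \<inter> A) \<le> ennreal \<epsilon> * m (ball x r)"
    using r0(1) by blast
qed

lemma perimeter_Omega_finite: "P \<Omega> UNIV < \<infinity>"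
proof (rule finite_perimeter_extension[OF cost open_Omega bounded_Omega order_refl Omega_sets])
  have "tv (indicator \<Omega>) \<Omega> = tv (\<lambda>_. 1) \<Omega>" by (rule tv_cong) simp
  then show "tv (indicator \<Omega>) \<Omega> < \<infinity>" using tv_const[OF open_Omega, of 1] by simp
qed

lemma perimeter_closure_compl:
  assumes "E \<subseteq> \<Omega>"
  shows "P E (- closure \<Omega>) = 0"
proof -
  have "tv (indicator E) (- closure \<Omega>) = tv (\<lambda>_. 0) (- closure \<Omega>)"
    using assms closure_subset[of \<Omega>] by (intro tv_cong) (auto simp: indicator_def)
  then show ?thesis by (simp add: tv_const TV_open open_Compl)
qed

lemma perimeter_density_zero_null:
  assumes E: "E \<in> sets M" "P E UNIV < \<infinity>" and Z: "Z \<subseteq> frontier \<Omega>" "\<And>x. x \<in> Z \<Longrightarrow> density_zero E x"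
  shows "P E Z = 0"
proof -
  have "P E (Z \<inter> UNIV) \<le> tv (indicator {}) UNIV"
    using Z(2) by (intro perimeter_density_zero[OF cost frontier_closed _ E Z(1) open_UNIV])
      (auto simp: density_zero_def)
  also have "\<dots> = 0"
    using tv_cong[of UNIV "indicator {}" "\<lambda>_. 0"] tv_const[of UNIV 0] by simp
  finally show ?thesis by simp
qed

lemma density_zero_off_bd:
  assumes x: "x \<in> frontier \<Omega>" "x \<notin> bd" "Limsup (at_right 0) (\<lambda>r. m (ball x r - \<Omega>) / m (ball x r)) > 0"
  shows "density_zero \<Omega> x"
  unfolding density_zero_def
proof (intro allI impI)
  fix \<epsilon> :: real assume \<epsilon>: "0 < \<epsilon>"
  have "Limsup (at_right 0) (\<lambda>r. m (ball x r \<inter> \<Omega>) / m (ball x r)) = 0"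
    using x by (auto simp: measure_theoretic_boundary_def)
  then have "eventually (\<lambda>r. m (ball x r \<inter> \<Omega>) / m (ball x r) < ennreal \<epsilon>) (at_right 0)"
    using \<epsilon> by (intro Limsup_lessD) simp
  then obtain r0 where r0: "0 < r0" "\<forall>r>0. r < r0 \<longrightarrow> m (ball x r \<inter> \<Omega>) / m (ball x r) < ennreal \<epsilon>"
    by (auto simp: eventually_at_right[OF zero_less_one])
  have "m (ball x r \<inter> \<Omega>) \<le> ennreal \<epsilon> * m (ball x r)" if r: "0 < r" "r < r0" for r
  proof -
    have "m (ball x r \<inter> \<Omega>) / m (ball x r) < ennreal \<epsilon>" using r0 r by blast
    then show ?thesis
      using divide_less_ennreal m_ball_pos[OF r(1), of x] m_ball_finite[of x r] by (simp add: less_imp_le)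
  qed
  then show "\<exists>r0>0. \<forall>r. 0 < r \<and> r < r0 \<longrightarrow> m (ball x r \<inter> \<Omega>) \<le> ennreal \<epsilon> * m (ball x r)"
    using r0(1) by blast
qed

text \<open>Outside the exceptional set of (i), a boundary point can miss \<open>bd\<close> only
  because Omega has density 0 there; then E has density 0 as well and no perimeter at such points.
  On the exceptional set the perimeter vanishes by codimension.\<close>

lemma perimeter_off_bd:
  assumes E: "E \<subseteq> \<Omega>" "E \<in> sets M" "P E UNIV < \<infinity>"
  shows "P E (frontier \<Omega> - bd) = 0"
proof -
  let ?N = "{x \<in> frontier \<Omega>. \<not> Limsup (at_right 0) (\<lambda>r. m (ball x r - \<Omega>) / m (ball x r)) > 0}"
  let ?Z = "{x \<in> frontier \<Omega>. density_zero E x}"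
  have "frontier \<Omega> - bd \<subseteq> ?N \<union> ?Z"
    using density_zero_off_bd density_zero_subset[OF _ E(1)] by blast
  then have "P E (frontier \<Omega> - bd) \<le> P E ?N + P E ?Z"
    using TV_mono TV_Un_le[OF ind_measurable[OF E(2)]] by (meson order_trans)
  also have "P E ?N = 0" by (rule perimeter_hausdorff_null[OF E(2,3) exterior])
  also have "P E ?Z = 0" by (rule perimeter_density_zero_null[OF E(2,3)]) auto
  finally show ?thesis by simp
qed

lemma trace_ratio:
  assumes E: "E \<subseteq> \<Omega>" "E \<in> sets M"
  shows "(\<integral>\<^sup>+y\<in>ball x r \<inter> \<Omega>. ennreal \<bar>indicator E y - t\<bar> \<partial>M)
    = ennreal \<bar>1 - t\<bar> * m (ball x r \<inter> E) + ennreal \<bar>t\<bar> * m (ball x r \<inter> (\<Omega> - E))"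
    and "m (ball x r \<inter> \<Omega>) = m (ball x r \<inter> E) + m (ball x r \<inter> (\<Omega> - E))"
proof -
  have s: "ball x r \<inter> E \<in> sets M" "ball x r \<inter> (\<Omega> - E) \<in> sets M"
    using E(2) Omega_sets sets_M_borel[of "ball x r"] by auto
  have "(\<integral>\<^sup>+y\<in>ball x r \<inter> \<Omega>. ennreal \<bar>indicator E y - t\<bar> \<partial>M)
      = (\<integral>\<^sup>+y. ennreal \<bar>1 - t\<bar> * indicator (ball x r \<inter> E) y + ennreal \<bar>t\<bar> * indicator (ball x r \<inter> (\<Omega> - E)) y \<partial>M)"
    using E(1) by (intro nn_integral_cong) (auto simp: indicator_def)
  also have "\<dots> = ennreal \<bar>1 - t\<bar> * m (ball x r \<inter> E) + ennreal \<bar>t\<bar> * m (ball x r \<inter> (\<Omega> - E))"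
    using s by (subst nn_integral_add) (auto simp: nn_integral_cmult_indicator emeasure_M)
  finally show "(\<integral>\<^sup>+y\<in>ball x r \<inter> \<Omega>. ennreal \<bar>indicator E y - t\<bar> \<partial>M)
    = ennreal \<bar>1 - t\<bar> * m (ball x r \<inter> E) + ennreal \<bar>t\<bar> * m (ball x r \<inter> (\<Omega> - E))" .
  have "ball x r \<inter> \<Omega> = (ball x r \<inter> E) \<union> (ball x r \<inter> (\<Omega> - E))" using E(1) by auto
  moreover have "emeasure M ((ball x r \<inter> E) \<union> (ball x r \<inter> (\<Omega> - E))) = emeasure M (ball x r \<inter> E) + emeasure M (ball x r \<inter> (\<Omega> - E))"
    by (rule plus_emeasure[symmetric, OF s]) auto
  ultimately show "m (ball x r \<inter> \<Omega>) = m (ball x r \<inter> E) + m (ball x r \<inter> (\<Omega> - E))"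
    using s emeasure_M[of "ball x r \<inter> \<Omega>"] by (metis emeasure_M sets.Un)
qed

text \<open>The average of |chi_E - t| is |1 - t| times the fraction of E plus |t| times the
  fraction of Omega - E. The fractions add up to 1, so the average stays above the smaller of |1 -
  t| and |t|, which must therefore be 0.\<close>

lemma is_trace_indicator_iff:
  assumes E: "E \<subseteq> \<Omega>" "E \<in> sets M" and x: "x \<in> frontier \<Omega>"
  shows "is_trace m \<Omega> (indicator E) x t \<longleftrightarrow>
    t = 0 \<and> ((\<lambda>r. m (ball x r \<inter> E) / m (ball x r \<inter> \<Omega>)) \<longlongrightarrow> 0) (at_right 0) \<or>
    t = 1 \<and> ((\<lambda>r. m (ball x r \<inter> (\<Omega> - E)) / m (ball x r \<inter> \<Omega>)) \<longlongrightarrow> 0) (at_right 0)"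
proof -
  let ?T = "\<lambda>r. m (ball x r \<inter> \<Omega>)" and ?a = "\<lambda>r. m (ball x r \<inter> E)" and ?b = "\<lambda>r. m (ball x r \<inter> (\<Omega> - E))"
  have tr: "is_trace m \<Omega> (indicator E) x t \<longleftrightarrow>
      ((\<lambda>r. (ennreal \<bar>1 - t\<bar> * ?a r + ennreal \<bar>t\<bar> * ?b r) / ?T r) \<longlongrightarrow> 0) (at_right 0)" for t
    by (simp add: is_trace_def trace_ratio[OF E])
  have only: "t = 0 \<or> t = 1" if lim: "((\<lambda>r. (ennreal \<bar>1 - t\<bar> * ?a r + ennreal \<bar>t\<bar> * ?b r) / ?T r) \<longlongrightarrow> 0) (at_right 0)"
  proof -
    define c where "c = min \<bar>1 - t\<bar> \<bar>t\<bar>"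
    have "ennreal c \<le> (ennreal \<bar>1 - t\<bar> * ?a r + ennreal \<bar>t\<bar> * ?b r) / ?T r" if r: "0 < r" for r
    proof -
      have T: "0 < ?T r" "?T r < \<infinity>" using relative_ball_pos[OF x r] relative_ball_finite by auto
      have "ennreal c * ?T r = ennreal c * ?a r + ennreal c * ?b r"
        by (simp add: trace_ratio(2)[OF E] distrib_left)
      also have "\<dots> \<le> ennreal \<bar>1 - t\<bar> * ?a r + ennreal \<bar>t\<bar> * ?b r"
        by (intro add_mono mult_right_mono ennreal_leI) (auto simp: c_def)
      finally have "ennreal c * ?T r / ?T r \<le> (ennreal \<bar>1 - t\<bar> * ?a r + ennreal \<bar>t\<bar> * ?b r) / ?T r"
        by (rule divide_right_mono_ennreal)
      then show ?thesis using T by (simp add: mult_divide_eq_ennreal)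
    qed
    then have "eventually (\<lambda>r. ennreal c \<le> (ennreal \<bar>1 - t\<bar> * ?a r + ennreal \<bar>t\<bar> * ?b r) / ?T r) (at_right 0)"
      by (auto simp: eventually_at_right[OF zero_less_one] intro!: exI[of _ 1])
    then have "ennreal c \<le> 0"
      by (intro tendsto_lowerbound[OF lim]) auto
    then show ?thesis by (auto simp: c_def min_def split: if_splits)
  qed
  have 0: "is_trace m \<Omega> (indicator E) x 0 \<longleftrightarrow> ((\<lambda>r. ?a r / ?T r) \<longlongrightarrow> 0) (at_right 0)"
    unfolding tr by simp
  have 1: "is_trace m \<Omega> (indicator E) x 1 \<longleftrightarrow> ((\<lambda>r. ?b r / ?T r) \<longlongrightarrow> 0) (at_right 0)"
    unfolding tr by simp
  show ?thesis using only[folded tr] 0 1 by blast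
qed

text \<open>Two different traces could only be 0 and 1; then both fractions would tend to 0,
  although their sum is 1.\<close>

lemma is_trace_unique:
  assumes E: "E \<subseteq> \<Omega>" "E \<in> sets M" and x: "x \<in> frontier \<Omega>"
    and t: "is_trace m \<Omega> (indicator E) x t" "is_trace m \<Omega> (indicator E) x t'"
  shows "t = t'"
proof (rule ccontr)
  assume "t \<noteq> t'"
  let ?T = "\<lambda>r. m (ball x r \<inter> \<Omega>)" and ?a = "\<lambda>r. m (ball x r \<inter> E)" and ?b = "\<lambda>r. m (ball x r \<inter> (\<Omega> - E))"
  have "((\<lambda>r. ?a r / ?T r) \<longlongrightarrow> 0) (at_right 0)" "((\<lambda>r. ?b r / ?T r) \<longlongrightarrow> 0) (at_right 0)"
    using t \<open>t \<noteq> t'\<close> is_trace_indicator_iff[OF E x] by auto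
  then have "((\<lambda>r. ?a r / ?T r + ?b r / ?T r) \<longlongrightarrow> 0 + 0) (at_right 0)" by (rule tendsto_add)
  then have lim: "((\<lambda>r. ?a r / ?T r + ?b r / ?T r) \<longlongrightarrow> 0) (at_right 0)" by simp
  have "?a r / ?T r + ?b r / ?T r = 1" if r: "0 < r" for r
    using relative_ball_pos[OF x r] relative_ball_finite[of x r \<Omega>]
    by (simp add: add_divide_distrib_ennreal[symmetric] trace_ratio(2)[OF E, symmetric])
  then have "eventually (\<lambda>r. 1 \<le> ?a r / ?T r + ?b r / ?T r) (at_right 0)"
    by (auto simp: eventually_at_right[OF zero_less_one] intro!: exI[of _ 1])
  then have "(1::ennreal) \<le> 0" by (intro tendsto_lowerbound[OF lim]) auto
  then show False by simp
qed

lemma trace_at_indicator: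
  assumes "E \<subseteq> \<Omega>" "E \<in> sets M" "x \<in> frontier \<Omega>" "is_trace m \<Omega> (indicator E) x t"
  shows "trace_at m \<Omega> (indicator E) x = t" "trace_at m \<Omega> (\<lambda>x. - indicator E x) x = - t"
proof -
  show "trace_at m \<Omega> (indicator E) x = t"
    unfolding trace_at_def using is_trace_unique[OF assms(1-3)] assms(4) by blast
  have "is_trace m \<Omega> (\<lambda>x. - indicator E x) x s \<longleftrightarrow> is_trace m \<Omega> (indicator E) x (- s)" for s
  proof -
    have "\<bar>- indicator E y - s\<bar> = \<bar>indicator E y - (- s)\<bar>" for y by (simp add: abs_minus_commute[of "- indicator E y"])
    then show ?thesis by (simp only: is_trace_def)
  qed
  then show "trace_at m \<Omega> (\<lambda>x. - indicator E x) x = - t"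
    unfolding trace_at_def using is_trace_unique[OF assms(1-3)] assms(4)
    by (intro the_equality) (auto, metis minus_minus)
qed

definition tr1 :: "'a set \<Rightarrow> 'a set" where
  "tr1 E = {x \<in> frontier \<Omega>. is_trace m \<Omega> (indicator E) x 1}"

definition tr0 :: "'a set \<Rightarrow> 'a set" where
  "tr0 E = {x \<in> frontier \<Omega>. is_trace m \<Omega> (indicator E) x 0}"

lemma tr1_compl: "E \<subseteq> \<Omega> \<Longrightarrow> E \<in> sets M \<Longrightarrow> tr1 (\<Omega> - E) = tr0 E"
  using is_trace_indicator_iff[of "\<Omega> - E"] is_trace_indicator_iff[of E] Omega_sets
  by (auto simp: tr1_def tr0_def double_diff)

lemma tr_density:
  assumes "E \<subseteq> \<Omega>" "E \<in> sets M"
  shows "x \<in> tr1 E \<Longrightarrow> density_zero (\<Omega> - E) x" "x \<in> tr0 E \<Longrightarrow> density_zero E x"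
  using is_trace_indicator_iff[OF assms] density_zeroI by (auto simp: tr1_def tr0_def)

text \<open>Bundles finite perimeter in Omega with the conclusion of (ii) for the indicator, so that
  the hypothesis about all BV functions need not be carried along.\<close>

definition has_traces :: "'a set \<Rightarrow> bool" where
  "has_traces E \<longleftrightarrow> E \<subseteq> \<Omega> \<and> E \<in> sets M \<and> tv (indicator E) \<Omega> < \<infinity> \<and>
     codim1_hausdorff m {x \<in> bd. \<not> (\<exists>t. is_trace m \<Omega> (indicator E) x t)} = 0"

lemma Limsup_density_zero:
  assumes "open U" "x \<in> U" "\<And>r. ball x r \<subseteq> U \<Longrightarrow> A r = {}"
  shows "\<not> Limsup (at_right 0) (\<lambda>r. m (A r) / m (ball x r)) > 0"
proof -
  obtain e where e: "0 < e" "ball x e \<subseteq> U" using assms(1,2) open_contains_ball by blast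
  have "eventually (\<lambda>r. r < e) (at_right (0::real))"
    using e(1) eventually_at_right[of 0 e] by auto
  then have "eventually (\<lambda>r. m (A r) / m (ball x r) \<le> 0) (at_right 0)"
  proof eventually_elim
    case (elim r)
    then have "ball x r \<subseteq> U" using e(2) subset_ball[of r e x] by auto
    then have "A r = {}" by (rule assms(3))
    then show ?case using oms by (simp add: outer_measure_space_def positive_def)
  qed
  then have "Limsup (at_right 0) (\<lambda>r. m (A r) / m (ball x r)) \<le> 0" by (rule Limsup_bounded)
  then show ?thesis by simp
qed

lemma bd_subset_frontier: "bd \<subseteq> frontier \<Omega>"
proof
  fix x assume x: "x \<in> bd"
  have "x \<notin> \<Omega>"
    using Limsup_density_zero[OF open_Omega, of x "\<lambda>r. ball x r - \<Omega>"] x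
    by (auto simp: measure_theoretic_boundary_def)
  moreover have "x \<in> closure \<Omega>"
  proof (rule ccontr)
    assume "x \<notin> closure \<Omega>"
    then have "\<not> Limsup (at_right 0) (\<lambda>r. m (ball x r \<inter> \<Omega>) / m (ball x r)) > 0"
    proof (intro Limsup_density_zero[of "- closure \<Omega>"])
      show "ball x r \<inter> \<Omega> = {}" if "ball x r \<subseteq> - closure \<Omega>" for r
        using that closure_subset[of \<Omega>] by blast
    qed (simp_all add: open_Compl)
    then show False using x by (simp add: measure_theoretic_boundary_def)
  qed
  ultimately show "x \<in> frontier \<Omega>" using open_Omega by (simp add: frontier_def interior_open)
qed

section \<open>The perimeter of a set and its trace on the boundary\<close>

lemma has_traces_null:
  assumes "has_traces E" "F \<subseteq> \<Omega>" "F \<in> sets M" "P F UNIV < \<infinity>"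
  shows "P F (frontier \<Omega> - (tr0 E \<union> tr1 E)) = 0"
proof -
  have E: "E \<subseteq> \<Omega>" "E \<in> sets M" using assms by (auto simp: has_traces_def)
  let ?N = "{x \<in> bd. \<not> (\<exists>t. is_trace m \<Omega> (indicator E) x t)}"
  have "frontier \<Omega> - (tr0 E \<union> tr1 E) \<subseteq> ?N \<union> (frontier \<Omega> - bd)"
    using is_trace_indicator_iff[OF E] by (auto simp: tr0_def tr1_def)
  then have "P F (frontier \<Omega> - (tr0 E \<union> tr1 E)) \<le> P F ?N + P F (frontier \<Omega> - bd)"
    using TV_mono TV_Un_le[OF ind_measurable[OF assms(3)]] by (meson order_trans)
  also have "P F ?N = 0" using assms by (intro perimeter_hausdorff_null) (auto simp: has_traces_def)
  also have "P F (frontier \<Omega> - bd) = 0" by (rule perimeter_off_bd[OF assms(2-4)])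
  finally show ?thesis by simp
qed

lemma has_traces_finite: "has_traces E \<Longrightarrow> P E UNIV < \<infinity>"
  by (intro finite_perimeter_extension[OF cost open_Omega bounded_Omega]) (auto simp: has_traces_def)

text \<open>At points of trace 1, E and Omega differ by Omega - E, which has density 0 there; so
  near these points Omega may be replaced by E.\<close>

lemma perimeter_trace_lower:
  assumes E: "has_traces E" and U: "open U"
  shows "P \<Omega> (tr1 E \<inter> U) \<le> tv (indicator E) U"
proof -
  have E': "E \<subseteq> \<Omega>" "E \<in> sets M" using E by (auto simp: has_traces_def)
  then have "(E - \<Omega>) \<union> (\<Omega> - E) = \<Omega> - E" by auto
  then show ?thesis
    using tr_density(1)[OF E']
    by (intro perimeter_density_zero[OF cost frontier_closed E'(2) Omega_sets perimeter_Omega_finite _ U])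
      (auto simp: tr1_def density_zero_def)
qed

text \<open>\<open>U\<close> splits into its part in Omega, the exterior, and the boundary points of
  trace 1, of trace 0 and without trace. E has no perimeter in the exterior, at trace 0, where its
  density is 0, or on the exceptional set.\<close>

lemma perimeter_trace_upper:
  assumes E: "has_traces E" and U: "open U"
  shows "tv (indicator E) U \<le> tv (indicator E) (U \<inter> \<Omega>) + P \<Omega> (tr1 E \<inter> U)"
proof -
  have E': "E \<subseteq> \<Omega>" "E \<in> sets M" using E by (auto simp: has_traces_def)
  note fin = has_traces_finite[OF E]
  note Un = TV_Un_le[OF ind_measurable[OF E'(2)]]
  let ?N = "frontier \<Omega> - (tr0 E \<union> tr1 E)"
  have "U \<subseteq> (U \<inter> \<Omega>) \<union> (tr1 E \<inter> U) \<union> (- closure \<Omega> \<union> (?N \<union> tr0 E))"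
    using open_Omega by (auto simp: frontier_def interior_open)
  then have "P E U \<le> P E ((U \<inter> \<Omega>) \<union> (tr1 E \<inter> U) \<union> (- closure \<Omega> \<union> (?N \<union> tr0 E)))" by (rule TV_mono)
  also have "\<dots> \<le> (P E (U \<inter> \<Omega>) + P E (tr1 E \<inter> U)) + (P E (- closure \<Omega>) + (P E ?N + P E (tr0 E)))"
    by (intro order_trans[OF Un] add_mono order_refl)
  also have "P E (- closure \<Omega>) = 0" by (rule perimeter_closure_compl[OF E'(1)])
  also have "P E ?N = 0" by (rule has_traces_null[OF E E' fin])
  also have "P E (tr0 E) = 0"
    using tr_density(2)[OF E'] by (intro perimeter_density_zero_null[OF E'(2) fin]) (auto simp: tr0_def)
  \<comment> \<open>The density comparison with the roles of E and Omega exchanged. It has an open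
    set on the right, so outer regularity of the perimeter of Omega is used to pass to the trace
    set.\<close>
  also have "P E (tr1 E \<inter> U) \<le> P \<Omega> (tr1 E \<inter> U)"
    unfolding TV_eq_INF[of "indicator \<Omega>" "tr1 E \<inter> U"]
  proof (rule INF_greatest)
    fix V assume "V \<in> {V. open V \<and> tr1 E \<inter> U \<subseteq> V}"
    then have V: "open V" "tr1 E \<inter> U \<subseteq> V" by auto
    have eq: "(\<Omega> - E) \<union> (E - \<Omega>) = \<Omega> - E" using E' by auto
    have "P E (tr1 E \<inter> U) \<le> P E (tr1 E \<inter> V)" using V by (intro TV_mono) auto
    also have "\<dots> \<le> tv (indicator \<Omega>) V"
      using tr_density(1)[OF E']
      by (intro perimeter_density_zero[OF cost frontier_closed Omega_sets E'(2) fin _ V(1)])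
        (auto simp: tr1_def density_zero_def eq)
    finally show "P E (tr1 E \<inter> U) \<le> tv (indicator \<Omega>) V" .
  qed
  finally show ?thesis using U open_Omega by (simp add: TV_open open_Int add_left_mono)
qed

lemma has_traces_compl:
  assumes "has_traces E"
  shows "has_traces (\<Omega> - E)" and "U \<subseteq> \<Omega> \<Longrightarrow> open U \<Longrightarrow> tv (indicator (\<Omega> - E)) U = tv (indicator E) U"
proof -
  have E: "E \<subseteq> \<Omega>" "E \<in> sets M" using assms by (auto simp: has_traces_def)
  show eq: "tv (indicator (\<Omega> - E)) U = tv (indicator E) U" if "U \<subseteq> \<Omega>" "open U" for U
  proof -
    have "tv (indicator (\<Omega> - E)) U = tv (\<lambda>x. 1 - indicator E x) U"
      using that by (intro tv_cong) (auto simp: indicator_def)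
    then show ?thesis using tv_reflect[OF that(2)] by simp
  qed
  have "{x \<in> bd. \<not> (\<exists>t. is_trace m \<Omega> (indicator (\<Omega> - E)) x t)} \<subseteq> {x \<in> bd. \<not> (\<exists>t. is_trace m \<Omega> (indicator E) x t)}"
    using is_trace_indicator_iff[OF E] is_trace_indicator_iff[of "\<Omega> - E"] E Omega_sets bd_subset_frontier
    by (auto simp: double_diff)
  moreover have "{x \<in> bd. \<not> (\<exists>t. is_trace m \<Omega> (indicator E) x t)} \<subseteq> {x \<in> bd. \<not> (\<exists>t. is_trace m \<Omega> (indicator (\<Omega> - E)) x t)}"
    using is_trace_indicator_iff[OF E] is_trace_indicator_iff[of "\<Omega> - E"] E Omega_sets bd_subset_frontier
    by (auto simp: double_diff)
  ultimately show "has_traces (\<Omega> - E)"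
    using assms eq[OF order_refl open_Omega] Omega_sets unfolding has_traces_def by auto
qed

text \<open>A ball is the increasing union of smaller concentric balls, and each of these stays
  inside the ball when the centre moves a little. Hence the function is lower
  semicontinuous.\<close>

lemma ball_measure_borel:
  assumes "A \<in> sets M"
  shows "(\<lambda>x. m (ball x r \<inter> A)) \<in> borel_measurable borel"
proof (rule borel_measurableI_greater)
  fix c
  have "open {x. c < m (ball x r \<inter> A)}"
    unfolding open_contains_ball
  proof safe
    fix x assume c: "c < m (ball x r \<inter> A)"
    define s where "s n = r - inverse (real (Suc n))" for n
    have "(\<Union>n. ball x (s n) \<inter> A) = ball x r \<inter> A"
    proof safe
      fix y assume "y \<in> ball x r" "y \<in> A"
      then obtain n where "inverse (real (Suc n)) < r - dist x y" using reals_Archimedean[of "r - dist x y"] by auto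
      then have "y \<in> ball x (s n) \<inter> A" using \<open>y \<in> A\<close> by (simp add: s_def)
      then show "y \<in> (\<Union>n. ball x (s n) \<inter> A)" by blast
    qed (auto simp: s_def intro: less_trans simp del: of_nat_Suc)
    moreover have inc: "incseq (\<lambda>n. ball x (s n) \<inter> A)"
      by (intro incseq_SucI Int_mono subset_ball order_refl) (auto simp: s_def le_imp_inverse_le)
    moreover have sm: "ball x (s n) \<inter> A \<in> sets M" for n using assms sets_M_borel[of "ball x (s n)"] by auto
    ultimately have "emeasure M (ball x r \<inter> A) = (SUP n. emeasure M (ball x (s n) \<inter> A))"
      using SUP_emeasure_incseq[OF image_subsetI[OF sm] inc] by simp
    moreover have "ball x r \<inter> A \<in> sets M" using assms sets_M_borel[of "ball x r"] by auto
    ultimately obtain n where n: "c < m (ball x (s n) \<inter> A)"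
      using c sm by (auto simp: emeasure_M less_SUP_iff)
    have "c < m (ball y r \<inter> A)" if y: "y \<in> ball x (inverse (real (Suc n)))" for y
    proof -
      have "ball x (s n) \<subseteq> ball y r"
      proof
        fix z assume "z \<in> ball x (s n)"
        then show "z \<in> ball y r" using y dist_triangle[of y z x] by (simp add: s_def dist_commute)
      qed
      then show ?thesis using n m_mono[of "ball x (s n) \<inter> A" "ball y r \<inter> A"] by (meson Int_mono less_le_trans order_refl)
    qed
    then show "\<exists>e>0. ball x e \<subseteq> {x. c < m (ball x r \<inter> A)}"
      by (intro exI[of _ "inverse (real (Suc n))"]) auto
  qed
  then show "{x \<in> space borel. c < m (ball x r \<inter> A)} \<in> sets borel" by simp
qed

lemma trace_set_borel:
  assumes E: "E \<subseteq> \<Omega>" "E \<in> sets M"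
  shows "\<exists>B\<in>sets borel. tr1 E \<subseteq> B \<and> tr0 E \<inter> B = {}"
proof -
  define \<rho> where "\<rho> k = inverse (real (Suc k))" for k
  define B where "B = (\<Union>n. \<Inter>k\<in>{n..}. {x. m (ball x (\<rho> k) \<inter> (\<Omega> - E)) < m (ball x (\<rho> k) \<inter> E)})"
  have meas: "{x. m (ball x (\<rho> k) \<inter> (\<Omega> - E)) < m (ball x (\<rho> k) \<inter> E)} \<in> sets borel" for k
    using borel_measurable_less[OF ball_measure_borel ball_measure_borel] E Omega_sets by simp
  have "B \<in> sets borel" unfolding B_def by (intro sets.countable_UN sets.countable_INT') (auto simp: meas)
  have lim\<rho>: "filterlim \<rho> (at_right 0) sequentially"
    unfolding \<rho>_def using LIMSEQ_inverse_real_of_nat by (auto simp: filterlim_at intro: always_eventually)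
  have half: "eventually (\<lambda>k. m (ball x (\<rho> k) \<inter> A) / m (ball x (\<rho> k) \<inter> \<Omega>) < 1/2) sequentially"
    if "((\<lambda>r. m (ball x r \<inter> A) / m (ball x r \<inter> \<Omega>)) \<longlongrightarrow> 0) (at_right 0)" for A x
    using order_tendstoD(2)[OF filterlim_compose[OF that lim\<rho>], of "1/2"] by (simp add: ennreal_zero_less_divide)
  have cmp: "m (ball x (\<rho> k) \<inter> A) < m (ball x (\<rho> k) \<inter> (\<Omega> - A))"
    if x: "x \<in> frontier \<Omega>" and A: "A \<subseteq> \<Omega>" "A \<in> sets M" and h: "m (ball x (\<rho> k) \<inter> A) / m (ball x (\<rho> k) \<inter> \<Omega>) < 1/2" for x k A
  proof (rule half_less_ennreal)
    have "0 < \<rho> k" by (simp add: \<rho>_def)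
    then have "m (ball x (\<rho> k) \<inter> \<Omega>) \<noteq> 0" using relative_ball_pos[OF x, of "\<rho> k"] by simp
    from iffD1[OF divide_less_ennreal[OF this] h] relative_ball_finite[of x "\<rho> k" \<Omega>]
    show "m (ball x (\<rho> k) \<inter> A) < 1/2 * (m (ball x (\<rho> k) \<inter> A) + m (ball x (\<rho> k) \<inter> (\<Omega> - A)))"
      by (simp add: trace_ratio(2)[OF A, symmetric])
  qed
  have "tr1 E \<subseteq> B"
  proof
    fix x assume "x \<in> tr1 E"
    then have x: "x \<in> frontier \<Omega>" and "((\<lambda>r. m (ball x r \<inter> (\<Omega> - E)) / m (ball x r \<inter> \<Omega>)) \<longlongrightarrow> 0) (at_right 0)"
      using is_trace_indicator_iff[OF E] by (auto simp: tr1_def)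
    from half[OF this(2)] obtain n where n: "\<forall>k\<ge>n. m (ball x (\<rho> k) \<inter> (\<Omega> - E)) / m (ball x (\<rho> k) \<inter> \<Omega>) < 1/2"
      by (auto simp: eventually_sequentially)
    have "\<forall>k\<ge>n. m (ball x (\<rho> k) \<inter> (\<Omega> - E)) < m (ball x (\<rho> k) \<inter> E)"
      using cmp[OF x, of "\<Omega> - E"] n E Omega_sets by (auto simp: double_diff)
    then show "x \<in> B" by (auto simp: B_def)
  qed
  moreover have "tr0 E \<inter> B = {}"
  proof -
    have False if xx: "x \<in> tr0 E" "x \<in> B" for x
    proof -
      have x: "x \<in> frontier \<Omega>" and l: "((\<lambda>r. m (ball x r \<inter> E) / m (ball x r \<inter> \<Omega>)) \<longlongrightarrow> 0) (at_right 0)"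
        using is_trace_indicator_iff[OF E] xx(1) by (auto simp: tr0_def)
      from half[OF l] obtain n where n: "\<forall>k\<ge>n. m (ball x (\<rho> k) \<inter> E) / m (ball x (\<rho> k) \<inter> \<Omega>) < 1/2"
        by (auto simp: eventually_sequentially)
      obtain n' where n': "\<forall>k\<ge>n'. m (ball x (\<rho> k) \<inter> (\<Omega> - E)) < m (ball x (\<rho> k) \<inter> E)"
        using xx(2) by (auto simp: B_def)
      have "m (ball x (\<rho> (max n n')) \<inter> E) < m (ball x (\<rho> (max n n')) \<inter> (\<Omega> - E))"
        using cmp[OF x E] n by auto
      then show False using n'[rule_format, of "max n n'"] by auto
    qed
    then show ?thesis by blast
  qed
  ultimately show ?thesis using \<open>B \<in> sets borel\<close> by blast
qed

text \<open>If the bound failed infinitely often, the corresponding members of the sequence would be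
  competitors in \<open>tv_lsc\<close> with variation at most c.\<close>

lemma tv_lsc_seq:
  assumes U: "open U" and u: "u \<in> borel_measurable M" "\<And>i. us i \<in> borel_measurable M"
    and lim: "(\<lambda>i. L1 U (us i) u) \<longlonglongrightarrow> 0" and c: "c < tv u U"
  shows "eventually (\<lambda>i. c < tv (us i) U) sequentially"
proof (rule ccontr)
  assume "\<not> eventually (\<lambda>i. c < tv (us i) U) sequentially"
  then have fr: "\<exists>\<^sub>F i in sequentially. tv (us i) U \<le> c" by (simp add: frequently_def not_le)
  have "tv u U \<le> c"
  proof (rule tv_lsc[OF U u(1)])
    fix \<epsilon> :: real assume "0 < \<epsilon>"
    then have "eventually (\<lambda>i. (L1 U (us i) u) < ennreal \<epsilon>) sequentially"
      using order_tendstoD(2)[OF lim] by simp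
    then have "eventually (\<lambda>i. tv (us i) U \<le> c \<longrightarrow> tv (us i) U \<le> c \<and> (L1 U (us i) u) \<le> ennreal \<epsilon>) sequentially"
      by eventually_elim (simp add: less_imp_le)
    from frequently_ex[OF frequently_rev_mp[OF fr this]]
    obtain i where i: "tv (us i) U \<le> c" "(L1 U (us i) u) \<le> ennreal \<epsilon>" by blast
    then have "tv (us i) U \<le> c + ennreal \<epsilon>" by (simp add: add_increasing2)
    then show "\<exists>v\<in>borel_measurable M. tv v U \<le> c + ennreal \<epsilon> \<and> (L1 U v u) \<le> ennreal \<epsilon>"
      using i(2) u(2) by blast
  qed
  then show False using c by simp
qed

text \<open>The variation measure is complete, as it comes from the Caratheodory construction. Without this,
  the Bochner integral of the trace could take the junk value 0.\<close>

lemma TVM_measurable_AE: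
  assumes u: "u \<in> borel_measurable M" and g: "(g :: 'a \<Rightarrow> real) \<in> borel_measurable (TVM u)"
    and ae: "AE x in TVM u. f x = g x"
  shows "f \<in> borel_measurable (TVM u)"
proof (rule measurableI)
  fix S :: "real set" assume S: "S \<in> sets borel"
  obtain N where N: "{x \<in> space (TVM u). f x \<noteq> g x} \<subseteq> N" "N \<in> null_sets (TVM u)"
    using AE_E[OF ae] by (metis null_setsI)
  have "TV u N = 0" using N(2) emeasure_TVM[OF u, of N] by (auto simp: null_sets_def)
  then have "TV u (f -` S \<inter> N) = 0" using TV_mono[of "f -` S \<inter> N" N u] by simp
  then have "f -` S \<inter> N \<in> sets (TVM u)" using TVM_null_sets[OF u] by (auto simp: null_sets_def)
  moreover have "g -` S \<inter> space (TVM u) - N \<in> sets (TVM u)"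
    using measurable_sets[OF g S] N(2) by (auto simp: null_sets_def)
  moreover have "f -` S \<inter> space (TVM u) = (g -` S \<inter> space (TVM u) - N) \<union> (f -` S \<inter> N)"
    using N(1) by (auto simp: space_TVM[OF u])
  ultimately show "f -` S \<inter> space (TVM u) \<in> sets (TVM u)" by simp
qed simp

end

text \<open>The thresholds are the midpoints of n equal subintervals of [-1,1]. If N of them lie
  below y, the average of the signs is 2 N / n - 1, and N is n (y + 1) / 2 rounded to an integer,
  hence off by at most 1/2.\<close>

lemma sign_layers:
  fixes y :: real
  assumes "-1 \<le> y" "y \<le> 1" "0 < n"
  shows "\<bar>y - (\<Sum>k<n. if -1 + (2 * real k + 1) / real n < y then 1 else -1) / real n\<bar> \<le> 1 / real n"
proof -
  \<comment> \<open>Shifted by 1/2 so that threshold k lies below y exactly when k < z; the count is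
    then a ceiling.\<close>
  define z where "z = real n * (y + 1) / 2 - 1/2"
  define N where "N = card {k\<in>{..<n}. -1 + (2 * real k + 1) / real n < y}"
  have z: "-1/2 \<le> z" "z \<le> real n - 1/2"
    using assms by (auto simp: z_def)
  let ?P = "\<lambda>k. -1 + (2 * real k + 1) / real n < y"
  have "?P k \<longleftrightarrow> real k < z" for k
  proof -
    have "?P k \<longleftrightarrow> (2 * real k + 1) / real n < y + 1" by linarith
    also have "\<dots> \<longleftrightarrow> 2 * real k + 1 < real n * (y + 1)" using assms(3) by (simp add: divide_less_eq mult.commute)
    also have "\<dots> \<longleftrightarrow> real k < z" by (simp add: z_def) linarith
    finally show ?thesis .
  qed
  moreover have "k < n" if "real k < z" for k using that z(2) by linarith
  ultimately have "{k\<in>{..<n}. ?P k} = {..<nat \<lceil>z\<rceil>}"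
    by (auto simp: zless_nat_eq_int_zless less_ceiling_iff)
  then have N: "N = nat \<lceil>z\<rceil>" by (simp add: N_def)
  have close: "\<bar>real N - (z + 1/2)\<bar> \<le> 1/2"
    unfolding N using z by linarith
  have "real N = (\<Sum>k<n. if ?P k then 1 else 0)"
    unfolding N_def by (simp add: sum.inter_filter[symmetric])
  then have "2 * real N - real n = (\<Sum>k<n. 2 * (if ?P k then 1 else 0) - 1)"
    by (simp add: sum_subtractf sum_distrib_left)
  also have "\<dots> = (\<Sum>k<n. if ?P k then 1 else -1)" by (intro sum.cong) auto
  finally have S: "(\<Sum>k<n. if ?P k then 1 else -1) = 2 * real N - real n" by (rule sym)
  have "y - (\<Sum>k<n. if ?P k then 1 else -1) / real n = 2 * (z + 1/2 - real N) / real n"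
    unfolding S using assms(3) by (simp add: z_def field_simps)
  then have "\<bar>y - (\<Sum>k<n. if ?P k then 1 else -1) / real n\<bar> = 2 * \<bar>real N - (z + 1/2)\<bar> / real n"
    by (simp only: abs_divide abs_mult abs_minus_commute[of "z + 1/2"] abs_numeral abs_of_nat)
  also have "\<dots> \<le> 1 / real n" using close assms(3) by (intro divide_right_mono) auto
  finally show ?thesis .
qed

section \<open>The perimeter measure of Omega\<close>

context boundary_setting
begin

abbreviation \<nu> :: "'a measure" where "\<nu> \<equiv> TVM (indicator \<Omega>)"

lemma ind_Omega: "(indicator \<Omega> :: 'a \<Rightarrow> real) \<in> borel_measurable M"
  by (rule ind_measurable[OF Omega_sets])

lemma space_nu [simp]: "space \<nu> = UNIV"
  by (rule space_TVM[OF ind_Omega])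

lemma emeasure_nu: "A \<in> sets \<nu> \<Longrightarrow> emeasure \<nu> A = P \<Omega> A"
  by (rule emeasure_TVM[OF ind_Omega])

lemma sets_nu_borel: "A \<in> sets borel \<Longrightarrow> A \<in> sets \<nu>"
  by (rule sets_TVM_borel[OF ind_Omega])

lemma finite_nu: "finite_measure \<nu>"
  using perimeter_Omega_finite sets.top[of \<nu>] by (intro finite_measureI) (simp add: emeasure_nu)

lemma P_eq_measure: "A \<in> sets \<nu> \<Longrightarrow> P \<Omega> A = ennreal (measure \<nu> A)"
  using finite_measure.emeasure_eq_measure[OF finite_nu, of A] by (simp add: emeasure_nu)

lemma perimeter_Omega_off_frontier: "P \<Omega> (- frontier \<Omega>) = 0"
proof -
  have "- frontier \<Omega> = \<Omega> \<union> - closure \<Omega>"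
    using open_Omega closure_subset[of \<Omega>] by (auto simp: frontier_def interior_open)
  then have "P \<Omega> (- frontier \<Omega>) \<le> P \<Omega> \<Omega> + P \<Omega> (- closure \<Omega>)"
    using TV_Un_le[OF ind_Omega] by simp
  moreover have "P \<Omega> \<Omega> = 0"
    using tv_cong[of \<Omega> "indicator \<Omega>" "\<lambda>_. 1"] tv_const[OF open_Omega, of 1] by (simp add: TV_open open_Omega)
  ultimately show ?thesis using perimeter_closure_compl[of \<Omega>] by simp
qed

text \<open>A Borel stand-in for the set of points of trace 1. By \<open>no_trace_null\<close> the
  choice matters only on a null set.\<close>

definition trace_set :: "'a set \<Rightarrow> 'a set" where
  "trace_set E = (SOME B. B \<in> sets borel \<and> tr1 E \<subseteq> B \<and> tr0 E \<inter> B = {})"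

lemma trace_set:
  assumes "has_traces E"
  shows "trace_set E \<in> sets borel" "tr1 E \<subseteq> trace_set E" "tr0 E \<inter> trace_set E = {}"
proof -
  have "\<exists>B. B \<in> sets borel \<and> tr1 E \<subseteq> B \<and> tr0 E \<inter> B = {}"
    using trace_set_borel[of E] assms unfolding has_traces_def by blast
  from someI_ex[OF this] show "trace_set E \<in> sets borel" "tr1 E \<subseteq> trace_set E" "tr0 E \<inter> trace_set E = {}"
    unfolding trace_set_def by auto
qed

lemma no_trace_null:
  assumes "has_traces E"
  shows "P \<Omega> (- (tr0 E \<union> tr1 E)) = 0"
proof -
  have "- (tr0 E \<union> tr1 E) \<subseteq> (frontier \<Omega> - (tr0 E \<union> tr1 E)) \<union> - frontier \<Omega>" by auto
  then have "P \<Omega> (- (tr0 E \<union> tr1 E)) \<le> P \<Omega> (frontier \<Omega> - (tr0 E \<union> tr1 E)) + P \<Omega> (- frontier \<Omega>)"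
    using TV_mono TV_Un_le[OF ind_Omega] by (meson order_trans)
  then show ?thesis
    using has_traces_null[OF assms order_refl Omega_sets perimeter_Omega_finite] perimeter_Omega_off_frontier by simp
qed

lemma trace_set_measure:
  assumes E: "has_traces E"
  shows "P \<Omega> (tr1 E \<inter> U) = P \<Omega> (U \<inter> trace_set E)" "P \<Omega> (tr0 E \<inter> U) = P \<Omega> (U - trace_set E)"
proof -
  note B = trace_set[OF E]
  have le: "P \<Omega> X \<le> P \<Omega> Y" if "X \<subseteq> Y \<union> - (tr0 E \<union> tr1 E)" for X Y
    using TV_mono[OF that, of "indicator \<Omega>"] TV_Un_le[OF ind_Omega, of Y "- (tr0 E \<union> tr1 E)"] no_trace_null[OF E]
    by simp
  show "P \<Omega> (tr1 E \<inter> U) = P \<Omega> (U \<inter> trace_set E)"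
    using B by (intro antisym le) auto
  show "P \<Omega> (tr0 E \<inter> U) = P \<Omega> (U - trace_set E)"
    using B by (intro antisym le) auto
qed

text \<open>Real values, meaningful for sets with \<open>has_traces\<close>, so that the final
  estimates with their subtractions are linear arithmetic. An infinite variation would be sent to
  0.\<close>

definition pr :: "'a set \<Rightarrow> 'a set \<Rightarrow> real" where "pr E U = enn2real (tv (indicator E) U)"

lemma tv_eq_pr:
  assumes "has_traces E" "open U"
  shows "tv (indicator E) U = ennreal (pr E U)"
proof -
  have "tv (indicator E) U \<le> P E UNIV" using assms TV_mono[of U UNIV] by (simp flip: TV_open)
  then have "tv (indicator E) U < top" using has_traces_finite[OF assms(1)] by (auto intro: le_less_trans)
  then show ?thesis by (simp add: pr_def)
qed

lemma pr_nonneg: "0 \<le> pr E U"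
  by (simp add: pr_def)

text \<open>The second pair is the first pair for Omega - E, whose points of trace 1 are the points
  of trace 0 of E and whose variation inside Omega is that of E.\<close>

lemma trace_ineqs:
  assumes E: "has_traces E" and U: "open U"
  shows "pr E U \<le> pr E (U \<inter> \<Omega>) + measure \<nu> (U \<inter> trace_set E)"
    and "measure \<nu> (U \<inter> trace_set E) \<le> pr E U"
    and "pr (\<Omega> - E) U \<le> pr E (U \<inter> \<Omega>) + measure \<nu> (U - trace_set E)"
    and "measure \<nu> (U - trace_set E) \<le> pr (\<Omega> - E) U"
proof -
  note E' = has_traces_compl(1)[OF E]
  have Es: "E \<subseteq> \<Omega>" "E \<in> sets M" using E by (auto simp: has_traces_def)
  have UO: "open (U \<inter> \<Omega>)" using U open_Omega by auto
  have s: "U \<inter> trace_set E \<in> sets \<nu>" "U - trace_set E \<in> sets \<nu>"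
    using trace_set(1)[OF E] U by (auto intro!: sets_nu_borel)
  show "pr E U \<le> pr E (U \<inter> \<Omega>) + measure \<nu> (U \<inter> trace_set E)"
    using perimeter_trace_upper[OF E U] pr_nonneg
    by (simp add: tv_eq_pr[OF E] U UO trace_set_measure[OF E] P_eq_measure[OF s(1)] flip: ennreal_plus)
  show "measure \<nu> (U \<inter> trace_set E) \<le> pr E U"
    using perimeter_trace_lower[OF E U] pr_nonneg
    by (simp add: tv_eq_pr[OF E] U trace_set_measure[OF E] P_eq_measure[OF s(1)])
  have "tv (indicator (\<Omega> - E)) (U \<inter> \<Omega>) = tv (indicator E) (U \<inter> \<Omega>)"
    by (rule has_traces_compl(2)[OF E _ UO]) simp
  then show "pr (\<Omega> - E) U \<le> pr E (U \<inter> \<Omega>) + measure \<nu> (U - trace_set E)"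
    using perimeter_trace_upper[OF E' U] pr_nonneg
    by (simp add: tv_eq_pr[OF E] tv_eq_pr[OF E' U] U UO tr1_compl[OF Es] trace_set_measure(2)[OF E] P_eq_measure[OF s(2)]
        flip: ennreal_plus)
  show "measure \<nu> (U - trace_set E) \<le> pr (\<Omega> - E) U"
    using perimeter_trace_lower[OF E' U] pr_nonneg
    by (simp add: tv_eq_pr[OF E' U] tr1_compl[OF Es] trace_set_measure(2)[OF E] P_eq_measure[OF s(2)])
qed

text \<open>The complement of an open neighbourhood of - A with small excess is closed and fills
  most of A. Intersecting it with the compact boundary, which carries the whole measure, makes it
  compact.\<close>

lemma nu_compact_approx:
  assumes A: "A \<in> sets \<nu>" and e: "0 < e"
  obtains K where "compact K" "K \<subseteq> A" "K \<subseteq> frontier \<Omega>" "measure \<nu> (A - K) \<le> e"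
proof -
  interpret nu: finite_measure \<nu> by (rule finite_nu)
  have cf: "compact (frontier \<Omega>)"
    by (intro compact_closed_bounded frontier_closed bounded_subset[OF bounded_closure[OF bounded_Omega]])
      (auto simp: frontier_def)
  have Ac: "- A \<in> sets \<nu>" using sets.compl_sets[OF A] by (simp add: Compl_eq_Diff_UNIV)
  have fin: "P \<Omega> (- A) < \<infinity>" by (simp add: P_eq_measure[OF Ac])
  obtain G where G: "open G" "- A \<subseteq> G" "tv (indicator \<Omega>) G \<le> P \<Omega> (- A) + ennreal e"
    by (rule TV_approx[OF fin e])
  have Gs: "G \<in> sets \<nu>" using G(1) by (intro sets_nu_borel) auto
  have "ennreal (measure \<nu> G) \<le> ennreal (measure \<nu> (- A) + e)"
    using G(3) e by (simp add: TV_open[OF G(1), symmetric] P_eq_measure[OF Gs] P_eq_measure[OF Ac] ennreal_plus)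
  then have Ge: "measure \<nu> G \<le> measure \<nu> (- A) + e" using e by (subst (asm) ennreal_le_iff) auto
  define K where "K = - G \<inter> frontier \<Omega>"
  have Kc: "compact K" unfolding K_def using G(1) cf by (intro closed_Int_compact) auto
  have Ks: "K \<in> sets \<nu>" using Kc by (intro sets_nu_borel borel_closed compact_imp_closed)
  have f0: "measure \<nu> (- frontier \<Omega>) = 0"
    using perimeter_Omega_off_frontier P_eq_measure[of "- frontier \<Omega>"] sets_nu_borel[of "- frontier \<Omega>"] by simp
  have fs: "- frontier \<Omega> \<in> sets \<nu>" by (intro sets_nu_borel) auto
  have "measure \<nu> (A - K) \<le> measure \<nu> ((G - - A) \<union> - frontier \<Omega>)"
    using Gs A fs by (intro nu.finite_measure_mono) (auto simp: K_def)
  also have "\<dots> \<le> measure \<nu> (G - - A) + measure \<nu> (- frontier \<Omega>)"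
    using Gs A fs by (intro measure_Un_le) auto
  also have "measure \<nu> (G - - A) = measure \<nu> G - measure \<nu> (- A)"
    using Gs Ac G(2) by (intro nu.finite_measure_Diff)
  finally have "measure \<nu> (A - K) \<le> e" using Ge f0 by simp
  moreover have "K \<subseteq> A" "K \<subseteq> frontier \<Omega>" using G(2) by (auto simp: K_def)
  ultimately show thesis using that Kc by blast
qed

lemma nu_open_approx:
  assumes K: "compact K" and e: "0 < e"
  obtains U where "open U" "K \<subseteq> U" "measure \<nu> (U - K) \<le> e"
proof -
  interpret nu: finite_measure \<nu> by (rule finite_nu)
  have Ks: "K \<in> sets \<nu>" using K by (intro sets_nu_borel borel_closed compact_imp_closed)
  have fin: "P \<Omega> K < \<infinity>" by (simp add: P_eq_measure[OF Ks])
  obtain U where U: "open U" "K \<subseteq> U" "tv (indicator \<Omega>) U \<le> P \<Omega> K + ennreal e"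
    by (rule TV_approx[OF fin e])
  have Us: "U \<in> sets \<nu>" using U(1) by (intro sets_nu_borel) auto
  have "ennreal (measure \<nu> U) \<le> ennreal (measure \<nu> K + e)"
    using U(3) e by (simp add: TV_open[OF U(1), symmetric] P_eq_measure[OF Us] P_eq_measure[OF Ks] ennreal_plus)
  then have "measure \<nu> U \<le> measure \<nu> K + e" using e by (subst (asm) ennreal_le_iff) auto
  moreover have "measure \<nu> (U - K) = measure \<nu> U - measure \<nu> K"
    using Us Ks U(2) by (intro nu.finite_measure_Diff)
  ultimately show thesis using that U by simp
qed

section \<open>Lower semicontinuity of the functional\<close>

lemma indicator_diff_integral:
  assumes "E \<subseteq> \<Omega>" "F \<subseteq> \<Omega>"
  shows "(L1 U (indicator E) (indicator F)) \<le> (L1 \<Omega> (indicator E) (indicator F))"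
    and "(L1 U (indicator (\<Omega> - E)) (indicator (\<Omega> - F))) \<le> (L1 \<Omega> (indicator E) (indicator F))"
  using assms by (auto intro!: nn_integral_mono simp: indicator_def)

lemma pr_lsc:
  assumes E: "has_traces E" "\<And>i. has_traces (Ei i)" and U: "open U" and e: "0 < e"
    and lim: "(\<lambda>i. L1 U (indicator (Ei i)) (indicator E)) \<longlonglongrightarrow> 0"
  shows "eventually (\<lambda>i. pr E U - e \<le> pr (Ei i) U) sequentially"
proof (cases "pr E U - e < 0")
  case True
  then have "pr E U - e \<le> pr (Ei i) U" for i using pr_nonneg[of "Ei i" U] by linarith
  then show ?thesis by simp
next
  case False
  have "ennreal (pr E U - e) < tv (indicator E) U"
    using False e by (simp add: tv_eq_pr[OF E(1) U] ennreal_less_iff)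
  then have "eventually (\<lambda>i. ennreal (pr E U - e) < tv (indicator (Ei i)) U) sequentially"
    using E by (intro tv_lsc_seq[OF U _ _ lim] ind_measurable) (auto simp: has_traces_def)
  then show ?thesis
    by eventually_elim (use False in \<open>simp add: tv_eq_pr[OF E(2) U] ennreal_less_iff\<close>)
qed

lemma sign_lsc:
  assumes E: "has_traces E" "\<And>i. has_traces (Ei i)"
    and lim: "(\<lambda>i. L1 \<Omega> (indicator (Ei i)) (indicator E)) \<longlonglongrightarrow> 0"
    and A: "A \<in> sets \<nu>" and e: "0 < e"
  shows "eventually (\<lambda>i. pr E \<Omega> + measure \<nu> (trace_set E \<inter> A) - measure \<nu> (trace_set E - A) - e
    \<le> pr (Ei i) \<Omega> + measure \<nu> (trace_set (Ei i) \<inter> A) - measure \<nu> (trace_set (Ei i) - A)) sequentially"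
proof -
  interpret nu: finite_measure \<nu> by (rule finite_nu)
  \<comment> \<open>Twelve errors d: one from exhausting Omega, three from lower semicontinuity, and
    four times two from exchanging A with \<open>U1\<close> and the complement of A with
    \<open>U2\<close>, for each of E and \<open>Ei i\<close>.\<close>
  define d where "d = e / 12"
  have d: "0 < d" "e = 12 * d" using e by (auto simp: d_def)
  have sub: "E \<subseteq> \<Omega>" "\<And>i. Ei i \<subseteq> \<Omega>" using E by (auto simp: has_traces_def)
  have limU: "(\<lambda>i. L1 U (indicator (Ei i)) (indicator E)) \<longlonglongrightarrow> 0" for U
    by (rule tendsto_0_squeeze_ennreal[OF lim]) (auto intro!: always_eventually indicator_diff_integral sub)
  have limU': "(\<lambda>i. L1 U (indicator (\<Omega> - Ei i)) (indicator (\<Omega> - E))) \<longlonglongrightarrow> 0" for U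
    by (rule tendsto_0_squeeze_ennreal[OF lim]) (auto intro!: always_eventually indicator_diff_integral(2) sub)
  obtain K1 where K1: "compact K1" "K1 \<subseteq> A" "K1 \<subseteq> frontier \<Omega>" "measure \<nu> (A - K1) \<le> d"
    by (rule nu_compact_approx[OF A d(1)])
  have Ac: "- A \<in> sets \<nu>" using sets.compl_sets[OF A] by (simp add: Compl_eq_Diff_UNIV)
  obtain K2 where K2: "compact K2" "K2 \<subseteq> - A" "K2 \<subseteq> frontier \<Omega>" "measure \<nu> (- A - K2) \<le> d"
    by (rule nu_compact_approx[OF Ac d(1)])
  obtain Q where Q: "exhaustion \<Omega> Q" using ex_exhaustion[OF open_Omega] by blast
  \<comment> \<open>If every member of the exhaustion missed an amount d of the perimeter, inner
    regularity would be contradicted.\<close>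
  have "\<exists>j. pr E \<Omega> - d \<le> pr E (Q j)"
  proof (rule ccontr)
    assume n: "\<not> (\<exists>j. pr E \<Omega> - d \<le> pr E (Q j))"
    then have lt: "pr E (Q j) < pr E \<Omega> - d" for j by (simp add: not_le)
    have "tv (indicator E) \<Omega> \<le> (SUP j. tv (indicator E) (Q j))"
      using E by (intro tv_inner_regular[OF open_Omega _ Q] ind_measurable) (auto simp: has_traces_def)
    also have "\<dots> \<le> ennreal (pr E \<Omega> - d)"
      using lt by (intro SUP_least) (simp add: tv_eq_pr[OF E(1) exhaustion_open[OF Q]] ennreal_leI less_imp_le)
    finally have "ennreal (pr E \<Omega>) \<le> ennreal (pr E \<Omega> - d)" by (simp add: tv_eq_pr[OF E(1) open_Omega])
    moreover have "0 \<le> pr E \<Omega> - d" using lt[of 0] pr_nonneg[of E "Q 0"] by linarith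
    ultimately show False using d(1) by (simp add: ennreal_le_iff)
  qed
  then obtain j where j: "pr E \<Omega> - d \<le> pr E (Q j)" by blast
  define W where "W = Q j"
  have W: "open W" "closure W \<subseteq> \<Omega>" "W \<subseteq> \<Omega>"
    using exhaustion_compactly_inside[OF Q, of j] compactly_inside_subset by (auto simp: W_def compactly_inside_def)
  have "K1 \<inter> K2 = {}" using K1(2) K2(2) by blast
  from t4_space[OF compact_imp_closed[OF K1(1)] compact_imp_closed[OF K2(1)] this]
  obtain V1 V2 where V: "open V1" "open V2" "K1 \<subseteq> V1" "K2 \<subseteq> V2" "V1 \<inter> V2 = {}" by blast
  obtain G1 where G1: "open G1" "K1 \<subseteq> G1" "measure \<nu> (G1 - K1) \<le> d" by (rule nu_open_approx[OF K1(1) d(1)])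
  obtain G2 where G2: "open G2" "K2 \<subseteq> G2" "measure \<nu> (G2 - K2) \<le> d" by (rule nu_open_approx[OF K2(1) d(1)])
  \<comment> \<open>\<open>K1\<close> and \<open>K2\<close> lie on the boundary of Omega, so
    removing the closure of W, which is contained in Omega, does not touch them and makes W disjoint
    from both neighbourhoods.\<close>
  define U1 where "U1 = V1 \<inter> G1 - closure W"
  define U2 where "U2 = V2 \<inter> G2 - closure W"
  have fr: "frontier \<Omega> \<inter> \<Omega> = {}" using open_Omega by (auto simp: frontier_def interior_open)
  have U: "open U1" "open U2" "K1 \<subseteq> U1" "K2 \<subseteq> U2" "U1 \<inter> U2 = {}" "W \<inter> U1 = {}" "W \<inter> U2 = {}"
    using V G1 G2 K1 K2 W fr closure_subset[of W] by (auto simp: U1_def U2_def)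
  have opn: "U1 \<in> sets \<nu>" "U2 \<in> sets \<nu>" "G1 \<in> sets \<nu>" "G2 \<in> sets \<nu>"
    using U(1,2) G1(1) G2(1) by (simp_all add: sets_nu_borel)
  have cls: "K1 \<in> sets \<nu>" "K2 \<in> sets \<nu>"
    using K1(1) K2(1) by (simp_all add: sets_nu_borel borel_closed compact_imp_closed)
  note Us = opn(1,2) cls opn(3,4)
  \<comment> \<open>A' and U' share K' and exceed it only by sets of measure at most d: A' - K'
    directly, U' - K' because U' lies in G'.\<close>
  have near: "\<bar>measure \<nu> (B \<inter> A') - measure \<nu> (B \<inter> U')\<bar> \<le> 2 * d"
    if "B \<in> sets \<nu>" "A' \<in> sets \<nu>" "U' \<in> sets \<nu>" "K' \<in> sets \<nu>" "G' \<in> sets \<nu>" "K' \<subseteq> A'" "K' \<subseteq> U'" "U' \<subseteq> G'"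
      "measure \<nu> (A' - K') \<le> d" "measure \<nu> (G' - K') \<le> d" for B A' U' K' G'
  proof -
    have "measure \<nu> (B \<inter> A') \<le> measure \<nu> ((B \<inter> U') \<union> (A' - K'))"
      using that by (intro nu.finite_measure_mono) auto
    also have "\<dots> \<le> measure \<nu> (B \<inter> U') + measure \<nu> (A' - K')"
      using that by (intro measure_Un_le) auto
    finally have 1: "measure \<nu> (B \<inter> A') \<le> measure \<nu> (B \<inter> U') + d" using that(9) by linarith
    have "measure \<nu> (B \<inter> U') \<le> measure \<nu> ((B \<inter> A') \<union> (G' - K'))"
      using that by (intro nu.finite_measure_mono) auto
    also have "\<dots> \<le> measure \<nu> (B \<inter> A') + measure \<nu> (G' - K')"
      using that by (intro measure_Un_le) auto
    finally have 2: "measure \<nu> (B \<inter> U') \<le> measure \<nu> (B \<inter> A') + d" using that(10) by linarith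
    show ?thesis using 1 2 d(1) by linarith
  qed
  have near1: "\<bar>measure \<nu> (B \<inter> A) - measure \<nu> (B \<inter> U1)\<bar> \<le> 2 * d" if "B \<in> sets \<nu>" for B
    by (rule near[OF that A Us(1,3,5) K1(2) U(3) _ K1(4) G1(3)]) (auto simp: U1_def)
  have near2: "\<bar>measure \<nu> (B - A) - measure \<nu> (B \<inter> U2)\<bar> \<le> 2 * d" if "B \<in> sets \<nu>" for B
    using near[OF that Ac Us(2,4,6) K2(2) U(4) _ K2(4) G2(3)] by (auto simp: U2_def Diff_eq)
  have ev1: "eventually (\<lambda>i. pr E W - d \<le> pr (Ei i) W) sequentially"
    by (rule pr_lsc[OF E W(1) d(1) limU])
  have ev2: "eventually (\<lambda>i. pr E U1 - d \<le> pr (Ei i) U1) sequentially"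
    by (rule pr_lsc[OF E U(1) d(1) limU])
  have ev3: "eventually (\<lambda>i. pr (\<Omega> - E) U2 - d \<le> pr (\<Omega> - Ei i) U2) sequentially"
    by (rule pr_lsc[OF has_traces_compl(1)[OF E(1)] has_traces_compl(1)[OF E(2)] U(2) d(1) limU'])
  show ?thesis using ev1 ev2 ev3
  proof eventually_elim
    case (elim i)
    let ?F = "Ei i" and ?B = "trace_set E" and ?C = "trace_set (Ei i)"
    have Bs: "?B \<in> sets \<nu>" "?C \<in> sets \<nu>" using trace_set(1) E by (auto intro: sets_nu_borel)
    have o: "open (U1 \<inter> \<Omega>)" "open (U2 \<inter> \<Omega>)" using U open_Omega by auto
    have "tv (indicator ?F) W + (tv (indicator ?F) (U1 \<inter> \<Omega>) + tv (indicator ?F) (U2 \<inter> \<Omega>))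
        \<le> tv (indicator ?F) W + tv (indicator ?F) ((U1 \<inter> \<Omega>) \<union> (U2 \<inter> \<Omega>))"
      using U o by (intro add_left_mono tv_superadditive) auto
    also have "\<dots> \<le> tv (indicator ?F) (W \<union> ((U1 \<inter> \<Omega>) \<union> (U2 \<inter> \<Omega>)))"
      using U o W by (intro tv_superadditive) auto
    also have "\<dots> \<le> tv (indicator ?F) \<Omega>"
      using W o open_Omega by (intro tv_subset) auto
    finally have super: "pr ?F W + (pr ?F (U1 \<inter> \<Omega>) + pr ?F (U2 \<inter> \<Omega>)) \<le> pr ?F \<Omega>"
      using pr_nonneg by (simp add: tv_eq_pr[OF E(2)] W(1) o open_Omega flip: ennreal_plus)
    \<comment> \<open>The trace inequalities for the complements involve U2 minus a trace set. After
      this rewriting the measure of U2 occurs for E and for \<open>Ei i\<close> alike and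
      cancels.\<close>
    have split: "measure \<nu> (U2 - B) = measure \<nu> U2 - measure \<nu> (B \<inter> U2)" if "B \<in> sets \<nu>" for B
      using nu.finite_measure_Diff'[OF Us(2) that] by (simp add: Int_commute)
    show ?case
      using super elim j[folded W_def] near1[OF Bs(1)] near1[OF Bs(2)] near2[OF Bs(1)] near2[OF Bs(2)]
        trace_ineqs(1)[OF E(2) U(1), of i] trace_ineqs(2)[OF E(1) U(1)]
        trace_ineqs(3)[OF E(2) U(2), of i] trace_ineqs(4)[OF E(1) U(2)] split[OF Bs(1)] split[OF Bs(2)] d(2)
      by (simp only: Int_commute[of U1])
  qed
qed

text \<open>\<open>sign_layers\<close> applied to the values of \<open>\<phi>\<close> and integrated
  over B: the sign functions of the superlevel sets \<open>A k\<close> average to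
  \<open>\<phi>\<close> with uniform error 1/n.\<close>

lemma layer_integral:
  assumes \<phi>: "\<phi> \<in> borel_measurable \<nu>" "AE x in \<nu>. -1 \<le> \<phi> x \<and> \<phi> x \<le> 1" and B: "B \<in> sets \<nu>" and n: "0 < n"
  defines "A \<equiv> \<lambda>k. {x. -1 + (2 * real k + 1) / real n < \<phi> x}"
  shows "\<bar>(\<integral>x. \<phi> x * indicator B x \<partial>\<nu>) - (\<Sum>k<n. measure \<nu> (B \<inter> A k) - measure \<nu> (B - A k)) / real n\<bar>
    \<le> measure \<nu> UNIV / real n"
    and "A k \<in> sets \<nu>" and "\<bar>\<integral>x. \<phi> x * indicator B x \<partial>\<nu>\<bar> \<le> measure \<nu> UNIV"
proof -
  interpret nu: finite_measure \<nu> by (rule finite_nu)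
  have As: "A k \<in> sets \<nu>" for k
    using borel_measurable_less[OF borel_measurable_const \<phi>(1)] by (simp add: A_def)
  then show "A k \<in> sets \<nu>" .
  have int\<phi>: "integrable \<nu> (\<lambda>x. \<phi> x * indicator B x)"
  proof (rule nu.integrable_const_bound[where B = 1])
    show "AE x in \<nu>. norm (\<phi> x * indicator B x) \<le> 1"
      using \<phi>(2) by eventually_elim (auto simp: indicator_def)
    show "(\<lambda>x. \<phi> x * indicator B x) \<in> borel_measurable \<nu>" using \<phi>(1) B by (intro borel_measurable_times) auto
  qed
  have inti: "integrable \<nu> (indicator X :: 'a \<Rightarrow> real)" if "X \<in> sets \<nu>" for X
    using that by (intro integrable_real_indicator) (auto simp: nu.emeasure_eq_measure)
  define s where "s x = (\<Sum>k<n. indicator (B \<inter> A k) x - indicator (B - A k) x) / real n" for x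
  have sets: "B \<inter> A k \<in> sets \<nu>" "B - A k \<in> sets \<nu>" for k using B As by auto
  have ints: "integrable \<nu> s"
    unfolding s_def using sets by (intro integrable_divide Bochner_Integration.integrable_sum Bochner_Integration.integrable_diff inti)
  have "(\<integral>x. s x \<partial>\<nu>) = (\<Sum>k<n. measure \<nu> (B \<inter> A k) - measure \<nu> (B - A k)) / real n"
    unfolding s_def using sets
    by (simp add: Bochner_Integration.integral_sum Bochner_Integration.integral_diff inti)
  then have "(\<integral>x. \<phi> x * indicator B x \<partial>\<nu>) - (\<Sum>k<n. measure \<nu> (B \<inter> A k) - measure \<nu> (B - A k)) / real n
      = (\<integral>x. \<phi> x * indicator B x - s x \<partial>\<nu>)"
    using int\<phi> ints by (simp add: Bochner_Integration.integral_diff)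
  also have "\<bar>\<dots>\<bar> \<le> (\<integral>x. \<bar>\<phi> x * indicator B x - s x\<bar> \<partial>\<nu>)"
    by (rule integral_abs_bound)
  also have "\<dots> \<le> (\<integral>x. 1 / real n \<partial>\<nu>)"
  proof (rule integral_mono_AE)
    show "integrable \<nu> (\<lambda>x. \<bar>\<phi> x * indicator B x - s x\<bar>)"
      using int\<phi> ints by (intro integrable_abs Bochner_Integration.integrable_diff)
    show "AE x in \<nu>. \<bar>\<phi> x * indicator B x - s x\<bar> \<le> 1 / real n"
      using \<phi>(2)
    proof eventually_elim
      case (elim x)
      show ?case
      proof (cases "x \<in> B")
        case True
        then have "s x = (\<Sum>k<n. if -1 + (2 * real k + 1) / real n < \<phi> x then 1 else -1) / real n"
          by (auto simp: s_def A_def indicator_def intro!: sum.cong arg_cong[where f = "\<lambda>a. a / real n"])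
        then show ?thesis using sign_layers[of "\<phi> x" n] elim n True by simp
      qed (simp add: s_def)
    qed
  qed simp
  also have "\<dots> = measure \<nu> UNIV / real n" by simp
  finally show "\<bar>(\<integral>x. \<phi> x * indicator B x \<partial>\<nu>) - (\<Sum>k<n. measure \<nu> (B \<inter> A k) - measure \<nu> (B - A k)) / real n\<bar>
    \<le> measure \<nu> UNIV / real n" .
  have "\<bar>\<integral>x. \<phi> x * indicator B x \<partial>\<nu>\<bar> \<le> (\<integral>x. \<bar>\<phi> x * indicator B x\<bar> \<partial>\<nu>)"
    by (rule integral_abs_bound)
  also have "\<dots> \<le> (\<integral>x. 1 \<partial>\<nu>)"
  proof (rule integral_mono_AE)
    show "AE x in \<nu>. \<bar>\<phi> x * indicator B x\<bar> \<le> 1"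
      using \<phi>(2) by eventually_elim (auto simp: indicator_def)
  qed (use int\<phi> in auto)
  finally show "\<bar>\<integral>x. \<phi> x * indicator B x \<partial>\<nu>\<bar> \<le> measure \<nu> UNIV" by simp
qed

text \<open>With \<open>\<phi>\<close> equal to f on \<open>bd\<close> and 0 elsewhere this is the
  functional at the indicator of E, with the trace replaced by the indicator of the Borel set
  \<open>trace_set E\<close>.\<close>

definition val :: "('a \<Rightarrow> real) \<Rightarrow> 'a set \<Rightarrow> real" where
  "val \<phi> E = pr E \<Omega> + (\<integral>x. \<phi> x * indicator (trace_set E) x \<partial>\<nu>)"

text \<open>The inequalities of \<open>sign_lsc\<close> for the n superlevel sets are averaged; the
  perimeter term is the same in each of them, so it survives with factor 1.\<close>

lemma val_lsc:
  assumes E: "has_traces E" "\<And>i. has_traces (Ei i)"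
    and lim: "(\<lambda>i. L1 \<Omega> (indicator (Ei i)) (indicator E)) \<longlonglongrightarrow> 0"
    and \<phi>: "\<phi> \<in> borel_measurable \<nu>" "AE x in \<nu>. -1 \<le> \<phi> x \<and> \<phi> x \<le> 1" and e: "0 < e"
  shows "eventually (\<lambda>i. val \<phi> E - e \<le> val \<phi> (Ei i)) sequentially"
proof -
  define p where "p = measure \<nu> UNIV"
  have p: "0 \<le> p" by (simp add: p_def)
  \<comment> \<open>Large enough that p/n \<le> e/4: replacing the two integrals by layers costs e/4
    each, and the layers themselves use e/2.\<close>
  obtain n :: nat where n: "4 * p / e < real n" using reals_Archimedean2 by blast
  have "0 \<le> 4 * p / e" using p e by simp
  then have n0: "0 < n" using n by (cases n) auto
  have pn: "p / real n \<le> e / 4" using n n0 e by (simp add: field_simps)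
  define A where "A k = {x. -1 + (2 * real k + 1) / real n < \<phi> x}" for k
  let ?D = "\<lambda>F k. measure \<nu> (trace_set F \<inter> A k) - measure \<nu> (trace_set F - A k)"
  have Bs: "trace_set F \<in> sets \<nu>" if "has_traces F" for F using trace_set(1)[OF that] by (rule sets_nu_borel)
  have lay: "\<bar>(\<integral>x. \<phi> x * indicator (trace_set F) x \<partial>\<nu>) - (\<Sum>k<n. ?D F k) / real n\<bar> \<le> e / 4" if "has_traces F" for F
    using layer_integral(1)[OF \<phi> Bs[OF that] n0] pn unfolding A_def p_def by linarith
  have "eventually (\<lambda>i. pr E \<Omega> + ?D E k - e / 2 \<le> pr (Ei i) \<Omega> + ?D (Ei i) k) sequentially" for k
    using sign_lsc[OF E lim layer_integral(2)[OF \<phi> Bs[OF E(1)] n0, of k] half_gt_zero[OF e]]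
    unfolding A_def by eventually_elim linarith
  then have "eventually (\<lambda>i. \<forall>k\<in>{..<n}. pr E \<Omega> + ?D E k - e / 2 \<le> pr (Ei i) \<Omega> + ?D (Ei i) k) sequentially"
    by (intro eventually_ball_finite) auto
  then show ?thesis
  proof eventually_elim
    case (elim i)
    have "(\<Sum>k<n. pr E \<Omega> + ?D E k - e / 2) \<le> (\<Sum>k<n. pr (Ei i) \<Omega> + ?D (Ei i) k)"
      using elim by (intro sum_mono) auto
    then have "real n * (pr E \<Omega> - e / 2) + (\<Sum>k<n. ?D E k) \<le> real n * pr (Ei i) \<Omega> + (\<Sum>k<n. ?D (Ei i) k)"
      by (simp add: sum.distrib sum_subtractf algebra_simps)
    then have "(real n * (pr E \<Omega> - e / 2) + (\<Sum>k<n. ?D E k)) / real n \<le> (real n * pr (Ei i) \<Omega> + (\<Sum>k<n. ?D (Ei i) k)) / real n"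
      by (intro divide_right_mono) auto
    then have "pr E \<Omega> - e / 2 + (\<Sum>k<n. ?D E k) / real n \<le> pr (Ei i) \<Omega> + (\<Sum>k<n. ?D (Ei i) k) / real n"
      using n0 by (simp add: add_divide_distrib)
    then show ?case using lay[OF E(1)] lay[OF E(2), of i] unfolding val_def by linarith
  qed
qed

lemma val_lower:
  assumes "has_traces F" "\<phi> \<in> borel_measurable \<nu>" "AE x in \<nu>. -1 \<le> \<phi> x \<and> \<phi> x \<le> 1"
  shows "pr F \<Omega> - measure \<nu> UNIV \<le> val \<phi> F"
  using layer_integral(3)[OF assms(2,3) sets_nu_borel[OF trace_set(1)[OF assms(1)]] zero_less_one]
  by (simp add: val_def)

section \<open>Identification of the functional and conclusion\<close>

lemma perimeter_measure_eq: "perimeter_measure m \<Omega> = \<nu>"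
proof -
  have "perimeter m \<Omega> = TV (indicator \<Omega>)" by (simp add: fun_eq_iff perimeter_def)
  then show ?thesis by (simp add: perimeter_measure_def)
qed

lemma functional_I_eq_val:
  assumes F: "has_traces F" and f: "(\<lambda>x. indicator bd x * f x) \<in> borel_measurable \<nu>"
  shows "functional_I m \<Omega> f (indicator F) = ereal (val (\<lambda>x. indicator bd x * f x) F)"
    and "functional_I m \<Omega> f (\<lambda>x. - indicator F x) = ereal (val (\<lambda>x. - (indicator bd x * f x)) F)"
proof -
  have Fs: "F \<subseteq> \<Omega>" "F \<in> sets M" using F by (auto simp: has_traces_def)
  let ?B = "trace_set F" and ?\<phi> = "\<lambda>x. indicator bd x * f x"
  have Bs: "?B \<in> sets \<nu>" using trace_set(1)[OF F] by (rule sets_nu_borel)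
  have ae: "AE x in \<nu>. trace_at m \<Omega> (indicator F) x = indicator ?B x \<and> trace_at m \<Omega> (\<lambda>x. - indicator F x) x = - indicator ?B x"
  proof (rule AE_I')
    show "- (tr0 F \<union> tr1 F) \<in> null_sets \<nu>" by (rule TVM_null_sets[OF ind_Omega no_trace_null[OF F]])
    show "{x \<in> space \<nu>. \<not> (trace_at m \<Omega> (indicator F) x = indicator ?B x \<and> trace_at m \<Omega> (\<lambda>x. - indicator F x) x = - indicator ?B x)}
        \<subseteq> - (tr0 F \<union> tr1 F)"
      using trace_at_indicator[OF Fs] trace_set(2,3)[OF F] by (fastforce simp: tr0_def tr1_def indicator_def)
  qed
  have m1: "(\<lambda>x. ?\<phi> x * indicator ?B x) \<in> borel_measurable \<nu>"
    by (rule borel_measurable_times[OF f borel_measurable_indicator[OF Bs]])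
  have m2: "(\<lambda>x. - ?\<phi> x * indicator ?B x) \<in> borel_measurable \<nu>"
    by (rule borel_measurable_times[OF borel_measurable_uminus[OF f] borel_measurable_indicator[OF Bs]])
  \<comment> \<open>The congruence rule asks for measurability of both integrands. For the one that
    contains the trace, known only almost everywhere, it comes from completeness of the
    measure.\<close>
  have int: "(LINT x:bd|\<nu>. g x * f x) = (\<integral>x. h x \<partial>\<nu>)"
    if h: "h \<in> borel_measurable \<nu>" and eq: "AE x in \<nu>. indicator bd x *\<^sub>R (g x * f x) = h x" for g h
    unfolding set_lebesgue_integral_def
    by (rule integral_cong_AE[OF TVM_measurable_AE[OF ind_Omega h eq] h eq])
  have "(LINT x:bd|\<nu>. trace_at m \<Omega> (indicator F) x * f x) = (\<integral>x. ?\<phi> x * indicator ?B x \<partial>\<nu>)"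
  proof (rule int[OF m1])
    show "AE x in \<nu>. indicator bd x *\<^sub>R (trace_at m \<Omega> (indicator F) x * f x) = ?\<phi> x * indicator ?B x"
      using ae by eventually_elim simp
  qed
  then show "functional_I m \<Omega> f (indicator F) = ereal (val ?\<phi> F)"
    using pr_nonneg by (simp add: functional_I_def perimeter_measure_eq TV_open open_Omega tv_eq_pr[OF F open_Omega] val_def
        enn2ereal_ennreal)
  have "(LINT x:bd|\<nu>. trace_at m \<Omega> (\<lambda>x. - indicator F x) x * f x) = (\<integral>x. - ?\<phi> x * indicator ?B x \<partial>\<nu>)"
  proof (rule int[OF m2])
    show "AE x in \<nu>. indicator bd x *\<^sub>R (trace_at m \<Omega> (\<lambda>x. - indicator F x) x * f x) = - ?\<phi> x * indicator ?B x"
      using ae by eventually_elim simp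
  qed
  moreover have "tv (\<lambda>x. - indicator F x) \<Omega> = tv (indicator F) \<Omega>"
    using tv_reflect[OF open_Omega, of 0 "indicator F"] by simp
  ultimately show "functional_I m \<Omega> f (\<lambda>x. - indicator F x) = ereal (val (\<lambda>x. - ?\<phi> x) F)"
    using pr_nonneg by (simp add: functional_I_def perimeter_measure_eq TV_open open_Omega tv_eq_pr[OF F open_Omega] val_def
        enn2ereal_ennreal)
qed

text \<open>If E has infinite perimeter, the limit value is infinite: lower semicontinuity makes the
  perimeters of the sequence exceed every bound, while the boundary term never falls below minus the
  total measure.\<close>

lemma val_liminf:
  assumes Ei: "\<And>i. has_traces (Ei i)" and E: "E \<subseteq> \<Omega>" "E \<in> sets M" "tv (indicator E) \<Omega> < \<infinity> \<Longrightarrow> has_traces E"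
    and lim: "(\<lambda>i. L1 \<Omega> (indicator (Ei i)) (indicator E)) \<longlonglongrightarrow> 0"
    and \<phi>: "\<phi> \<in> borel_measurable \<nu>" "AE x in \<nu>. -1 \<le> \<phi> x \<and> \<phi> x \<le> 1"
  shows "(if tv (indicator E) \<Omega> < \<infinity> then ereal (val \<phi> E) else \<infinity>) \<le> liminf (\<lambda>i. ereal (val \<phi> (Ei i)))"
  unfolding le_Liminf_iff
proof (intro allI impI)
  fix y :: ereal
  assume y: "y < (if tv (indicator E) \<Omega> < \<infinity> then ereal (val \<phi> E) else \<infinity>)"
  show "eventually (\<lambda>i. y < ereal (val \<phi> (Ei i))) sequentially"
  proof (cases y)
    case (real c)
    show ?thesis
    proof (cases "tv (indicator E) \<Omega> < \<infinity>")
      case True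
      then have "0 < (val \<phi> E - c) / 2" using y real by simp
      from val_lsc[OF E(3)[OF True] Ei lim \<phi> this] show ?thesis
      proof eventually_elim
        case (elim i)
        then have "c < val \<phi> (Ei i)" using \<open>0 < (val \<phi> E - c) / 2\<close> by (simp add: field_simps)
        then show ?case by (simp add: real)
      qed
    next
      case False
      \<comment> \<open>The total measure is added to absorb the worst possible boundary term in
        \<open>val_lower\<close>.\<close>
      define a where "a = \<bar>c\<bar> + measure \<nu> UNIV"
      have "ennreal a < tv (indicator E) \<Omega>" using False by (simp add: not_less top_unique)
      then have "eventually (\<lambda>i. ennreal a < tv (indicator (Ei i)) \<Omega>) sequentially"
        using E(2) Ei by (intro tv_lsc_seq[OF open_Omega _ _ lim] ind_measurable) (auto simp: has_traces_def)
      then show ?thesis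
      proof eventually_elim
        case (elim i)
        have "0 \<le> a" by (simp add: a_def)
        then have "a < pr (Ei i) \<Omega>" using elim by (simp add: tv_eq_pr[OF Ei open_Omega] ennreal_less_iff)
        then show ?case using val_lower[OF Ei \<phi>, of i] by (simp add: real a_def)
      qed
    qed
  qed (use y in auto)
qed

end

theorem lemma4p10:
  fixes m :: "'a::complete_space set \<Rightarrow> ennreal"
    and \<Omega> :: "'a set"
    and f :: "'a \<Rightarrow> real"
    and E :: "'a set"
    and Ei :: "nat \<Rightarrow> 'a set"
  assumes two_points: "\<exists>x y :: 'a. x \<noteq> y"
    and outer: "borel_regular_outer_measure m"
    and doubling: "doubling m"
    and poincare: "poincare_1_1 m"
    and Omega: "\<Omega> \<noteq> {}" "bounded \<Omega>" "open \<Omega>"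
    and cond_i: "codim1_hausdorff m
          {x \<in> frontier \<Omega>. \<not> Limsup (at_right 0) (\<lambda>r. m (ball x r - \<Omega>) / m (ball x r)) > 0} = 0"
    and cond_ii: "\<And>u. BV_on m \<Omega> u \<Longrightarrow>
          codim1_hausdorff m
            {x \<in> measure_theoretic_boundary m \<Omega>. \<not> (\<exists>t. is_trace m \<Omega> u x t)} = 0"
    and cond_iii: "\<exists>C\<ge>1::real. \<forall>x\<in>frontier \<Omega>. \<forall>r. 0 < r \<and> r \<le> diameter \<Omega> \<longrightarrow>
          ennreal (1 / C) * (m (ball x r) / ennreal r) \<le> codim1_hausdorff m (ball x r \<inter> frontier \<Omega>) \<and>
          codim1_hausdorff m (ball x r \<inter> frontier \<Omega>) \<le> ennreal C * (m (ball x r) / ennreal r)"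
    and f_int: "set_integrable (perimeter_measure m \<Omega>) (measure_theoretic_boundary m \<Omega>) f"
    and f_bound: "AE x in perimeter_measure m \<Omega>.
          x \<in> measure_theoretic_boundary m \<Omega> \<longrightarrow> -1 \<le> f x \<and> f x \<le> 1"
    and f_mean: "(LINT x:measure_theoretic_boundary m \<Omega>|perimeter_measure m \<Omega>. f x) = 0"
    and E_sets: "E \<subseteq> \<Omega>" "E \<in> sets (caratheodory_measure m)"
    and Ei_sets: "\<And>i. Ei i \<subseteq> \<Omega>" "\<And>i. Ei i \<in> sets (caratheodory_measure m)"
    and Ei_perimeter: "\<And>i. perimeter m (Ei i) \<Omega> < \<infinity>"
    and Ei_conv: "(\<lambda>i. \<integral>\<^sup>+x\<in>\<Omega>. ennreal \<bar>indicator (Ei i) x - indicator E x\<bar> \<partial>caratheodory_measure m)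
          \<longlonglongrightarrow> 0"
  shows "functional_I m \<Omega> f (indicator E) \<le> liminf (\<lambda>i. functional_I m \<Omega> f (indicator (Ei i))) \<and>
         functional_I m \<Omega> f (\<lambda>x. - indicator E x)
           \<le> liminf (\<lambda>i. functional_I m \<Omega> f (\<lambda>x. - indicator (Ei i) x))"
proof -
  interpret doubling_space m by unfold_locales (rule outer doubling)+
  obtain C where C: "\<forall>x\<in>frontier \<Omega>. \<forall>r. 0 < r \<and> r \<le> diameter \<Omega> \<longrightarrow>
          codim1_hausdorff m (ball x r \<inter> frontier \<Omega>) \<le> ennreal C * (m (ball x r) / ennreal r)"
    using cond_iii by blast
  obtain b where b: "finite_cost (frontier \<Omega>) b"
    using finite_cost_frontier[OF Omega(2,3,1) C] by blast
  interpret boundary_setting m \<Omega> b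
    using Omega b cond_i by unfold_locales auto
  \<comment> \<open>Omega is bounded and so has finite measure; the indicator of a subset is thus
    integrable, and finite perimeter puts it into BV, where (ii) applies.\<close>
  have traces: "has_traces F" if F: "F \<subseteq> \<Omega>" "F \<in> sets M" "tv (indicator F) \<Omega> < \<infinity>" for F
  proof -
    have "set_integrable M \<Omega> (indicator F :: 'a \<Rightarrow> real)"
    proof -
      have "emeasure M (\<Omega> \<inter> F) < \<infinity>"
        using m_bounded_finite[of "\<Omega> \<inter> F"] Omega(2) F Omega_sets by (simp add: emeasure_M bounded_Int sets.Int)
      then have "integrable M (indicator (\<Omega> \<inter> F) :: 'a \<Rightarrow> real)"
        using F Omega_sets by (intro integrable_real_indicator) auto
      moreover have "(\<lambda>x. indicator \<Omega> x *\<^sub>R indicator F x) = (indicator (\<Omega> \<inter> F) :: 'a \<Rightarrow> real)"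
        by (auto simp: fun_eq_iff indicator_def)
      ultimately show ?thesis by (simp only: set_integrable_def)
    qed
    then have "BV_on m \<Omega> (indicator F)" using F by (simp add: BV_on_def TV_open Omega(3))
    from cond_ii[OF this] show ?thesis using F by (simp add: has_traces_def)
  qed
  have Ei: "has_traces (Ei i)" for i
    using Ei_perimeter[of i] Ei_sets by (intro traces) (simp_all add: perimeter_def TV_open Omega(3))
  let ?\<phi> = "\<lambda>x. indicator bd x * f x"
  have \<phi>m: "?\<phi> \<in> borel_measurable \<nu>"
    using borel_measurable_integrable[OF f_int[unfolded set_integrable_def perimeter_measure_eq]] by simp
  have \<phi>b: "AE x in \<nu>. -1 \<le> ?\<phi> x \<and> ?\<phi> x \<le> 1"
    using f_bound unfolding perimeter_measure_eq by eventually_elim (auto simp: indicator_def)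
  \<comment> \<open>E itself is not assumed to have finite perimeter. If its variation is infinite,
    so is the functional, because the boundary integral is a real number whatever its value.\<close>
  have E_val: "functional_I m \<Omega> f (indicator E) = (if tv (indicator E) \<Omega> < \<infinity> then ereal (val ?\<phi> E) else \<infinity>)"
    "functional_I m \<Omega> f (\<lambda>x. - indicator E x) = (if tv (indicator E) \<Omega> < \<infinity> then ereal (val (\<lambda>x. - ?\<phi> x) E) else \<infinity>)"
  proof -
    have "tv (\<lambda>x. - indicator E x) \<Omega> = tv (indicator E) \<Omega>"
      using tv_reflect[OF open_Omega, of 0 "indicator E"] by simp
    then show "functional_I m \<Omega> f (indicator E) = (if tv (indicator E) \<Omega> < \<infinity> then ereal (val ?\<phi> E) else \<infinity>)"
      "functional_I m \<Omega> f (\<lambda>x. - indicator E x) = (if tv (indicator E) \<Omega> < \<infinity> then ereal (val (\<lambda>x. - ?\<phi> x) E) else \<infinity>)"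
      using functional_I_eq_val[OF traces[OF E_sets] \<phi>m]
      by (auto simp: functional_I_def TV_open Omega(3) top.not_eq_extremum[symmetric])
  qed
  have neg: "(\<lambda>x. - ?\<phi> x) \<in> borel_measurable \<nu>" "AE x in \<nu>. -1 \<le> - ?\<phi> x \<and> - ?\<phi> x \<le> 1"
    using \<phi>m \<phi>b by (auto elim: eventually_mono)
  show ?thesis
    unfolding E_val functional_I_eq_val[OF Ei \<phi>m]
    using val_liminf[OF Ei E_sets traces[OF E_sets] Ei_conv \<phi>m \<phi>b]
      val_liminf[OF Ei E_sets traces[OF E_sets] Ei_conv neg] by blast
qed

end
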